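(* Let $K$ be an algebraic number field that is Galois over $\mathbb Q$, $\Gamma=\operatorname{Gal}(K/\mathbb Q)$, $\mathcal O_K$ its ring of integers, $\mathcal O$ a $\Gamma$-invariant order in $K$ with conductor $\mathfrak m=\{x\in \mathcal O_K : x\mathcal O_K\subset \mathcal O\}$, and let $m\in\mathbb N\cap\mathfrak m$. Let $N_m(K)$, $N_m^{(+)}(\mathcal O)$, the (narrow) class group $\mathcal C^{(+)}(\mathcal O)$, the monoid $\mathcal B_\Gamma(\mathcal C^{(+)}(\mathcal O))$, the family $(\mathfrak p_p)_{p\in\mathbb P_m}$ and the homomorphism $\Theta\colon N_m(K)\to\mathcal F(\mathcal C^{(+)}(\mathcal O))$ be as defined in the context. Then, in both the general and the totally positive version: 1. For every $n\in N_m(K)$: $n\in N_m^{(+)}(\mathcal O)$ if and only if $\Theta(n)\in\mathcal B_\Gamma(\mathcal C^{(+)}(\mathcal O))$. 2. The map $\theta=\Theta|_{N_m^{(+)}(\mathcal O)}\colon N_m^{(+)}(\mathcal O)\to\mathcal B_\Gamma(\mathcal C^{(+)}(\mathcal O))$ is a transfer homomorphism satisfying $\mathsf c(N_m^{(+)}(\mathcal O),\theta)\le 2$.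
   Context: **Superscript convention.** A superscript $(+)$ means that the statement is made simultaneously for two versions: the general one (no superscript) and the totally positive one (superscript $+$). $K^+$ is the group of totally positive elements of $K$ (nonzero elements positive under every real embedding), $\mathcal O^+=\mathcal O\cap K^+$; in the general version $K^{(+)}$ is $K^\times$ and $\mathcal O^{(+)}$ is $\mathcal O$ (zero excluded for generators of ideals). **Ideals.** $\mathscr I(\mathcal O)$ is the group of invertible fractional ideals of $\mathcal O$, $\mathscr H^{(+)}(\mathcal O)$ the subgroup of fractional principal ideals $a\mathcal O$ with $a\in K^{(+)}$, and $\mathcal C^{(+)}(\mathcal O)=\mathscr I(\mathcal O)/\mathscr H^{(+)}(\mathcal O)$ the (narrow) class group, written additively; it is a finite $\Gamma$-module, and $[\mathfrak a]^{(+)}$ denotes the class of $\mathfrak a$. $\mathscr P_m(\mathcal O)$ is the set of nonzero prime ideals of $\mathcal O$ coprime to $m\mathcal O_K$ and $\mathscr I_m(\mathcal O)$ the monoid of ideals $\mathfrak a$ of $\mathcal O$ coprime to $m\mathcal O_K$ (i.e. $\mathfrak a+m\mathcal O_K=\mathcal O$); these ideals are invertible, and $\mathscr I_m(\mathcal O)$ is free abelian with basis $\mathscr P_m(\mathcal O)$. $\mathscr H_m^{(+)}(\mathcal O)$ is the monoid of principal ideals $a\mathcal O$ coprime to $m\mathcal O_K$ with $a\in\mathcal O^{(+)}$. For $\mathfrak a\in \mathscr I_m(\mathcal O)$, $\mathfrak N(\mathfrak a)=|\mathcal O/\mathfrak a|$. **Norm monoids.** $\mathbb P_m$ is the set of primes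 not dividing $m$; $f_p$ is the inertia degree of $p$ in $K$; $\mathsf v_p$ is the $p$-adic exponent. $N_m(K)=\{n\in\mathbb N:\gcd(n,m)=1,\ f_p\mid \mathsf v_p(n)\text{ for all }p\in\mathbb P_m\}=\mathfrak N(\mathscr I_m(\mathcal O))$, the free abelian monoid with basis $\{p^{f_p}:p\in\mathbb P_m\}$. $N_m^{(+)}(\mathcal O)=\mathfrak N(\mathscr H_m^{(+)}(\mathcal O))$. **The map $\Theta$.** Every class in $\mathcal C^{(+)}(\mathcal O)$ contains infinitely many prime ideals of degree $1$. For every $p\in\mathbb P_m$ fix a prime ideal $\mathfrak p_p\in\mathscr P_m(\mathcal O)$ with $p\in \mathfrak p_p$, in such a way that $\{[\mathfrak p_p]^{(+)}:p\in\mathbb P_m,\ f_p=1\}=\mathcal C^{(+)}(\mathcal O)$. For a set $P$, $\mathcal F(P)$ denotes the (multiplicative) free abelian monoid with basis $P$. Define $\Theta(n)=\prod_{p\in\mathbb P_m}\bigl([\mathfrak p_p]^{(+)}\bigr)^{\mathsf v_p(n)/f_p}\in\mathcal F(\mathcal C^{(+)}(\mathcal O))$ (formal product). **Weighted zero-sum sequences.** For a finite abelian group $G$ and a set $\Gamma$ of endomorphisms of $G$ (here: those given by the action of the Galois group on $G=\mathcal C^{(+)}(\mathcal O)$), $\mathcal B_\Gamma(G)=\{g_1\cdot\ldots\cdot g_\ell\in\mathcal F(G):\ \ell\ge 0,\ \sum_{i=1}^\ell\gamma_i(g_i)=0\text{ for some }\gamma_1,\dots,\gamma_\ell\in\Gamma\}$.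 **Transfer homomorphisms.** A monoid is a commutative cancellative semigroup with identity; $H^\times$ is its group of units, $H_{\rm red}=\{aH^\times:a\in H\}$, and $\mathcal A(H)$ its set of atoms. A monoid homomorphism $\theta\colon H\to B$ is a transfer homomorphism if (T1) $B=\theta(H)B^\times$ and $\theta^{-1}(B^\times)=H^\times$; (T2) if $u\in H$, $b,c\in B$ and $\theta(u)=bc$, then there are $v,w\in H$ with $u=vw$, $\theta(v)\in bB^\times$, $\theta(w)\in cB^\times$. **Catenary degree in the fibres.** $\mathsf Z(H)=\mathcal F(\mathcal A(H_{\rm red}))$, with the canonical homomorphism $\pi\colon\mathsf Z(H)\to H_{\rm red}$, and $\mathsf Z(a)=\pi^{-1}(aH^\times)$ is the set of factorizations of $a$. The distance $\mathsf d(z,z')$ of $z,z'\in \mathsf Z(H)$ is $\max\{|z\gcd(z,z')^{-1}|,|z'\gcd(z,z')^{-1}|\}$, where $|\cdot|$ is length. For a transfer homomorphism $\theta\colon H\to B$ of atomic monoids, $\overline\theta\colon\mathsf Z(H)\to\mathsf Z(B)$ is the homomorphism with $\overline\theta(uH^\times)=\theta(u)B^\times$ for all $u\in\mathcal A(H)$. $\mathsf c(a,\theta)$ is the smallest $N\in\mathbb N_0\cup\{\infty\}$ such that whenever $z,z'\in\mathsf Z(a)$ with $\overline\theta(z)=\overline\theta(z')$, there are $z=z_0,\dots,z_k=z'$ in $\mathsf Z(a)$ with $\overline\theta(z_i)=\overline\theta(z)$ and $\mathsf d(z_{i-1},z_i)\le N$ for all $i\in[1,k]$. $\mathsf c(H,\theta)=\sup\{\mathsf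 c(a,\theta):a\in H\}$. *)

theory Defs
  imports
    "HOL-Algebra.Algebra"
    "HOL-Algebra.Algebraic_Closure_Type"
    "HOL-Library.Multiset"
    "HOL-Library.Extended_Nat"
begin

text \<open>A monoid is a \<^locale>\<open>comm_monoid_cancel\<close>. The group of units of \<open>H\<close> is
  \<^term>\<open>Units H\<close>, and the free abelian monoid with basis \<open>P\<close> is the set of multisets
  with all elements in \<open>P\<close>.\<close>

text \<open>\<^const>\<open>FactGroup\<close> is defined for arbitrary monoids; with the group of units it gives
  the monoid of the sets \<open>a Units(H)\<close> under elementwise multiplication.\<close>

definition reduced_monoid :: "('h, 'x) monoid_scheme \<Rightarrow> 'h set monoid" where
  "reduced_monoid H = H Mod (Units H)"

definition atoms :: "('h, 'x) monoid_scheme \<Rightarrow> 'h set" where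
  "atoms H = {u \<in> carrier H. Divisibility.irreducible H u}"

definition transfer_hom ::
    "('h, 'x) monoid_scheme \<Rightarrow> ('b, 'y) monoid_scheme \<Rightarrow> ('h \<Rightarrow> 'b) \<Rightarrow> bool" where
  "transfer_hom H B \<theta> \<longleftrightarrow>
     comm_monoid_cancel H \<and> comm_monoid_cancel B \<and>
     \<theta> \<in> hom H B \<and> \<theta> \<one>\<^bsub>H\<^esub> = \<one>\<^bsub>B\<^esub> \<and>
     carrier B = \<theta> ` carrier H <#>\<^bsub>B\<^esub> Units B \<and>
     {u \<in> carrier H. \<theta> u \<in> Units B} = Units H \<and>
     (\<forall>u\<in>carrier H. \<forall>b\<in>carrier B. \<forall>c\<in>carrier B. \<theta> u = b \<otimes>\<^bsub>B\<^esub> c \<longrightarrow>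
        (\<exists>v\<in>carrier H. \<exists>w\<in>carrier H. u = v \<otimes>\<^bsub>H\<^esub> w \<and>
           \<theta> v \<in> b <#\<^bsub>B\<^esub> Units B \<and> \<theta> w \<in> c <#\<^bsub>B\<^esub> Units B))"

definition factorization_monoid :: "('h, 'x) monoid_scheme \<Rightarrow> 'h set multiset set" where
  "factorization_monoid H = {z. set_mset z \<subseteq> atoms (reduced_monoid H)}"

definition factorization_value ::
    "('h, 'x) monoid_scheme \<Rightarrow> 'h set multiset \<Rightarrow> 'h set" where
  "factorization_value H z =
     finprod (reduced_monoid H) (\<lambda>u. u [^]\<^bsub>reduced_monoid H\<^esub> count z u) (set_mset z)"

definition factorizations ::
    "('h, 'x) monoid_scheme \<Rightarrow> 'h \<Rightarrow> 'h set multiset set" where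
  "factorizations H a =
     {z \<in> factorization_monoid H. factorization_value H z = Units H #>\<^bsub>H\<^esub> a}"

definition factorization_dist :: "'u multiset \<Rightarrow> 'u multiset \<Rightarrow> nat" where
  "factorization_dist z z' = max (size (z - (z \<inter># z'))) (size (z' - (z \<inter># z')))"

text \<open>For \<open>U = u Units(H)\<close> and a homomorphism \<open>\<theta>\<close>, the set \<open>\<theta>(U) Units(B)\<close> is the class
  \<open>\<theta>(u) Units(B)\<close>.\<close>

definition factorization_map ::
    "('b, 'y) monoid_scheme \<Rightarrow> ('h \<Rightarrow> 'b) \<Rightarrow> 'h set multiset \<Rightarrow> 'b set multiset" where
  "factorization_map B \<theta> z = image_mset (\<lambda>U. \<theta> ` U <#>\<^bsub>B\<^esub> Units B) z"

definition fibre_chain ::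
    "('h, 'x) monoid_scheme \<Rightarrow> ('b, 'y) monoid_scheme \<Rightarrow> ('h \<Rightarrow> 'b) \<Rightarrow> 'h \<Rightarrow> enat \<Rightarrow>
     'h set multiset \<Rightarrow> 'h set multiset \<Rightarrow> bool" where
  "fibre_chain H B \<theta> a N z z' \<longleftrightarrow>
     (\<exists>(k::nat) zs. zs 0 = z \<and> zs k = z' \<and>
        (\<forall>i\<le>k. zs i \<in> factorizations H a \<and>
           factorization_map B \<theta> (zs i) = factorization_map B \<theta> z) \<and>
        (\<forall>i\<in>{1..k}. enat (factorization_dist (zs (i - 1)) (zs i)) \<le> N))"

definition elem_fibre_catenary_degree ::
    "('h, 'x) monoid_scheme \<Rightarrow> ('b, 'y) monoid_scheme \<Rightarrow> ('h \<Rightarrow> 'b) \<Rightarrow> 'h \<Rightarrow> enat" where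
  "elem_fibre_catenary_degree H B \<theta> a =
     (LEAST N. \<forall>z\<in>factorizations H a. \<forall>z'\<in>factorizations H a.
        factorization_map B \<theta> z = factorization_map B \<theta> z' \<longrightarrow> fibre_chain H B \<theta> a N z z')"

definition fibre_catenary_degree ::
    "('h, 'x) monoid_scheme \<Rightarrow> ('b, 'y) monoid_scheme \<Rightarrow> ('h \<Rightarrow> 'b) \<Rightarrow> enat" where
  "fibre_catenary_degree H B \<theta> = (SUP a\<in>carrier H. elem_fibre_catenary_degree H B \<theta> a)"

text \<open>The abelian group \<open>G\<close> is written multiplicatively here, so that zero sums become
  products equal to \<open>\<one>\<close>.\<close>

definition weighted_zero_sum_monoid ::
    "('g, 'x) monoid_scheme \<Rightarrow> ('g \<Rightarrow> 'g) set \<Rightarrow> 'g multiset monoid" where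
  "weighted_zero_sum_monoid G \<Gamma> =
     \<lparr> carrier = {S. \<exists>(l::nat) g \<gamma>. S = mset (map g [0..<l]) \<and>
         (\<forall>i<l. g i \<in> carrier G \<and> \<gamma> i \<in> \<Gamma>) \<and>
         finprod G (\<lambda>i. \<gamma> i (g i)) {..<l} = \<one>\<^bsub>G\<^esub>},
       monoid.mult = (+),
       one = {#} \<rparr>"

text \<open>The field \<open>K\<close> is the type \<^typ>\<open>'a\<close>, of class \<^class>\<open>field_char_0\<close>.\<close>

definition number_field :: "'a::field_char_0 itself \<Rightarrow> bool" where
  "number_field _ \<longleftrightarrow>
     (\<exists>B::'a set. finite B \<and> module.span (\<lambda>(q::rat) x. of_rat q * x) B = UNIV)"

text \<open>Every ring automorphism of a field of characteristic zero fixes the rationals, so that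
  these are the elements of the Galois group over the rationals.\<close>

definition Gal :: "('a::field_char_0 \<Rightarrow> 'a) set" where
  "Gal = ring_iso ring_of_type_algebra ring_of_type_algebra"

definition galois_over_rat :: "'a::field_char_0 itself \<Rightarrow> bool" where
  "galois_over_rat _ \<longleftrightarrow> {x::'a. \<forall>\<gamma>\<in>Gal. \<gamma> x = x} = \<rat>"

abbreviation sub_ring :: "'a::field_char_0 set \<Rightarrow> 'a ring" where
  "sub_ring A \<equiv> ring_of_type_algebra\<lparr>carrier := A\<rparr>"

definition ring_of_integers :: "'a::field_char_0 set" where
  "ring_of_integers = {x. algebraic_int x}"

definition order_of_field :: "'a::field_char_0 set \<Rightarrow> bool" where
  "order_of_field \<O> \<longleftrightarrow>
     subring \<O> ring_of_type_algebra \<and>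
     (\<exists>B. finite B \<and> module.span (\<lambda>(k::int) x. of_int k * x) B = \<O>) \<and>
     module.span (\<lambda>(q::rat) x. of_rat q * x) \<O> = UNIV"

definition conductor :: "'a::field_char_0 set \<Rightarrow> 'a set" where
  "conductor \<O> = {x \<in> ring_of_integers. (*) x ` ring_of_integers \<subseteq> \<O>}"

datatype positivity = General | Totally_Positive

definition real_embeddings :: "('a::field_char_0 \<Rightarrow> real) set" where
  "real_embeddings = ring_hom ring_of_type_algebra ring_of_type_algebra"

fun K_elems :: "positivity \<Rightarrow> 'a::field_char_0 set" where
  "K_elems General = UNIV - {0}"
| "K_elems Totally_Positive = {x. x \<noteq> 0 \<and> (\<forall>\<sigma>\<in>real_embeddings. \<sigma> x > 0)}"

definition fractional_ideal :: "'a::field_char_0 set \<Rightarrow> 'a set \<Rightarrow> bool" where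
  "fractional_ideal \<O> I \<longleftrightarrow>
     subgroup I (add_monoid ring_of_type_algebra) \<and> I \<noteq> {0} \<and>
     (\<forall>r\<in>\<O>. \<forall>x\<in>I. r * x \<in> I) \<and>
     (\<exists>d\<in>\<O>. d \<noteq> 0 \<and> (*) d ` I \<subseteq> \<O>)"

text \<open>\<^const>\<open>ideal_prod\<close> over the ring \<open>K\<close> is the set of finite sums of products of elements
  of the two factors.\<close>

definition invertible_ideal_group :: "'a::field_char_0 set \<Rightarrow> 'a set monoid" where
  "invertible_ideal_group \<O> =
     \<lparr> carrier = {I. fractional_ideal \<O> I \<and>
         (\<exists>J. fractional_ideal \<O> J \<and> ideal_prod ring_of_type_algebra I J = \<O>)},
       monoid.mult = ideal_prod ring_of_type_algebra,
       one = \<O> \<rparr>"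

definition principal_fractional_ideals ::
    "positivity \<Rightarrow> 'a::field_char_0 set \<Rightarrow> 'a set set" where
  "principal_fractional_ideals s \<O> = {(*) a ` \<O> | a. a \<in> K_elems s}"

definition class_group :: "positivity \<Rightarrow> 'a::field_char_0 set \<Rightarrow> 'a set set monoid" where
  "class_group s \<O> = invertible_ideal_group \<O> Mod principal_fractional_ideals s \<O>"

definition ideal_class :: "positivity \<Rightarrow> 'a::field_char_0 set \<Rightarrow> 'a set \<Rightarrow> 'a set set" where
  "ideal_class s \<O> I = principal_fractional_ideals s \<O> #>\<^bsub>invertible_ideal_group \<O>\<^esub> I"

text \<open>An automorphism of \<open>K\<close> acts on elements, hence by taking images on ideals, hence by
  taking images again on classes of ideals.\<close>

definition Gal_on_classes :: "('a::field_char_0 set set \<Rightarrow> 'a set set) set" where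
  "Gal_on_classes = {(`) ((`) \<gamma>) | \<gamma>. \<gamma> \<in> Gal}"

definition coprime_to :: "nat \<Rightarrow> 'a::field_char_0 set \<Rightarrow> 'a set \<Rightarrow> bool" where
  "coprime_to m \<O> I \<longleftrightarrow> I <+>\<^bsub>ring_of_type_algebra\<^esub> ((*) (of_nat m) ` ring_of_integers) = \<O>"

definition coprime_prime_ideals :: "nat \<Rightarrow> 'a::field_char_0 set \<Rightarrow> 'a set set" where
  "coprime_prime_ideals m \<O> = {P. primeideal P (sub_ring \<O>) \<and> P \<noteq> {0} \<and> coprime_to m \<O> P}"

definition coprime_principal_ideals ::
    "positivity \<Rightarrow> nat \<Rightarrow> 'a::field_char_0 set \<Rightarrow> 'a set set" where
  "coprime_principal_ideals s m \<O> =
     {(*) a ` \<O> | a. a \<in> \<O> \<inter> K_elems s \<and> coprime_to m \<O> ((*) a ` \<O>)}"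

definition ideal_norm :: "'a::field_char_0 set \<Rightarrow> 'a set \<Rightarrow> nat" where
  "ideal_norm \<O> I = card (carrier (sub_ring \<O> Quot I))"

definition primes_not_dividing :: "nat \<Rightarrow> nat set" where
  "primes_not_dividing m = {p. Factorial_Ring.prime p \<and> \<not> p dvd m}"

text \<open>The degree of the residue field over its prime field, the image of the integers.\<close>

definition residue_degree :: "'a::field_char_0 set \<Rightarrow> nat" where
  "residue_degree P =
     (let F = sub_ring ring_of_integers Quot P
      in ring.dim F (range (\<lambda>k::int. P +>\<^bsub>sub_ring ring_of_integers\<^esub> of_int k)) (carrier F))"

text \<open>The common residue degree of all prime ideals above \<open>p\<close>; it is well defined if \<open>K\<close> is
  Galois over the rationals.\<close>

definition inertia_degree :: "'a::field_char_0 itself \<Rightarrow> nat \<Rightarrow> nat" where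
  "inertia_degree _ p =
     (THE f. \<forall>P::'a set. primeideal P (sub_ring ring_of_integers) \<and> of_nat p \<in> P \<longrightarrow>
        residue_degree P = f)"

definition field_norms :: "'a::field_char_0 itself \<Rightarrow> nat \<Rightarrow> nat set" where
  "field_norms K m =
     {n. n > 0 \<and> coprime n m \<and>
         (\<forall>p\<in>primes_not_dividing m. inertia_degree K p dvd multiplicity p n)}"

definition principal_norm_monoid ::
    "positivity \<Rightarrow> nat \<Rightarrow> 'a::field_char_0 set \<Rightarrow> nat monoid" where
  "principal_norm_monoid s m \<O> =
     \<lparr> carrier = ideal_norm \<O> ` coprime_principal_ideals s m \<O>,
       monoid.mult = (*),
       one = 1 \<rparr>"

text \<open>\<open>\<pp> p\<close> is the chosen prime ideal above \<open>p\<close>. The formal product over all primes not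
  dividing \<open>m\<close> has non-trivial factors only at the prime divisors of \<open>n\<close>.\<close>

definition Theta ::
    "positivity \<Rightarrow> nat \<Rightarrow> 'a::field_char_0 set \<Rightarrow> (nat \<Rightarrow> 'a set) \<Rightarrow> nat \<Rightarrow>
     'a set set multiset" where
  "Theta s m \<O> \<pp> n =
     (\<Sum>p\<in>{p \<in> primes_not_dividing m. p dvd n}.
        replicate_mset (multiplicity p n div inertia_degree TYPE('a) p) (ideal_class s \<O> (\<pp> p)))"

definition prime_ideal_choice ::
    "positivity \<Rightarrow> nat \<Rightarrow> 'a::field_char_0 set \<Rightarrow> (nat \<Rightarrow> 'a set) \<Rightarrow> bool" where
  "prime_ideal_choice s m \<O> \<pp> \<longleftrightarrow>
     (\<forall>p\<in>primes_not_dividing m. \<pp> p \<in> coprime_prime_ideals m \<O> \<and> of_nat p \<in> \<pp> p) \<and>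
     {ideal_class s \<O> (\<pp> p) | p. p \<in> primes_not_dividing m \<and> inertia_degree TYPE('a) p = 1} =
       carrier (class_group s \<O>)"

end

theory Submission
  imports Defs "Jordan_Normal_Form.Char_Poly"
begin

text \<open>
  Let \<open>f\<^sub>p\<close> be the inertia degree of a rational prime \<open>p\<close> and \<open>\<pp>\<^sub>p\<close> the chosen prime ideal
  above \<open>p\<close>, for \<open>p\<close> not dividing \<open>m\<close>. An ideal of \<open>\<O>\<close> that is coprime to \<open>m\<close> is a product
  \<open>P\<^sub>1 \<star> ... \<star> P\<^sub>l\<close> of prime ideals coprime to \<open>m\<close>. The Galois group permutes the prime ideals
  above a rational prime transitively, so that \<open>P\<^sub>i\<close> is the image of some \<open>\<pp>\<^sub>p\<close> under some
  automorphism \<open>\<gamma>\<^sub>i\<close>, where \<open>p\<close> is the rational prime below \<open>P\<^sub>i\<close>; and the norm of \<open>P\<^sub>i\<close> is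
  \<open>p\<close> to the power \<open>f\<^sub>p\<close>. Hence the norm of the product determines the multiset of the rational
  primes below the factors, and says nothing about the automorphisms. The class of the product is
  the sum of the classes of the \<open>\<pp>\<^sub>p\<close>, each moved by its \<open>\<gamma>\<^sub>i\<close>. A product of powers of the form
  \<open>p\<close> to the \<open>f\<^sub>p\<close> is therefore the norm of a principal ideal with an admissible generator if and
  only if the classes of the corresponding \<open>\<pp>\<^sub>p\<close>, repeated accordingly, can be moved by
  automorphisms so that their sum vanishes. This is the first assertion; its two directions are
  \<open>principal_norm_imp_zero_sum\<close> and \<open>zero_sum_imp_principal_norm\<close>.

  For the second assertion the arithmetic can be forgotten. The numbers \<open>p\<close> to the \<open>f\<^sub>p\<close> generate
  a free monoid, so that norms are multisets \<open>U\<close> of rational primes, and \<open>\<Theta>\<close> replaces each prime in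
  \<open>U\<close> by the class of \<open>\<pp>\<^sub>p\<close>. By the first assertion the norms of principal ideals are the full
  preimage of the monoid of weighted zero-sum sequences, and every class is hit by assumption. For a
  full preimage under a map of free monoids that sends basis elements to basis elements, a
  decomposition of the image lifts to a decomposition of \<open>U\<close> (\<open>transfer_hom_theta\<close>). Two
  factorizations with the same image have factors that differ only in the choice of primes within
  the same classes; exchanging two primes of one class between two factors changes only those two
  factors, and finitely many such exchanges lead from one factorization to the other
  (\<open>class_swap_connected\<close>), so that steps of distance two suffice
  (\<open>fibre_catenary_degree_le_2\<close>).

  The arithmetic part rests on the inclusion of \<open>m\<close> times the ring of integers in \<open>\<O>\<close>. An ideal
  coprime to \<open>m\<close> contains \<open>a\<close> with \<open>1 = a + m c\<close> and \<open>c\<close> in \<open>\<O>\<close>, and so an integral element that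
  stabilizes such an ideal lies in \<open>\<O>\<close> (\<open>multiplier_integral\<close>). This replaces integral closedness
  in the classical proof that prime ideals are invertible and that ideals factor into prime ideals
  (\<open>prime_invertible\<close>, \<open>prime_factorization\<close>). Norms are multiplicative on products of invertible
  prime ideals (\<open>index_lprod\<close>), transitivity of the Galois group is \<open>Gal_transitive\<close>, and the norm
  of a prime ideal is computed in \<open>index_prime_eq_power\<close>, by comparing its residue field with that
  of a prime ideal of the ring of integers.
\<close>

section \<open>Transfer from a free monoid\<close>

text \<open>The step of the chains below. It keeps the sum and the image of the family \<open>Z\<close>, and as all but two
  members stay in place, it has distance at most two.\<close>

definition class_swap :: "('p \<Rightarrow> 'g) \<Rightarrow> 'p multiset multiset \<Rightarrow> 'p multiset multiset \<Rightarrow> bool" where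
  "class_swap \<phi> Z Z' \<longleftrightarrow> (\<exists>R u v u' v'. Z = R + {#u, v#} \<and> Z' = R + {#u', v'#} \<and> u + v = u' + v' \<and>
     image_mset \<phi> u = image_mset \<phi> u' \<and> image_mset \<phi> v = image_mset \<phi> v')"

text \<open>Both multisets contain equally many elements of each class, so that an excess of \<open>p\<close> on one side
  is made up for by an excess of another element of the same class on the other side.\<close>

lemma compensating_element:
  assumes eq: "image_mset \<phi> u = image_mset \<phi> u'" and p: "count u p < count u' p"
  obtains q where "\<phi> q = \<phi> p" "count u' q < count u q"
proof (rule ccontr)
  assume "\<not> thesis"
  with that have le: "\<And>q. \<phi> q = \<phi> p \<Longrightarrow> count u q \<le> count u' q"
    by (meson not_le)
  have sub: "filter_mset (\<lambda>q. \<phi> q = \<phi> p) u \<subseteq># filter_mset (\<lambda>q. \<phi> q = \<phi> p) u'"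
    by (rule mset_subset_eqI) (simp add: le)
  have ne: "filter_mset (\<lambda>q. \<phi> q = \<phi> p) u \<noteq> filter_mset (\<lambda>q. \<phi> q = \<phi> p) u'"
  proof
    assume "filter_mset (\<lambda>q. \<phi> q = \<phi> p) u = filter_mset (\<lambda>q. \<phi> q = \<phi> p) u'"
    then have "count (filter_mset (\<lambda>q. \<phi> q = \<phi> p) u) p = count (filter_mset (\<lambda>q. \<phi> q = \<phi> p) u') p"
      by simp
    then show False using p by simp
  qed
  have "filter_mset (\<lambda>q. \<phi> q = \<phi> p) u \<subset># filter_mset (\<lambda>q. \<phi> q = \<phi> p) u'"
    using sub ne by (simp add: subset_mset.less_le)
  then have "size (filter_mset (\<lambda>q. \<phi> q = \<phi> p) u) < size (filter_mset (\<lambda>q. \<phi> q = \<phi> p) u')"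
    by (rule mset_subset_size)
  moreover have "size (filter_mset (\<lambda>q. \<phi> q = \<phi> p) w) = size (filter_mset (\<lambda>c. c = \<phi> p) (image_mset \<phi> w))" for w
    by (simp add: filter_mset_image_mset)
  ultimately show False using eq by simp
qed

lemma mset_two_updates:
  assumes "i < length us" "j < length us" "i \<noteq> j"
  shows "\<exists>R. \<forall>x y. mset (us[i := x, j := y]) = R + {#x, y#}"
proof -
  have base: "{#us ! i, us ! j#} \<subseteq># mset us"
  proof -
    have "mset us = {#us ! i#} + mset (take i us @ drop (Suc i) us)"
      using assms by (metis id_take_nth_drop union_commute mset_append mset.simps(2) add_mset_add_single union_assoc)
    moreover have "us ! j \<in># mset (take i us @ drop (Suc i) us)"
    proof (cases "j < i")
      case True
      then have "take i us ! j = us ! j" "j < length (take i us)" using assms by auto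
      then show ?thesis by (metis in_multiset_in_set nth_mem mset_append union_iff)
    next
      case False
      then have "drop (Suc i) us ! (j - Suc i) = us ! j" "j - Suc i < length (drop (Suc i) us)"
        using assms by auto
      then show ?thesis by (metis in_multiset_in_set nth_mem mset_append union_iff)
    qed
    ultimately show ?thesis by (auto simp: mset_subset_eq_single)
  qed
  then obtain R where R: "mset us = R + {#us ! i, us ! j#}"
    by (metis subset_mset.le_iff_add union_commute)
  have "mset (us[i := x, j := y]) = R + {#x, y#}" for x y
  proof -
    have "us[i := x] ! j = us ! j" using assms by simp
    then have "mset (us[i := x, j := y]) = add_mset y (add_mset x (mset us - {#us ! i#}) - {#us ! j#})"
      using assms by (simp add: mset_update)
    then show ?thesis unfolding R by (auto simp: add_mset_commute)
  qed
  then show ?thesis by blast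
qed

text \<open>As long as the families differ, some \<open>u\<^sub>i\<close> lacks a \<open>p\<close> that \<open>v\<^sub>i\<close> has, and has a \<open>q\<close> of the same
  class too many. Since the total number of \<open>p\<close>s agrees, some other \<open>u\<^sub>j\<close> has a \<open>p\<close> too many.
  Exchanging \<open>q\<close> for \<open>p\<close> between \<open>u\<^sub>i\<close> and \<open>u\<^sub>j\<close> lowers the total size of the differences
  \<open>u\<^sub>k - v\<^sub>k\<close>: it drops at \<open>i\<close>, and at \<open>j\<close> the removed \<open>p\<close> makes up for the added \<open>q\<close>.\<close>

lemma class_swap_connected:
  fixes us vs :: "'p multiset list"
  assumes "map (image_mset \<phi>) us = map (image_mset \<phi>) vs" "sum_list us = sum_list vs"
  shows "(class_swap \<phi>)\<^sup>*\<^sup>* (mset us) (mset vs)"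
  using assms
proof (induction "\<Sum>i<length us. size (us ! i - vs ! i)" arbitrary: us rule: less_induct)
  case less
  have len: "length us = length vs" using less.prems(1) map_eq_imp_length_eq by blast
  have img: "image_mset \<phi> (us ! i) = image_mset \<phi> (vs ! i)" if "i < length us" for i
    using less.prems(1) that len by (metis nth_map)
  have sums: "(\<Sum>i<length us. count (us ! i) p) = (\<Sum>i<length us. count (vs ! i) p)" for p
  proof -
    have "count (sum_list ws) p = (\<Sum>i<length ws. count (ws ! i) p)" for ws :: "'p multiset list"
      by (simp add: sum_list_sum_nth count_sum atLeast0LessThan)
    then show ?thesis using less.prems(2) len by metis
  qed
  show ?case
  proof (cases "us = vs")
    case True then show ?thesis by simp
  next
    case False
    then obtain i where i: "i < length us" "us ! i \<noteq> vs ! i"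
      using len by (meson nth_equalityI)
    have "size (us ! i) = size (vs ! i)" using img[OF i(1)] by (metis size_image_mset)
    then have "\<not> vs ! i \<subseteq># us ! i"
      using i(2) by (metis mset_subset_size subset_mset.less_le less_irrefl)
    then obtain p where p: "count (us ! i) p < count (vs ! i) p"
      by (meson mset_subset_eqI not_le)
    obtain q where q: "\<phi> q = \<phi> p" "count (vs ! i) q < count (us ! i) q"
      using compensating_element[OF img[OF i(1)] p] by blast
    have "\<exists>j<length us. count (vs ! j) p < count (us ! j) p"
    proof (rule ccontr)
      assume "\<not> ?thesis"
      then have "\<forall>j<length us. count (us ! j) p \<le> count (vs ! j) p" by (meson not_le)
      then have "(\<Sum>i<length us. count (us ! i) p) < (\<Sum>i<length us. count (vs ! i) p)"
        using i(1) p by (intro sum_strict_mono_ex1) auto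
      then show False using sums by simp
    qed
    then obtain j where j: "j < length us" "count (vs ! j) p < count (us ! j) p" by blast
    have ij: "i \<noteq> j" using j p by auto
    have pq: "p \<noteq> q" using p q by auto
    define u where "u = add_mset p (us ! i - {#q#})"
    define v where "v = add_mset q (us ! j - {#p#})"
    define us' where "us' = us[i := u, j := v]"
    have qi: "q \<in># us ! i" and pj: "p \<in># us ! j"
      using q(2) j(2) by (metis count_inI not_less_zero)+
    have im_u: "image_mset \<phi> u = image_mset \<phi> (us ! i)"
      using qi q(1) unfolding u_def by (metis image_mset_add_mset insert_DiffM)
    have im_v: "image_mset \<phi> v = image_mset \<phi> (us ! j)"
      using pj q(1) unfolding v_def by (metis image_mset_add_mset insert_DiffM)
    have uv: "u + v = us ! i + us ! j"
      using qi pj unfolding u_def v_def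
      by (auto dest!: multi_member_split)
    have len': "length us' = length us" by (simp add: us'_def)
    have img': "map (image_mset \<phi>) us' = map (image_mset \<phi>) vs"
    proof -
      have "map (image_mset \<phi>) us' = map (image_mset \<phi>) us"
        unfolding us'_def map_update im_u im_v by (metis list_update_id map_update)
      then show ?thesis using less.prems(1) by simp
    qed
    obtain R where R: "\<And>x y. mset (us[i := x, j := y]) = R + {#x, y#}"
      using mset_two_updates[OF i(1) j(1) ij] by blast
    have mus: "mset us = R + {#us ! i, us ! j#}" using R[of "us ! i" "us ! j"] by simp
    have mus': "mset us' = R + {#u, v#}" unfolding us'_def by (rule R)
    have sum': "sum_list us' = sum_list vs"
    proof -
      have "sum_list us' = sum_list us"
        unfolding sum_mset_sum_list[symmetric] mus mus' using uv by simp
      then show ?thesis using less.prems(2) by simp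
    qed
    have step: "class_swap \<phi> (mset us) (mset us')"
      unfolding class_swap_def mus mus' using uv im_u im_v by metis
    have decr: "(\<Sum>k<length us'. size (us' ! k - vs ! k)) < (\<Sum>k<length us. size (us ! k - vs ! k))"
    proof -
      have u_less: "size (u - vs ! i) < size (us ! i - vs ! i)"
      proof -
        have "u - vs ! i = us ! i - vs ! i - {#q#}"
          by (rule multiset_eqI) (use p pq in \<open>auto simp: u_def\<close>)
        moreover have "q \<in># us ! i - vs ! i" using q(2) by (simp add: in_diff_count)
        ultimately show ?thesis by (metis size_Diff1_less)
      qed
      have v_le: "size (v - vs ! j) \<le> size (us ! j - vs ! j)"
      proof -
        have "v - vs ! j \<subseteq># add_mset q (us ! j - vs ! j - {#p#})"
          by (rule mset_subset_eqI) (auto simp: v_def)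
        then have "size (v - vs ! j) \<le> Suc (size (us ! j - vs ! j - {#p#}))"
          by (metis size_add_mset size_mset_mono)
        moreover have "p \<in># us ! j - vs ! j" using j(2) by (simp add: in_diff_count)
        then obtain M where "us ! j - vs ! j = add_mset p M" by (meson multi_member_split)
        ultimately show ?thesis by simp
      qed
      have "size (us' ! k - vs ! k) \<le> size (us ! k - vs ! k)" if "k < length us" for k
        using that u_less v_le ij by (cases "k = i"; cases "k = j") (auto simp: us'_def)
      moreover have "size (us' ! i - vs ! i) < size (us ! i - vs ! i)"
        using u_less ij i(1) by (simp add: us'_def)
      ultimately show ?thesis unfolding len'
        using i(1) by (intro sum_strict_mono_ex1) auto
    qed
    have "(class_swap \<phi>)\<^sup>*\<^sup>* (mset us') (mset vs)"
      by (rule less.hyps[OF decr img' sum'])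
    then show ?thesis using step by (meson converse_rtranclp_into_rtranclp)
  qed
qed

lemma lift_list:
  assumes "image_mset f M = mset xs" obtains ys where "mset ys = M" "map f ys = xs"
proof -
  have "\<exists>ys. mset ys = M \<and> map f ys = xs" using assms
  proof (induction xs arbitrary: M)
    case Nil then show ?case by simp
  next
    case (Cons x xs)
    then obtain N a where N: "M = add_mset a N" "f a = x" "image_mset f N = mset xs"
      by (metis mset.simps(2) msed_map_invR)
    then obtain ys where "mset ys = N" "map f ys = xs" using Cons.IH by blast
    then show ?case using N by (intro exI[of _ "a # ys"]) simp
  qed
  then show thesis using that by blast
qed

text \<open>\<open>\<nu>\<close> is an isomorphism of the free monoid on \<open>P\<close> with a multiplicative monoid, \<open>\<phi>\<close> assigns a class to
  each element of \<open>P\<close>, and \<open>CB\<close> is a monoid of multisets of classes. The monoid \<open>H\<close> below is the full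
  preimage of \<open>CB\<close> under the induced map \<open>\<theta>\<close>. In the application, \<open>P\<close> consists of rational primes,
  \<open>\<nu>\<close> multiplies prime powers, and \<open>CB\<close> consists of the weighted zero-sum sequences.\<close>

locale block_lift =
  fixes P :: "'p set" and \<nu> :: "'p multiset \<Rightarrow> 'h::comm_monoid_mult" and \<phi> :: "'p \<Rightarrow> 'g"
    and CB :: "'g multiset set" and \<theta> :: "'h \<Rightarrow> 'g multiset"
  assumes inj: "inj_on \<nu> {U. set_mset U \<subseteq> P}"
    and nu_empty: "\<nu> {#} = 1"
    and nu_add: "set_mset U \<subseteq> P \<Longrightarrow> set_mset V \<subseteq> P \<Longrightarrow> \<nu> (U + V) = \<nu> U * \<nu> V"
    and theta_nu: "set_mset U \<subseteq> P \<Longrightarrow> \<theta> (\<nu> U) = image_mset \<phi> U"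
    and CB_empty: "{#} \<in> CB"
    and CB_add: "S \<in> CB \<Longrightarrow> T \<in> CB \<Longrightarrow> S + T \<in> CB"
    and CB_lifts: "S \<in> CB \<Longrightarrow> set_mset S \<subseteq> \<phi> ` P"
begin

definition D where "D = {U. set_mset U \<subseteq> P \<and> image_mset \<phi> U \<in> CB}"

definition H :: "'h monoid" where
  "H = \<lparr>carrier = \<nu> ` D, monoid.mult = (*), one = 1\<rparr>"

definition B :: "'g multiset monoid" where
  "B = \<lparr>carrier = CB, monoid.mult = (+), one = {#}\<rparr>"

lemma D_sub: "U \<in> D \<Longrightarrow> set_mset U \<subseteq> P" by (simp add: D_def)
lemma D_empty: "{#} \<in> D" by (simp add: D_def CB_empty)
lemma D_add: "U \<in> D \<Longrightarrow> V \<in> D \<Longrightarrow> U + V \<in> D" by (auto simp: D_def CB_add)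

lemma nu_add_D: "U \<in> D \<Longrightarrow> V \<in> D \<Longrightarrow> \<nu> (U + V) = \<nu> U * \<nu> V"
  by (simp add: D_sub nu_add)

lemma nu_eq_iff: "U \<in> D \<Longrightarrow> V \<in> D \<Longrightarrow> \<nu> U = \<nu> V \<longleftrightarrow> U = V"
  using inj_onD[OF inj, of U V] by (auto dest: D_sub)

lemma theta_D: "U \<in> D \<Longrightarrow> \<theta> (\<nu> U) = image_mset \<phi> U"
  by (simp add: D_sub theta_nu)

lemma carrier_H: "carrier H = \<nu> ` D" and mult_H: "monoid.mult H = (*)" and one_H: "monoid.one H = 1"
  by (simp_all add: H_def)

lemma carrier_B: "carrier B = CB" and mult_B: "monoid.mult B = (+)" and one_B: "monoid.one B = {#}"
  by (simp_all add: B_def)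

lemma lift:
  assumes "S \<in> CB" obtains U where "U \<in> D" "image_mset \<phi> U = S"
proof -
  have "\<exists>U. set_mset U \<subseteq> P \<and> image_mset \<phi> U = S" using CB_lifts[OF assms]
  proof (induction S)
    case empty then show ?case by auto
  next
    case (add g S)
    then obtain U p where "set_mset U \<subseteq> P" "image_mset \<phi> U = S" "p \<in> P" "\<phi> p = g" by auto
    then show ?case by (intro exI[of _ "add_mset p U"]) auto
  qed
  then show thesis using that assms by (auto simp: D_def)
qed

lemma comm_monoid_cancel_H: "comm_monoid_cancel H"
proof (rule comm_monoid_cancelI)
  show "comm_monoid H"
  proof (rule comm_monoidI)
    show "x \<otimes>\<^bsub>H\<^esub> y \<in> carrier H" if xy: "x \<in> carrier H" "y \<in> carrier H" for x y
    proof -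
      obtain U V where "U \<in> D" "V \<in> D" "x = \<nu> U" "y = \<nu> V" using xy by (auto simp: carrier_H)
      then show ?thesis using D_add[of U V] by (auto simp: carrier_H mult_H nu_add_D[symmetric])
    qed
    show "\<one>\<^bsub>H\<^esub> \<in> carrier H" unfolding carrier_H one_H using nu_empty D_empty by (metis imageI)
  qed (auto simp: mult_H one_H ac_simps)
next
  fix a b c assume eq: "a \<otimes>\<^bsub>H\<^esub> c = b \<otimes>\<^bsub>H\<^esub> c" and abc: "a \<in> carrier H" "b \<in> carrier H" "c \<in> carrier H"
  obtain U V W where "U \<in> D" "V \<in> D" "W \<in> D" "a = \<nu> U" "b = \<nu> V" "c = \<nu> W"
    using abc by (auto simp: carrier_H)
  then show "a = b" using eq by (simp add: mult_H nu_add_D[symmetric] nu_eq_iff D_add)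
qed

lemma comm_monoid_cancel_B: "comm_monoid_cancel B"
proof (rule comm_monoid_cancelI)
  show "comm_monoid B"
    by (rule comm_monoidI) (auto simp: carrier_B mult_B one_B CB_add CB_empty)
qed (auto simp: mult_B)

lemma nu_eq_one: "U \<in> D \<Longrightarrow> \<nu> U = 1 \<longleftrightarrow> U = {#}"
  using nu_eq_iff[OF _ D_empty] nu_empty by simp

lemma theta_one: "\<theta> 1 = {#}"
  using theta_nu[of "{#}"] nu_empty by simp

lemma Units_H: "Units H = {1}"
proof -
  have "U = {#}" if "U \<in> D" "V \<in> D" "\<nu> U * \<nu> V = 1" for U V
    using that by (metis D_add nu_add_D nu_eq_one empty_eq_union)
  then have "x = 1" if "x \<in> Units H" for x
    using that nu_empty unfolding Units_def carrier_H mult_H one_H by (auto simp: mult.commute)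
  moreover have "1 \<in> Units H"
  proof -
    interpret comm_monoid_cancel H by (rule comm_monoid_cancel_H)
    show ?thesis using Units_one_closed by (simp add: one_H)
  qed
  ultimately show ?thesis by blast
qed

lemma Units_B: "Units B = {{#}}"
  using CB_empty by (auto simp: Units_def carrier_B mult_B one_B)

text \<open>A decomposition \<open>b + c\<close> of the image of a multiset \<open>U\<close> comes from a decomposition of \<open>U\<close> itself,
  and its parts lie in the preimage of \<open>CB\<close> because \<open>b\<close> and \<open>c\<close> lie in \<open>CB\<close>.\<close>

lemma transfer_hom_theta: "transfer_hom H B \<theta>"
proof -
  have "\<theta> \<in> hom H B"
    by (rule homI) (auto simp: carrier_H carrier_B mult_H mult_B theta_nu nu_add[symmetric] D_def)
  moreover have "\<theta> \<one>\<^bsub>H\<^esub> = \<one>\<^bsub>B\<^esub>"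
    using theta_nu[of "{#}"] nu_empty by (simp add: one_H one_B)
  moreover have "carrier B = \<theta> ` carrier H <#>\<^bsub>B\<^esub> Units B"
  proof -
    have "\<theta> ` carrier H = CB"
    proof
      show "\<theta> ` carrier H \<subseteq> CB" by (auto simp: carrier_H theta_D) (simp add: D_def)
      show "CB \<subseteq> \<theta> ` carrier H"
      proof
        fix S assume "S \<in> CB"
        then obtain U where "U \<in> D" "image_mset \<phi> U = S" by (rule lift)
        then show "S \<in> \<theta> ` carrier H" unfolding carrier_H by (metis theta_D imageI)
      qed
    qed
    then show ?thesis by (simp add: set_mult_def Units_B mult_B carrier_B)
  qed
  moreover have "{u \<in> carrier H. \<theta> u \<in> Units B} = Units H"
    using D_empty nu_empty theta_one
    by (auto simp: carrier_H Units_B Units_H theta_D nu_eq_one image_iff)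
  moreover have "\<exists>v\<in>carrier H. \<exists>w\<in>carrier H. u = v \<otimes>\<^bsub>H\<^esub> w \<and>
           \<theta> v \<in> b <#\<^bsub>B\<^esub> Units B \<and> \<theta> w \<in> c <#\<^bsub>B\<^esub> Units B"
    if u: "u \<in> carrier H" and bc: "b \<in> carrier B" "c \<in> carrier B" "\<theta> u = b \<otimes>\<^bsub>B\<^esub> c" for u b c
  proof -
    obtain U where U: "U \<in> D" "u = \<nu> U" using u by (auto simp: carrier_H)
    then have "image_mset \<phi> U = b + c" using bc(3) by (simp add: theta_D mult_B)
    then obtain V W where VW: "U = V + W" "b = image_mset \<phi> V" "c = image_mset \<phi> W"
      using image_mset_eq_plusD by metis
    then have "V \<in> D" "W \<in> D" using U(1) bc(1,2) by (auto simp: D_def carrier_B)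
    then show ?thesis using U VW
      by (intro bexI[of _ "\<nu> V"] bexI[of _ "\<nu> W"])
        (auto simp: carrier_H mult_H nu_add_D theta_D l_coset_def Units_B mult_B)
  qed
  ultimately show ?thesis
    unfolding transfer_hom_def using comm_monoid_cancel_H comm_monoid_cancel_B by blast
qed

abbreviation "Hred \<equiv> reduced_monoid H"

lemma carrier_red: "carrier Hred = (\<lambda>U. {\<nu> U}) ` D"
  by (auto simp: reduced_monoid_def FactGroup_def RCOSETS_def r_coset_def Units_H carrier_H mult_H)

lemma mult_red: "{a} \<otimes>\<^bsub>Hred\<^esub> {b} = {a * b}"
  by (simp add: reduced_monoid_def FactGroup_def set_mult_def mult_H)

lemma one_red: "\<one>\<^bsub>Hred\<^esub> = {1}"
  by (simp add: reduced_monoid_def FactGroup_def Units_H)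

lemma comm_monoid_red: "comm_monoid Hred"
proof (rule comm_monoidI)
  show "\<one>\<^bsub>Hred\<^esub> \<in> carrier Hred"
    unfolding carrier_red one_red using D_empty nu_empty by (metis imageI)
qed (auto simp: carrier_red mult_red one_red nu_add_D[symmetric] D_add ac_simps)

lemma Units_red: "Units Hred = {{1}}"
proof -
  have "U = {#}" if "U \<in> D" "V \<in> D" "\<nu> U * \<nu> V = 1" for U V
    using that by (metis D_add nu_add_D nu_eq_one empty_eq_union)
  then have "A = {1}" if A: "A \<in> Units Hred" for A
  proof -
    obtain U V where UV: "U \<in> D" "V \<in> D" "A = {\<nu> U}" "{\<nu> U * \<nu> V} = {1}"
      using A unfolding Units_def carrier_red one_red by (auto simp: mult_red)
    then show ?thesis using \<open>\<And>U V. U \<in> D \<Longrightarrow> V \<in> D \<Longrightarrow> \<nu> U * \<nu> V = 1 \<Longrightarrow> U = {#}\<close>[of U V] nu_empty by simp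
  qed
  moreover have "{1} \<in> Units Hred"
  proof -
    interpret comm_monoid Hred by (rule comm_monoid_red)
    show ?thesis using Units_one_closed by (simp add: one_red)
  qed
  ultimately show ?thesis by blast
qed

text \<open>The atoms of \<open>H\<close>, described in the free monoid: as \<open>1\<close> is the only unit of \<open>H\<close>, the reduced
  monoid of \<open>H\<close> consists of the singletons of elements of \<open>H\<close>.\<close>

definition atomD :: "'p multiset \<Rightarrow> bool" where
  "atomD U \<longleftrightarrow> U \<in> D \<and> U \<noteq> {#} \<and> (\<forall>V\<in>D. \<forall>W\<in>D. U = V + W \<longrightarrow> V = {#} \<or> W = {#})"

lemma divides_red:
  assumes "U \<in> D" "V \<in> D"
  shows "{\<nu> V} divides\<^bsub>Hred\<^esub> {\<nu> U} \<longleftrightarrow> (\<exists>W\<in>D. U = V + W)"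
  using assms unfolding factor_def carrier_red
  by (auto simp: mult_red nu_add_D[symmetric] nu_eq_iff D_add)

lemma atoms_red: "atoms Hred = (\<lambda>U. {\<nu> U}) ` {U. atomD U}"
proof -
  have "Divisibility.irreducible Hred {\<nu> U} \<longleftrightarrow> atomD U" if U: "U \<in> D" for U
  proof -
    have "Divisibility.irreducible Hred {\<nu> U} \<longleftrightarrow>
        U \<noteq> {#} \<and> (\<forall>V\<in>D. (\<exists>W\<in>D. U = V + W) \<and> \<not> (\<exists>W\<in>D. V = U + W) \<longrightarrow> V = {#})"
      unfolding irreducible_def Units_red carrier_red properfactor_def ball_simps(9)
      using U by (simp add: divides_red nu_eq_one cong: ball_cong)
    also have "\<dots> \<longleftrightarrow> atomD U"
    proof -
      have "(\<exists>Y\<in>D. V = U + Y) \<longleftrightarrow> W = {#}" if "U = V + W" "V \<in> D" "W \<in> D" for V W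
      proof -
        have "V = U + Y \<longleftrightarrow> W + Y = {#}" for Y unfolding that(1) union_assoc by (rule add_cancel_right_right)
        then have "(\<exists>Y\<in>D. V = U + Y) \<longleftrightarrow> (\<exists>Y\<in>D. W + Y = {#})" by blast
        also have "\<dots> \<longleftrightarrow> W = {#}" unfolding empty_eq_union[symmetric] union_eq_empty using D_empty by blast
        finally show ?thesis .
      qed
      then have "((\<exists>W\<in>D. U = V + W) \<and> \<not> (\<exists>W\<in>D. V = U + W) \<longrightarrow> V = {#}) \<longleftrightarrow>
          (\<forall>W\<in>D. U = V + W \<longrightarrow> V = {#} \<or> W = {#})" if "V \<in> D" for V
        using that by blast
      then show ?thesis using U unfolding atomD_def by (simp cong: ball_cong)
    qed
    finally show ?thesis .
  qed
  then show ?thesis by (auto simp: atoms_def carrier_red atomD_def)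
qed

text \<open>Being an atom depends on the image in \<open>CB\<close> only, since decompositions of the image lift.\<close>

lemma atomD_cong:
  assumes "atomD U" "set_mset U' \<subseteq> P" "image_mset \<phi> U' = image_mset \<phi> U"
  shows "atomD U'"
  unfolding atomD_def
proof (intro conjI ballI impI)
  show "U' \<in> D" using assms by (auto simp: D_def atomD_def)
  show "U' \<noteq> {#}" using assms by (auto simp: atomD_def)
  fix V W assume V: "V \<in> D" and W: "W \<in> D" and U': "U' = V + W"
  then have "image_mset \<phi> U = image_mset \<phi> V + image_mset \<phi> W" using assms(3) by simp
  then obtain V' W' where "U = V' + W'" "image_mset \<phi> V = image_mset \<phi> V'" "image_mset \<phi> W = image_mset \<phi> W'"
    using image_mset_eq_plusD by metis
  moreover have "V' \<in> D" "W' \<in> D" using calculation assms(1) V W by (auto simp: D_def atomD_def)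
  ultimately show "V = {#} \<or> W = {#}" using assms(1) unfolding atomD_def
    by (metis image_mset_is_empty_iff)
qed

abbreviation fac :: "'p multiset multiset \<Rightarrow> 'h set multiset" where
  "fac Z \<equiv> image_mset (\<lambda>U. {\<nu> U}) Z"

lemma sum_mset_D: "(\<And>U. U \<in># Z \<Longrightarrow> U \<in> D) \<Longrightarrow> \<Sum>\<^sub># Z \<in> D"
  by (induction Z) (auto simp: D_empty D_add)

lemma factorization_value_fac:
  assumes "\<And>U. U \<in># Z \<Longrightarrow> U \<in> D"
  shows "factorization_value H (fac Z) = {\<nu> (\<Sum>\<^sub># Z)}"
proof -
  interpret R: comm_monoid Hred by (rule comm_monoid_red)
  have gen: "factorization_value H (add_mset A z) = A \<otimes>\<^bsub>Hred\<^esub> factorization_value H z"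
    if A: "A \<in> carrier Hred" and z: "set_mset z \<subseteq> carrier Hred" for A z
  proof -
    let ?f = "\<lambda>z u. u [^]\<^bsub>Hred\<^esub> count z u"
    have f: "?f z \<in> set_mset z - {A} \<rightarrow> carrier Hred" using z by auto
    have "factorization_value H (add_mset A z) =
        ?f (add_mset A z) A \<otimes>\<^bsub>Hred\<^esub> finprod Hred (?f (add_mset A z)) (set_mset z - {A})"
    proof -
      have "set_mset (add_mset A z) = insert A (set_mset z - {A})" by auto
      then show ?thesis unfolding factorization_value_def using A z
        by (simp only:, subst R.finprod_insert) auto
    qed
    also have "finprod Hred (?f (add_mset A z)) (set_mset z - {A}) =
        finprod Hred (?f z) (set_mset z - {A})"
      by (rule R.finprod_cong') (use f in auto)
    also have "?f (add_mset A z) A = A \<otimes>\<^bsub>Hred\<^esub> ?f z A"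
      using A by (simp add: R.m_comm)
    also have "A \<otimes>\<^bsub>Hred\<^esub> ?f z A \<otimes>\<^bsub>Hred\<^esub>
        finprod Hred (?f z) (set_mset z - {A}) =
        A \<otimes>\<^bsub>Hred\<^esub> (?f z A \<otimes>\<^bsub>Hred\<^esub>
        finprod Hred (?f z) (set_mset z - {A}))"
      using A f by (intro R.m_assoc) (auto intro: R.finprod_closed)
    also have "?f z A \<otimes>\<^bsub>Hred\<^esub> finprod Hred (?f z) (set_mset z - {A}) =
        factorization_value H z"
    proof (cases "A \<in># z")
      case True
      have "finprod Hred (?f z) (insert A (set_mset z - {A})) =
          ?f z A \<otimes>\<^bsub>Hred\<^esub> finprod Hred (?f z) (set_mset z - {A})"
        by (rule R.finprod_insert) (use A f in auto)
      then show ?thesis unfolding factorization_value_def using True by (simp add: insert_absorb)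
    next
      case False
      then have "count z A = 0" "set_mset z - {A} = set_mset z" by (auto simp: not_in_iff)
      then show ?thesis unfolding factorization_value_def using f by simp
    qed
    finally show ?thesis .
  qed
  show ?thesis using assms
  proof (induction Z)
    case empty then show ?case by (simp add: factorization_value_def one_red nu_empty)
  next
    case (add U Z)
    have "factorization_value H (fac (add_mset U Z)) = {\<nu> U} \<otimes>\<^bsub>Hred\<^esub> factorization_value H (fac Z)"
      using add.prems by (simp, intro gen) (auto simp: carrier_red)
    also have "factorization_value H (fac Z) = {\<nu> (\<Sum>\<^sub># Z)}" using add by simp
    finally show ?case using add.prems by (simp add: mult_red nu_add_D sum_mset_D)
  qed
qed

lemma factorizations_fac:
  assumes "Ua \<in> D"
  shows "factorizations H (\<nu> Ua) = fac ` {Z. (\<forall>U\<in>#Z. atomD U) \<and> \<Sum>\<^sub># Z = Ua}"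
proof -
  have lift: "\<exists>Z. z = fac Z \<and> (\<forall>U\<in>#Z. atomD U)" if "set_mset z \<subseteq> atoms Hred" for z
    using that
  proof (induction z)
    case empty then show ?case by auto
  next
    case (add A z)
    then obtain Z U where "z = fac Z" "\<forall>U\<in>#Z. atomD U" "A = {\<nu> U}" "atomD U" by (auto simp: atoms_red)
    then show ?case by (intro exI[of _ "add_mset U Z"]) auto
  qed
  have val: "factorization_value H (fac Z) = Units H #>\<^bsub>H\<^esub> \<nu> Ua \<longleftrightarrow> \<Sum>\<^sub># Z = Ua"
    if "\<forall>U\<in>#Z. atomD U" for Z
  proof -
    have D: "\<And>U. U \<in># Z \<Longrightarrow> U \<in> D" using that by (auto simp: atomD_def)
    then show ?thesis using assms
      by (simp add: factorization_value_fac[OF D] r_coset_def Units_H mult_H nu_eq_iff sum_mset_D)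
  qed
  show ?thesis
  proof (intro equalityI subsetI)
    fix z assume "z \<in> factorizations H (\<nu> Ua)"
    then show "z \<in> fac ` {Z. (\<forall>U\<in>#Z. atomD U) \<and> \<Sum>\<^sub># Z = Ua}"
      unfolding factorizations_def factorization_monoid_def using lift val by blast
  next
    fix z assume "z \<in> fac ` {Z. (\<forall>U\<in>#Z. atomD U) \<and> \<Sum>\<^sub># Z = Ua}"
    then obtain Z where "z = fac Z" "\<forall>U\<in>#Z. atomD U" "\<Sum>\<^sub># Z = Ua" by blast
    then show "z \<in> factorizations H (\<nu> Ua)"
      unfolding factorizations_def factorization_monoid_def using val by (auto simp: atoms_red)
  qed
qed

lemma factorization_map_fac:
  assumes "\<forall>U\<in>#Z. atomD U"
  shows "factorization_map B \<theta> (fac Z) = image_mset (\<lambda>U. {image_mset \<phi> U}) Z"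
  unfolding factorization_map_def multiset.map_comp
  by (rule image_mset_cong) (use assms in \<open>auto simp: set_mult_def Units_B mult_B theta_D atomD_def\<close>)

text \<open>Members common to both factorizations do not contribute to the distance.\<close>

lemma factorization_dist_common:
  "factorization_dist (R + S :: 'h set multiset) (R + S') \<le> max (size S) (size S')"
proof -
  have "size ((R + S) - ((R + S) \<inter># (R + S'))) \<le> size S" for R S S' :: "'h set multiset"
  proof -
    have "R \<subseteq># (R + S) \<inter># (R + S')" by simp
    then obtain T where "(R + S) \<inter># (R + S') = R + T"
      using mset_subset_eq_exists_conv by blast
    then have "(R + S) - ((R + S) \<inter># (R + S')) = S - T" by simp
    then show ?thesis using size_mset_mono[OF diff_subset_eq_self] by metis
  qed
  from this[of R S S'] this[of R S' S] show ?thesis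
    unfolding factorization_dist_def by (metis max.mono subset_mset.inf.commute)
qed

lemma class_swap_keeps:
  assumes "class_swap \<phi> Z Z'" "\<forall>U\<in>#Z. atomD U"
  shows "(\<forall>U\<in>#Z'. atomD U) \<and> \<Sum>\<^sub># Z' = \<Sum>\<^sub># Z \<and>
    image_mset (\<lambda>U. {image_mset \<phi> U}) Z' = image_mset (\<lambda>U. {image_mset \<phi> U}) Z \<and>
    factorization_dist (fac Z) (fac Z') \<le> 2"
proof -
  obtain R u v u' v' where Z: "Z = R + {#u, v#}" "Z' = R + {#u', v'#}" and s: "u + v = u' + v'"
    and i: "image_mset \<phi> u = image_mset \<phi> u'" "image_mset \<phi> v = image_mset \<phi> v'"
    using assms(1) unfolding class_swap_def by blast
  have uv: "atomD u" "atomD v" using assms(2) Z by auto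
  have "set_mset (u' + v') \<subseteq> P" using uv D_sub unfolding s[symmetric] atomD_def by auto
  then have "atomD u'" "atomD v'" using atomD_cong[OF uv(1), of u'] atomD_cong[OF uv(2), of v'] i by auto
  moreover have "factorization_dist (fac Z) (fac Z') \<le> 2"
    using factorization_dist_common[of "fac R" "fac {#u, v#}" "fac {#u', v'#}"] by (simp add: Z)
  ultimately show ?thesis using assms(2) Z s i by (auto simp: union_assoc)
qed

theorem fibre_catenary_degree_le_2: "fibre_catenary_degree H B \<theta> \<le> 2"
  unfolding fibre_catenary_degree_def
proof (rule SUP_least)
  fix a assume "a \<in> carrier H"
  then obtain Ua where Ua: "Ua \<in> D" "a = \<nu> Ua" by (auto simp: carrier_H)
  have "fibre_chain H B \<theta> a 2 z z'"
    if z: "z \<in> factorizations H a" and z': "z' \<in> factorizations H a"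
      and eq: "factorization_map B \<theta> z = factorization_map B \<theta> z'" for z z'
  proof -
    obtain Z where Z: "z = fac Z" "\<forall>U\<in>#Z. atomD U" "\<Sum>\<^sub># Z = Ua"
      using z factorizations_fac[OF Ua(1)] Ua(2) by blast
    obtain Z' where Z': "z' = fac Z'" "\<forall>U\<in>#Z'. atomD U" "\<Sum>\<^sub># Z' = Ua"
      using z' factorizations_fac[OF Ua(1)] Ua(2) by blast
    obtain us where us: "mset us = Z" using ex_mset by blast
    have sing: "image_mset (\<lambda>S. {S}) (image_mset (image_mset \<phi>) Z) = image_mset (\<lambda>S. {S}) (image_mset (image_mset \<phi>) Z')"
      using eq Z Z' by (simp add: factorization_map_fac multiset.map_comp comp_def)
    have "image_mset (image_mset \<phi>) Z = image_mset (image_mset \<phi>) Z'"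
      using arg_cong[OF sing, of "image_mset the_elem"] by (simp add: multiset.map_comp comp_def)
    then have "image_mset (image_mset \<phi>) Z' = mset (map (image_mset \<phi>) us)" using us by simp
    then obtain vs where vs: "mset vs = Z'" "map (image_mset \<phi>) vs = map (image_mset \<phi>) us"
      by (rule lift_list)
    have "(class_swap \<phi>)\<^sup>*\<^sup>* (mset us) (mset vs)"
      by (rule class_swap_connected) (use vs us Z Z' in \<open>auto simp: sum_mset_sum_list[symmetric]\<close>)
    then obtain k f where f: "f 0 = Z" "f k = Z'" "\<And>i. i < k \<Longrightarrow> class_swap \<phi> (f i) (f (Suc i))"
      unfolding us vs rtranclp_power relpowp_fun_conv by blast
    have inv: "(\<forall>U\<in>#f i. atomD U) \<and> \<Sum>\<^sub># (f i) = Ua \<and>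
        image_mset (\<lambda>U. {image_mset \<phi> U}) (f i) = image_mset (\<lambda>U. {image_mset \<phi> U}) Z" if "i \<le> k" for i
      using that
    proof (induction i)
      case 0 show ?case unfolding f(1) using Z(2,3) by blast
    next
      case (Suc i)
      then have ih: "(\<forall>U\<in>#f i. atomD U)" "\<Sum>\<^sub># (f i) = Ua"
          "image_mset (\<lambda>U. {image_mset \<phi> U}) (f i) = image_mset (\<lambda>U. {image_mset \<phi> U}) Z"
        and "i < k" by auto
      from class_swap_keeps[OF f(3)[OF this(4)] ih(1)] show ?case unfolding ih by blast
    qed
    have "fac (f i) \<in> factorizations H a \<and>
        factorization_map B \<theta> (fac (f i)) = factorization_map B \<theta> z" if "i \<le> k" for i
    proof
      show "fac (f i) \<in> factorizations H a"
        unfolding Ua(2) factorizations_fac[OF Ua(1)] using inv[OF that] by blast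
      show "factorization_map B \<theta> (fac (f i)) = factorization_map B \<theta> z"
        using inv[OF that] factorization_map_fac[of "f i"] factorization_map_fac[OF Z(2)] Z(1) by simp
    qed
    moreover have "enat (factorization_dist (fac (f (i - 1))) (fac (f i))) \<le> 2" if "i \<in> {1..k}" for i
    proof -
      have i: "i - 1 < k" "i - 1 \<le> k" "Suc (i - 1) = i" using that by auto
      have "factorization_dist (fac (f (i - 1))) (fac (f (Suc (i - 1)))) \<le> 2"
        using class_swap_keeps[OF f(3)[OF i(1)]] inv[OF i(2)] by blast
      then show ?thesis unfolding i(3) by (simp add: numeral_eq_enat)
    qed
    ultimately show ?thesis unfolding fibre_chain_def
      by (intro exI[of _ k] exI[of _ "\<lambda>i. fac (f i)"]) (auto simp: f Z(1) Z'(1))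
  qed
  then show "elem_fibre_catenary_degree H B \<theta> a \<le> 2"
    unfolding elem_fibre_catenary_degree_def by (intro Least_le) blast
qed

end

section \<open>Integrality over the integers\<close>

definition zspan :: "'a::comm_ring_1 set \<Rightarrow> 'a set" where
  "zspan = module.span (\<lambda>(k::int) x. of_int k * x)"

interpretation zmod: Modules.module "\<lambda>(k::int) (x::'a::comm_ring_1). of_int k * x"
  rewrites "Modules.module.span (\<lambda>(k::int) (x::'a). of_int k * x) = zspan"
  by (unfold_locales, auto simp: algebra_simps zspan_def)

lemma zspan_generator_nonzero:
  assumes "x \<in> zspan B" "x \<noteq> 0" shows "\<exists>b\<in>B. b \<noteq> 0"
proof (rule ccontr)
  assume B: "\<not> ?thesis"
  have "x = 0" using assms(1)
    by (induction rule: zmod.span_induct_alt) (use B in auto)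
  then show False using assms(2) by simp
qed

lemma zspan_mult:
  assumes "a \<in> zspan A" "b \<in> zspan B"
  shows "a * b \<in> zspan {x * y |x y. x \<in> A \<and> y \<in> B}"
  using assms(1)
proof (induction rule: zmod.span_induct_alt)
  case base then show ?case by (simp add: zmod.span_zero)
next
  case (step c x y)
  have "x * b \<in> zspan {x * y |x y. x \<in> A \<and> y \<in> B}" using assms(2)
  proof (induction rule: zmod.span_induct_alt)
    case base then show ?case by (simp add: zmod.span_zero)
  next
    case (step d u v)
    have "of_int d * (x * u) + x * v \<in> zspan {x * y |x y. x \<in> A \<and> y \<in> B}"
      by (rule zmod.span_add[OF zmod.span_scale[OF zmod.span_base]]) (use step \<open>x \<in> A\<close> in blast)+
    then show ?case by (simp add: algebra_simps)
  qed
  then have "of_int c * (x * b) + y * b \<in> zspan {x * y |x y. x \<in> A \<and> y \<in> B}"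
    by (intro zmod.span_add zmod.span_scale step)
  then show ?case by (simp add: algebra_simps)
qed

text \<open>The determinant trick: multiplication by \<open>x\<close> on the generators is given by an integral matrix,
  the vector of the generators is an eigenvector of it with eigenvalue \<open>x\<close>, and the characteristic
  polynomial of an integral matrix is monic with integral coefficients.\<close>

lemma algebraic_int_of_stable:
  fixes x :: "'a::field_char_0"
  assumes fin: "finite B" and ne: "\<exists>b\<in>B. b \<noteq> 0" and stable: "\<And>b. b \<in> B \<Longrightarrow> x * b \<in> zspan B"
  shows "algebraic_int x"
proof -
  define n where "n = card B"
  obtain b where b: "bij_betw b {..<n} B"
    using ex_bij_betw_nat_finite[OF fin] unfolding n_def atLeast0LessThan by blast
  have "\<exists>c. \<forall>i<n. x * b i = (\<Sum>j<n. of_int (c i j) * b j)"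
  proof -
    have "\<exists>c. x * b i = (\<Sum>j<n. of_int (c j) * b j)" if "i < n" for i
    proof -
      have "b i \<in> B" using b that by (auto simp: bij_betw_def)
      then obtain u where "x * b i = (\<Sum>v\<in>B. of_int (u v) * v)"
        using stable[of "b i"] unfolding zmod.span_finite[OF fin] by blast
      also have "\<dots> = (\<Sum>j<n. of_int (u (b j)) * b j)"
        using sum.reindex_bij_betw[OF b, of "\<lambda>v. of_int (u v) * v"] by simp
      finally show ?thesis by (rule exI[of _ "\<lambda>j. u (b j)"])
    qed
    then show ?thesis by metis
  qed
  then obtain c where c: "\<And>i. i < n \<Longrightarrow> x * b i = (\<Sum>j<n. of_int (c i j) * b j)" by blast
  define A where "A = mat n n (\<lambda>(i, j). c i j)"
  define A' where "A' = map_mat (of_int :: int \<Rightarrow> 'a) A"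
  have A: "A \<in> carrier_mat n n" and A': "A' \<in> carrier_mat n n"
    by (simp_all add: A_def A'_def)
  have "A' *\<^sub>v vec n b = x \<cdot>\<^sub>v vec n b"
  proof (rule eq_vecI)
    fix i assume "i < dim_vec (x \<cdot>\<^sub>v vec n b)"
    then have i: "i < n" by simp
    then show "vec_index (A' *\<^sub>v vec n b) i = vec_index (x \<cdot>\<^sub>v vec n b) i"
      using c[OF i] by (simp add: A'_def A_def scalar_prod_def atLeast0LessThan)
  qed (simp add: A'_def A_def)
  moreover have "vec n b \<noteq> 0\<^sub>v n"
  proof
    assume eq: "vec n b = 0\<^sub>v n"
    have "b i = 0" if "i < n" for i
      using that arg_cong[OF eq, of "\<lambda>v. vec_index v i"] by simp
    then show False using ne b by (auto simp: bij_betw_def)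
  qed
  ultimately have "eigenvalue A' x"
    unfolding eigenvalue_def eigenvector_def using A' by (intro exI[of _ "vec n b"]) simp
  then have "poly (char_poly A') x = 0" using eigenvalue_root_char_poly[OF A'] by simp
  moreover have "char_poly A' = map_poly of_int (char_poly A)"
    unfolding A'_def by (rule of_int_hom.char_poly_hom[OF A])
  moreover have "lead_coeff (char_poly A) = 1" using degree_monic_char_poly[OF A] by simp
  ultimately show ?thesis unfolding algebraic_int_altdef_ipoly by metis
qed

lemma algebraic_int_powers:
  fixes x :: "'a::field_char_0"
  assumes "algebraic_int x"
  obtains n where "n > 0" "x ^ n \<in> zspan ((\<lambda>i. x ^ i) ` {..<n})"
proof -
  obtain p :: "int poly" where p: "poly (map_poly of_int p) x = 0" "lead_coeff p = 1"
    using assms unfolding algebraic_int_altdef_ipoly by blast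
  define n where "n = degree p"
  have eq: "0 = x ^ n + (\<Sum>i<n. of_int (coeff p i) * x ^ i)"
    using p unfolding poly_altdef by (simp add: n_def degree_map_poly coeff_map_poly lessThan_Suc_atMost[symmetric] add.commute)
  have "n > 0" using eq by (cases n) auto
  moreover have "x ^ n = - (\<Sum>i<n. of_int (coeff p i) * x ^ i)" using eq by (simp add: eq_neg_iff_add_eq_0)
  then have "x ^ n \<in> zspan ((\<lambda>i. x ^ i) ` {..<n})"
    by (auto intro!: zmod.span_neg zmod.span_sum zmod.span_scale intro: zmod.span_base)
  ultimately show thesis by (rule that)
qed

text \<open>The finitely many products of powers of \<open>x\<close> and \<open>y\<close> below the degrees of their equations span
  a group that is stable under multiplication by \<open>x\<close> and by \<open>y\<close>, hence by \<open>x + y\<close> and by \<open>x * y\<close>.\<close>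

lemma algebraic_int_add_mult:
  fixes x y :: "'a::field_char_0"
  assumes "algebraic_int x" "algebraic_int y"
  shows "algebraic_int (x + y) \<and> algebraic_int (x * y)"
proof -
  obtain n where n: "n > 0" "x ^ n \<in> zspan ((\<lambda>i. x ^ i) ` {..<n})"
    using assms(1) by (rule algebraic_int_powers)
  obtain k where k: "k > 0" "y ^ k \<in> zspan ((\<lambda>i. y ^ i) ` {..<k})"
    using assms(2) by (rule algebraic_int_powers)
  define M where "M = (\<lambda>i. x ^ i) ` {..<n}"
  define N where "N = (\<lambda>i. y ^ i) ` {..<k}"
  define B where "B = {a * b |a b. a \<in> M \<and> b \<in> N}"
  have "finite B"
  proof -
    have "B = (\<lambda>(a, b). a * b) ` (M \<times> N)" by (auto simp: B_def)
    then show ?thesis by (simp add: M_def N_def)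
  qed
  have "1 \<in> B"
  proof -
    have "1 \<in> M" "1 \<in> N" using n(1) k(1) by (auto simp: M_def N_def image_iff intro!: bexI[of _ 0])
    then show ?thesis unfolding B_def by force
  qed
  have xX: "x * a \<in> zspan M" if a: "a \<in> M" for a
  proof -
    obtain i where i: "i < n" "a = x ^ i" using a by (auto simp: M_def)
    then have eq: "x * a = x ^ Suc i" by simp
    show ?thesis
    proof (cases "Suc i = n")
      case True then show ?thesis using n(2) unfolding eq M_def by simp
    next
      case False
      then have "Suc i \<in> {..<n}" using i(1) by simp
      then show ?thesis unfolding eq M_def by (intro zmod.span_base imageI)
    qed
  qed
  have yY: "y * b \<in> zspan N" if b: "b \<in> N" for b
  proof -
    obtain i where i: "i < k" "b = y ^ i" using b by (auto simp: N_def)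
    then have eq: "y * b = y ^ Suc i" by simp
    show ?thesis
    proof (cases "Suc i = k")
      case True then show ?thesis using k(2) unfolding eq N_def by simp
    next
      case False
      then have "Suc i \<in> {..<k}" using i(1) by simp
      then show ?thesis unfolding eq N_def by (intro zmod.span_base imageI)
    qed
  qed
  have xyB: "x * c \<in> zspan B \<and> y * c \<in> zspan B" if cB: "c \<in> B" for c
  proof -
    obtain a b where c: "c = a * b" "a \<in> M" "b \<in> N" using cB by (auto simp: B_def)
    have "(x * a) * b \<in> zspan B" "a * (y * b) \<in> zspan B" unfolding B_def
      using zspan_mult[OF xX[OF c(2)] zmod.span_base[OF c(3)]]
        zspan_mult[OF zmod.span_base[OF c(2)] yY[OF c(3)]] by simp_all
    then show ?thesis unfolding c(1) by (simp add: algebra_simps)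
  qed
  have stable: "z * c \<in> zspan B" if "c \<in> zspan B" "\<And>c. c \<in> B \<Longrightarrow> z * c \<in> zspan B" for z c
    using that(1)
  proof (induction rule: zmod.span_induct_alt)
    case base then show ?case by (simp add: zmod.span_zero)
  next
    case (step d u v)
    have "of_int d * (z * u) + z * v \<in> zspan B"
      by (intro zmod.span_add zmod.span_scale) (use step that(2) in auto)
    then show ?case by (simp add: algebra_simps)
  qed
  have "(x + y) * c \<in> zspan B" "(x * y) * c \<in> zspan B" if "c \<in> B" for c
  proof -
    show "(x + y) * c \<in> zspan B" using xyB[OF that] by (simp add: distrib_right zmod.span_add)
    have "x * (y * c) \<in> zspan B" using stable[of "y * c" x] xyB that by blast
    then show "(x * y) * c \<in> zspan B" by (simp add: mult.assoc)
  qed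
  moreover have "\<exists>b\<in>B. b \<noteq> 0" using \<open>1 \<in> B\<close> zero_neq_one by metis
  ultimately show ?thesis using \<open>finite B\<close> by (intro conjI algebraic_int_of_stable[of B])
qed

section \<open>Products of subsets of a field, and indices of subgroups\<close>

text \<open>For arbitrary subsets of a field the product is commutative and associative, so that ideals,
  fractional ideals and their inverses can be treated alike.\<close>

definition iprod :: "'a::field_char_0 set \<Rightarrow> 'a set \<Rightarrow> 'a set" (infixl "\<star>" 80) where
  "I \<star> J = ideal_prod ring_of_type_algebra I J"

lemma iprod_mult: "i \<in> I \<Longrightarrow> j \<in> J \<Longrightarrow> i * j \<in> I \<star> J"
  using ideal_prod.prod[of i I j J ring_of_type_algebra]
  by (simp add: iprod_def ring_of_type_algebra_def)

lemma iprod_add: "x \<in> I \<star> J \<Longrightarrow> y \<in> I \<star> J \<Longrightarrow> x + y \<in> I \<star> J"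
  using ideal_prod.sum[of x ring_of_type_algebra I J y]
  by (simp add: iprod_def ring_of_type_algebra_def)

lemma iprod_induct [consumes 1, case_names mult add]:
  assumes "x \<in> I \<star> J" and "\<And>i j. i \<in> I \<Longrightarrow> j \<in> J \<Longrightarrow> Q (i * j)"
    and "\<And>x y. x \<in> I \<star> J \<Longrightarrow> y \<in> I \<star> J \<Longrightarrow> Q x \<Longrightarrow> Q y \<Longrightarrow> Q (x + y)"
  shows "Q x"
  using assms(1) unfolding iprod_def
proof (induction rule: ideal_prod.induct)
  case (prod i j)
  then show ?case using assms(2) by (simp add: ring_of_type_algebra_def)
next
  case (sum s1 s2)
  then show ?case using assms(3) by (simp add: ring_of_type_algebra_def iprod_def)
qed

lemma iprod_subset:
  assumes "\<And>i j. i \<in> I \<Longrightarrow> j \<in> J \<Longrightarrow> i * j \<in> S" "\<And>x y. x \<in> S \<Longrightarrow> y \<in> S \<Longrightarrow> x + y \<in> S"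
  shows "I \<star> J \<subseteq> S"
proof
  fix x assume "x \<in> I \<star> J" then show "x \<in> S" by (induction rule: iprod_induct) (auto intro: assms)
qed

lemma iprod_mono: "I \<subseteq> I' \<Longrightarrow> J \<subseteq> J' \<Longrightarrow> I \<star> J \<subseteq> I' \<star> J'"
  by (rule iprod_subset) (auto intro: iprod_mult iprod_add)

lemma iprod_commute: "I \<star> J = J \<star> I"
proof -
  have "I \<star> J \<subseteq> J \<star> I" for I J :: "'a set"
    by (rule iprod_subset) (metis iprod_mult mult.commute, rule iprod_add)
  then show ?thesis by blast
qed

lemma iprod_assoc: "(I \<star> J) \<star> L = I \<star> (J \<star> L)"
proof -
  have le: "(I \<star> J) \<star> L \<subseteq> I \<star> (J \<star> L)" for I J L :: "'a set"
  proof (rule iprod_subset)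
    fix x l assume "x \<in> I \<star> J" "l \<in> L"
    then show "x * l \<in> I \<star> (J \<star> L)"
    proof (induction rule: iprod_induct)
      case (mult i j)
      have "i * (j * l) \<in> I \<star> (J \<star> L)" by (intro iprod_mult mult)
      then show ?case by (simp add: mult.assoc)
    qed (auto simp: distrib_right intro: iprod_add)
  qed (rule iprod_add)
  have "I \<star> (J \<star> L) = (L \<star> J) \<star> I" by (simp add: iprod_commute)
  also have "\<dots> \<subseteq> L \<star> (J \<star> I)" by (rule le)
  also have "\<dots> = (I \<star> J) \<star> L" by (simp add: iprod_commute)
  finally show ?thesis using le by blast
qed

lemma iprod_left_commute: "I \<star> (J \<star> L) = J \<star> (I \<star> L)"
  by (metis iprod_assoc iprod_commute)

definition add_group :: "'a::ab_group_add set \<Rightarrow> bool" where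
  "add_group A \<longleftrightarrow> 0 \<in> A \<and> (\<forall>x\<in>A. \<forall>y\<in>A. x - y \<in> A)"

lemma add_group_zero: "add_group A \<Longrightarrow> 0 \<in> A" by (simp add: add_group_def)
lemma add_group_diff: "add_group A \<Longrightarrow> x \<in> A \<Longrightarrow> y \<in> A \<Longrightarrow> x - y \<in> A" by (simp add: add_group_def)
lemma add_group_uminus: "add_group A \<Longrightarrow> x \<in> A \<Longrightarrow> - x \<in> A"
  using add_group_diff[of A 0 x] by (simp add: add_group_zero)
lemma add_group_add: "add_group A \<Longrightarrow> x \<in> A \<Longrightarrow> y \<in> A \<Longrightarrow> x + y \<in> A"
  using add_group_diff[of A x "- y"] by (simp add: add_group_uminus)

definition cosets :: "'a::ab_group_add set \<Rightarrow> 'a set \<Rightarrow> 'a set set" where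
  "cosets A B = (\<lambda>x. (\<lambda>h. h + x) ` A) ` B"

definition index :: "'a::ab_group_add set \<Rightarrow> 'a set \<Rightarrow> nat" where
  "index A B = card (cosets A B)"

text \<open>Indices are computed with transversals: images and sums of transversals are again transversals
  in the situations below, and no quotient structure has to be transported.\<close>

definition transversal :: "'a::ab_group_add set \<Rightarrow> 'a set \<Rightarrow> 'a set \<Rightarrow> bool" where
  "transversal A B T \<longleftrightarrow> T \<subseteq> B \<and> (\<forall>b\<in>B. \<exists>t\<in>T. b - t \<in> A) \<and>
     (\<forall>t\<in>T. \<forall>t'\<in>T. t - t' \<in> A \<longrightarrow> t = t')"

lemma coset_eq_iff:
  assumes "add_group A"
  shows "(\<lambda>h. h + x) ` A = (\<lambda>h. h + y) ` A \<longleftrightarrow> x - y \<in> A"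
proof
  assume eq: "(\<lambda>h. h + x) ` A = (\<lambda>h. h + y) ` A"
  have "x \<in> (\<lambda>h. h + x) ` A" using add_group_zero[OF assms] by force
  then obtain h where "h \<in> A" "x = h + y" unfolding eq by blast
  then show "x - y \<in> A" by simp
next
  have sub: "(\<lambda>h. h + x) ` A \<subseteq> (\<lambda>h. h + y) ` A" if "x - y \<in> A" for x y
  proof
    fix z assume "z \<in> (\<lambda>h. h + x) ` A"
    then obtain h where h: "h \<in> A" "z = h + x" by blast
    have "z = (h + (x - y)) + y" using h by simp
    then show "z \<in> (\<lambda>h. h + y) ` A" using add_group_add[OF assms h(1) that] by blast
  qed
  assume a: "x - y \<in> A"
  then have "y - x \<in> A" using add_group_uminus[OF assms a] by simp
  then show "(\<lambda>h. h + x) ` A = (\<lambda>h. h + y) ` A" using sub a by blast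
qed

lemma transversal_bij:
  assumes "add_group A" "transversal A B T"
  shows "bij_betw (\<lambda>x. (\<lambda>h. h + x) ` A) T (cosets A B)"
  unfolding bij_betw_def
proof
  show "inj_on (\<lambda>x. (\<lambda>h. h + x) ` A) T"
    using assms(2) by (auto simp: inj_on_def coset_eq_iff[OF assms(1)] transversal_def)
  show "(\<lambda>x. (\<lambda>h. h + x) ` A) ` T = cosets A B"
  proof
    show "(\<lambda>x. (\<lambda>h. h + x) ` A) ` T \<subseteq> cosets A B"
      using assms(2) unfolding cosets_def transversal_def by (intro image_mono) simp
    show "cosets A B \<subseteq> (\<lambda>x. (\<lambda>h. h + x) ` A) ` T"
    proof
      fix C assume "C \<in> cosets A B"
      then obtain b where b: "b \<in> B" "C = (\<lambda>h. h + b) ` A" by (auto simp: cosets_def)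
      then obtain t where "t \<in> T" "b - t \<in> A" using assms(2) by (auto simp: transversal_def)
      then have "C = (\<lambda>h. h + t) ` A" using b(2) coset_eq_iff[OF assms(1)] by simp
      then show "C \<in> (\<lambda>x. (\<lambda>h. h + x) ` A) ` T" using \<open>t \<in> T\<close> by blast
    qed
  qed
qed

lemma index_transversal: "add_group A \<Longrightarrow> transversal A B T \<Longrightarrow> index A B = card T"
  unfolding index_def using bij_betw_same_card[OF transversal_bij] by metis

lemma finite_transversal: "add_group A \<Longrightarrow> transversal A B T \<Longrightarrow> finite (cosets A B) \<longleftrightarrow> finite T"
  using bij_betw_finite[OF transversal_bij] by metis

lemma transversal_exists:
  assumes "add_group A" obtains T where "transversal A B T"
proof -
  define r where "r C = (SOME b. b \<in> B \<and> C = (\<lambda>h. h + b) ` A)" for C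
  have r: "r C \<in> B \<and> C = (\<lambda>h. h + r C) ` A" if "C \<in> cosets A B" for C
    unfolding r_def by (rule someI_ex) (use that in \<open>auto simp: cosets_def\<close>)
  have "transversal A B (r ` cosets A B)"
    unfolding transversal_def
  proof (intro conjI ballI impI)
    show "r ` cosets A B \<subseteq> B" using r by blast
    fix b assume "b \<in> B"
    then have C: "(\<lambda>h. h + b) ` A \<in> cosets A B" by (auto simp: cosets_def)
    have "b - r ((\<lambda>h. h + b) ` A) \<in> A" using r[OF C] coset_eq_iff[OF assms] by blast
    then show "\<exists>t\<in>r ` cosets A B. b - t \<in> A" using C by blast
  next
    fix t t' assume "t \<in> r ` cosets A B" "t' \<in> r ` cosets A B" and d: "t - t' \<in> A"
    then obtain C C' where C: "C \<in> cosets A B" "C' \<in> cosets A B" "t = r C" "t' = r C'" by blast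
    have "C = C'" using r[OF C(1)] r[OF C(2)] d coset_eq_iff[OF assms] unfolding C by metis
    then show "t = t'" using C by simp
  qed
  then show thesis by (rule that)
qed

lemma index_tower:
  assumes A: "add_group A" and B: "add_group B" and C: "add_group C" and sub: "A \<subseteq> B" "B \<subseteq> C"
  shows "index A C = index B C * index A B"
    and "finite (cosets B C) \<Longrightarrow> finite (cosets A B) \<Longrightarrow> finite (cosets A C)"
    and "finite (cosets A C) \<Longrightarrow> finite (cosets B C) \<and> finite (cosets A B)"
proof -
  obtain T where T: "transversal B C T" using transversal_exists[OF B] .
  obtain U where U: "transversal A B U" using transversal_exists[OF A] .
  define f where "f = (\<lambda>(t, u). t + u :: 'a)"
  have key: "t = t' \<and> u = u'" if t: "t \<in> T" "t' \<in> T" and u: "u \<in> U" "u' \<in> U" and eq: "t + u = t' + u'" for t t' u u'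
  proof -
    have "t - t' = (t + u) - (t' + u)" by simp
    also have "\<dots> = u' - u" unfolding eq by simp
    finally have "t - t' = u' - u" .
    moreover have "u' - u \<in> B" using u U add_group_diff[OF B, of u' u] unfolding transversal_def by blast
    ultimately have "t = t'" using T t unfolding transversal_def by metis
    then show ?thesis using eq by simp
  qed
  have inj: "inj_on f (T \<times> U)"
  proof (rule inj_onI)
    fix p q assume pq: "p \<in> T \<times> U" "q \<in> T \<times> U" "f p = f q"
    obtain t u t' u' where "p = (t, u)" "q = (t', u')" by fastforce
    then show "p = q" using pq key[of t t' u u'] by (simp add: f_def)
  qed
  have tr: "transversal A C (f ` (T \<times> U))"
    unfolding transversal_def
  proof (intro conjI ballI impI)
    show "f ` (T \<times> U) \<subseteq> C"
      unfolding f_def using T U sub by (auto simp: transversal_def intro!: add_group_add[OF C])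
    fix c assume "c \<in> C"
    then obtain t where t: "t \<in> T" "c - t \<in> B" using T by (auto simp: transversal_def)
    then obtain u where u: "u \<in> U" "c - t - u \<in> A" using U by (auto simp: transversal_def)
    have "c - f (t, u) = c - t - u" by (simp add: f_def)
    then show "\<exists>s\<in>f ` (T \<times> U). c - s \<in> A" using t u by (metis SigmaI imageI)
  next
    fix s s' assume "s \<in> f ` (T \<times> U)" "s' \<in> f ` (T \<times> U)" and d: "s - s' \<in> A"
    then obtain t u t' u' where t: "t \<in> T" "t' \<in> T" and u: "u \<in> U" "u' \<in> U"
      and s: "s = t + u" "s' = t' + u'" by (auto simp: f_def)
    have uB: "u' - u \<in> B" using u U add_group_diff[OF B, of u' u] unfolding transversal_def by blast
    have "t - t' = (s - s') + (u' - u)" using s by simp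
    then have "t - t' \<in> B" using add_group_add[OF B _ uB] d sub(1) by auto
    then have tt: "t = t'" using T t by (auto simp: transversal_def)
    then have "u - u' \<in> A" using d s by simp
    then have "u = u'" using U u by (auto simp: transversal_def)
    then show "s = s'" using s tt by simp
  qed
  show "index A C = index B C * index A B"
    using index_transversal[OF A tr] index_transversal[OF B T] index_transversal[OF A U]
      card_image[OF inj] by (simp add: card_cartesian_product)
  have fin: "finite (f ` (T \<times> U)) \<longleftrightarrow> finite (T \<times> U)" by (rule finite_image_iff[OF inj])
  show "finite (cosets B C) \<Longrightarrow> finite (cosets A B) \<Longrightarrow> finite (cosets A C)"
    unfolding finite_transversal[OF A tr] finite_transversal[OF B T] finite_transversal[OF A U] fin by simp
  have ne: "T \<noteq> {}" "U \<noteq> {}"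
    using T U add_group_zero[OF B] add_group_zero[OF C] by (auto simp: transversal_def)
  show "finite (cosets B C) \<and> finite (cosets A B)" if "finite (cosets A C)"
    using that ne unfolding finite_transversal[OF A tr] finite_transversal[OF B T] finite_transversal[OF A U] fin
    by (auto dest: finite_cartesian_productD1 finite_cartesian_productD2)
qed

lemma index_less:
  assumes A: "add_group A" and B: "add_group B" and C: "add_group C" and sub: "A \<subset> B" "B \<subseteq> C"
    and fin: "finite (cosets A C)"
  shows "index B C < index A C"
proof -
  have fin': "finite (cosets B C)" "finite (cosets A B)" using index_tower(3)[OF A B C] sub fin by auto
  have "index B C > 0"
    using fin'(1) add_group_zero[OF C] unfolding index_def by (auto simp: card_gt_0_iff cosets_def)
  moreover have "index A B > 1"
  proof -
    obtain b where b: "b \<in> B" "b \<notin> A" using sub by blast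
    define C0 C1 where "C0 = (\<lambda>h. h + (0::'a)) ` A" and "C1 = (\<lambda>h. h + b) ` A"
    have "C0 \<in> cosets A B" "C1 \<in> cosets A B"
      unfolding cosets_def C0_def C1_def using b(1) add_group_zero[OF B] by blast+
    then have "{C0, C1} \<subseteq> cosets A B" by simp
    then have "card {C0, C1} \<le> index A B" unfolding index_def by (rule card_mono[OF fin'(2)])
    moreover have "C1 \<noteq> C0" unfolding C0_def C1_def coset_eq_iff[OF A] using b(2) by simp
    ultimately show ?thesis by simp
  qed
  ultimately show ?thesis using index_tower(1)[OF A B C] sub by simp
qed

section \<open>Ideals of an order, away from its conductor\<close>

text \<open>After division by a power of the variable, the polynomial has a nonzero constant term, which is
  then a multiple of \<open>x\<close>.\<close>

lemma nonzero_integer_multiple: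
  fixes x :: "'a::field_char_0"
  assumes "p \<noteq> 0" "poly (map_poly of_int p) x = 0" "x \<noteq> 0"
  shows "\<exists>k q. k \<noteq> 0 \<and> of_int k = x * poly (map_poly of_int q) x"
  using assms
proof (induction p)
  case 0 then show ?case by simp
next
  case (pCons a p)
  have eq: "of_int a + x * poly (map_poly of_int p) x = 0"
    using pCons.prems(2) by (simp add: of_int_hom.map_poly_pCons_hom)
  show ?case
  proof (cases "a = 0")
    case True
    then show ?thesis using eq pCons by auto
  next
    case False
    have "of_int a = - (x * poly (map_poly of_int p) x)" using eq by (simp add: eq_neg_iff_add_eq_0)
    then have "of_int (- a) = x * poly (map_poly of_int p) x" by simp
    then show ?thesis using False by (intro exI[of _ "- a"] exI[of _ p]) simp
  qed
qed

text \<open>An order that contains \<open>m\<close> times every algebraic integer, that is, whose conductor contains \<open>m\<close>.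
  Away from \<open>m\<close> such an order behaves like the ring of integers.\<close>

locale near_maximal_order =
  fixes \<O> :: "'a::field_char_0 set" and m :: nat
  assumes one: "1 \<in> \<O>" and add: "x \<in> \<O> \<Longrightarrow> y \<in> \<O> \<Longrightarrow> x + y \<in> \<O>"
    and uminus: "x \<in> \<O> \<Longrightarrow> - x \<in> \<O>" and mult: "x \<in> \<O> \<Longrightarrow> y \<in> \<O> \<Longrightarrow> x * y \<in> \<O>"
    and fg: "\<exists>B. finite B \<and> zspan B = \<O>"
    and frac: "\<exists>d\<in>\<O>. d \<noteq> 0 \<and> d * x \<in> \<O>"
    and int_m: "algebraic_int x \<Longrightarrow> of_nat m * x \<in> \<O>"
begin

lemma zero: "0 \<in> \<O>" using add[OF one uminus[OF one]] by simp
lemma diff: "x \<in> \<O> \<Longrightarrow> y \<in> \<O> \<Longrightarrow> x - y \<in> \<O>" using add[of x "- y"] uminus by simp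
lemma of_nat_in: "of_nat n \<in> \<O>" by (induction n) (auto intro: zero one add)
lemma of_int_in: "of_int k \<in> \<O>" by (cases k) (auto intro: of_nat_in uminus simp del: of_nat_Suc)
lemma power_in: "x \<in> \<O> \<Longrightarrow> x ^ n \<in> \<O>" by (induction n) (auto intro: one mult)
lemma prod_in: "(\<And>i. i \<in> A \<Longrightarrow> f i \<in> \<O>) \<Longrightarrow> prod f A \<in> \<O>"
  by (induction A rule: infinite_finite_induct) (auto intro: one mult)

lemma algebraic: "x \<in> \<O> \<Longrightarrow> algebraic_int x"
proof -
  assume x: "x \<in> \<O>"
  obtain B where B: "finite B" "zspan B = \<O>" using fg by blast
  have "\<exists>b\<in>B. b \<noteq> 0" using zspan_generator_nonzero[of 1 B] B(2) one by simp
  moreover have "x * b \<in> zspan B" if "b \<in> B" for b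
    using that x mult zmod.span_base[of b B] unfolding B(2) by blast
  ultimately show ?thesis using algebraic_int_of_stable[OF B(1)] by blast
qed

lemma poly_in: "x \<in> \<O> \<Longrightarrow> poly (map_poly of_int q) x \<in> \<O>"
  by (induction q) (auto simp: of_int_hom.map_poly_pCons_hom intro: zero add mult of_int_in)

definition omodule :: "'a set \<Rightarrow> bool" where
  "omodule I \<longleftrightarrow> 0 \<in> I \<and> (\<forall>x\<in>I. \<forall>y\<in>I. x + y \<in> I) \<and> (\<forall>r\<in>\<O>. \<forall>x\<in>I. r * x \<in> I)"

lemma omodule_zero: "omodule I \<Longrightarrow> 0 \<in> I"
  and omodule_add: "omodule I \<Longrightarrow> x \<in> I \<Longrightarrow> y \<in> I \<Longrightarrow> x + y \<in> I"
  and omodule_scale: "omodule I \<Longrightarrow> r \<in> \<O> \<Longrightarrow> x \<in> I \<Longrightarrow> r * x \<in> I"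
  by (simp_all add: omodule_def)

lemma omodule_uminus: "omodule I \<Longrightarrow> x \<in> I \<Longrightarrow> - x \<in> I"
  using omodule_scale[of I "- 1" x] uminus[OF one] by simp

lemma omodule_diff: "omodule I \<Longrightarrow> x \<in> I \<Longrightarrow> y \<in> I \<Longrightarrow> x - y \<in> I"
  using omodule_add[of I x "- y"] omodule_uminus by simp

lemma omodule_add_group: "omodule I \<Longrightarrow> add_group I"
  by (simp add: add_group_def omodule_zero omodule_diff)

lemma omodule_O: "omodule \<O>"
  by (simp add: omodule_def zero add mult)

lemma omodule_iprod:
  assumes "omodule I" "omodule J" shows "omodule (I \<star> J)"
  unfolding omodule_def
proof (intro conjI ballI)
  show "0 \<in> I \<star> J" using iprod_mult[OF omodule_zero omodule_zero, of I J] assms by simp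
  fix r x assume "r \<in> \<O>" "x \<in> I \<star> J"
  from this(2) show "r * x \<in> I \<star> J"
  proof (induction rule: iprod_induct)
    case (mult i j)
    have "(r * i) * j \<in> I \<star> J"
      by (intro iprod_mult mult omodule_scale[OF assms(1) \<open>r \<in> \<O>\<close>])
    then show ?case by (simp add: mult.assoc)
  qed (auto simp: distrib_left intro: iprod_add)
qed (rule iprod_add)

lemma O_iprod: assumes "omodule I" shows "\<O> \<star> I = I" and "I \<star> \<O> = I"
proof -
  show "\<O> \<star> I = I"
  proof
    show "\<O> \<star> I \<subseteq> I"
      by (rule iprod_subset) (use assms omodule_scale omodule_add in blast)+
    show "I \<subseteq> \<O> \<star> I" using iprod_mult[OF one] by force
  qed
  then show "I \<star> \<O> = I" by (simp add: iprod_commute)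
qed

definition oideal :: "'a set \<Rightarrow> bool" where "oideal I \<longleftrightarrow> omodule I \<and> I \<subseteq> \<O>"

lemma oideal_one: "oideal I \<Longrightarrow> 1 \<in> I \<Longrightarrow> I = \<O>"
  using omodule_scale[of I _ 1] by (auto simp: oideal_def)

lemma oideal_O: "oideal \<O>" by (simp add: oideal_def omodule_O)

lemma oideal_iprod: "oideal I \<Longrightarrow> oideal J \<Longrightarrow> oideal (I \<star> J)"
  using iprod_mono[of I \<O> J \<O>] O_iprod(1)[OF omodule_O] by (simp add: oideal_def omodule_iprod)

lemma oideal_iprod_le: "oideal I \<Longrightarrow> oideal J \<Longrightarrow> I \<star> J \<subseteq> J"
  using iprod_mono[of I \<O> J J] O_iprod(1)[of J] by (simp add: oideal_def)

definition adjoin :: "'a set \<Rightarrow> 'a \<Rightarrow> 'a set" where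
  "adjoin I x = {r * x + y |r y. r \<in> \<O> \<and> y \<in> I}"

lemma omodule_adjoin: assumes "omodule I" shows "omodule (adjoin I x)"
  unfolding omodule_def
proof (intro conjI ballI)
  show "0 \<in> adjoin I x" unfolding adjoin_def using zero omodule_zero[OF assms] by force
next
  fix u v assume "u \<in> adjoin I x" "v \<in> adjoin I x"
  then obtain r y s z where u: "u = r * x + y" "r \<in> \<O>" "y \<in> I" and v: "v = s * x + z" "s \<in> \<O>" "z \<in> I"
    by (auto simp: adjoin_def)
  have "u + v = (r + s) * x + (y + z)" unfolding u v by (simp add: algebra_simps)
  then show "u + v \<in> adjoin I x"
    using add[OF u(2) v(2)] omodule_add[OF assms u(3) v(3)] unfolding adjoin_def by blast
next
  fix t u assume t: "t \<in> \<O>" and "u \<in> adjoin I x"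
  then obtain r y where u: "u = r * x + y" "r \<in> \<O>" "y \<in> I" by (auto simp: adjoin_def)
  have "t * u = (t * r) * x + t * y" unfolding u by (simp add: algebra_simps)
  then show "t * u \<in> adjoin I x"
    using mult[OF t u(2)] omodule_scale[OF assms t u(3)] unfolding adjoin_def by blast
qed

lemma adjoin_le: "I \<subseteq> adjoin I x"
proof
  fix y assume "y \<in> I"
  then show "y \<in> adjoin I x" unfolding adjoin_def using zero by force
qed

lemma adjoin_mem: "omodule I \<Longrightarrow> x \<in> adjoin I x"
  unfolding adjoin_def using one omodule_zero by force

lemma oideal_adjoin: assumes "oideal I" "x \<in> \<O>" shows "oideal (adjoin I x)"
  using assms omodule_adjoin[of I x] mult add unfolding oideal_def adjoin_def by blast

lemma integer_in_ideal:
  assumes "oideal I" "I \<noteq> {0}" obtains N where "N > 0" "of_nat N \<in> I"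
proof -
  obtain x where x: "x \<in> I" "x \<noteq> 0" using assms omodule_zero[of I] unfolding oideal_def by blast
  have xO: "x \<in> \<O>" using x(1) assms(1) by (auto simp: oideal_def)
  obtain p :: "int poly" where p: "poly (map_poly of_int p) x = 0" "lead_coeff p = 1"
    using algebraic[OF xO] unfolding algebraic_int_altdef_ipoly by blast
  have "p \<noteq> 0" using p(2) by auto
  then obtain k q where k: "k \<noteq> 0" "of_int k = x * poly (map_poly of_int q) x"
    using nonzero_integer_multiple[OF _ p(1) x(2)] by blast
  have kI: "of_int k \<in> I"
    unfolding k(2) using omodule_scale[OF _ poly_in[OF xO] x(1)] assms(1) by (simp add: oideal_def mult.commute)
  have "of_nat (nat \<bar>k\<bar>) \<in> I"
    using kI omodule_uminus[of I "of_int k"] assms(1) by (cases "k \<ge> 0") (auto simp: oideal_def)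
  then show thesis using k(1) that[of "nat \<bar>k\<bar>"] by simp
qed

lemma omodule_principal: "omodule ((*) x ` \<O>)"
  unfolding omodule_def
proof (intro conjI ballI)
  show "0 \<in> (*) x ` \<O>" using zero by force
next
  fix u v assume "u \<in> (*) x ` \<O>" "v \<in> (*) x ` \<O>"
  then show "u + v \<in> (*) x ` \<O>" using add by (auto simp: distrib_left[symmetric])
next
  fix r u assume "r \<in> \<O>" "u \<in> (*) x ` \<O>"
  then obtain y where "y \<in> \<O>" "u = x * y" by blast
  then have "r * u = x * (r * y)" by simp
  then show "r * u \<in> (*) x ` \<O>" using mult[OF \<open>r \<in> \<O>\<close> \<open>y \<in> \<O>\<close>] by blast
qed

lemma oideal_principal: "x \<in> \<O> \<Longrightarrow> oideal ((*) x ` \<O>)"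
  using omodule_principal mult by (auto simp: oideal_def)

text \<open>With finitely many generators of the additive group of \<open>\<O>\<close>, every element is congruent modulo \<open>N\<close>
  to a combination of the generators with coefficients between \<open>0\<close> and \<open>N - 1\<close>.\<close>

lemma finite_cosets_integer:
  assumes "N > 0" shows "finite (cosets ((*) (of_nat N) ` \<O>) \<O>)"
proof -
  obtain B where B: "finite B" "zspan B = \<O>" using fg by blast
  define NO where "NO = (*) (of_nat N :: 'a) ` \<O>"
  have grp: "add_group NO"
    using oideal_principal[OF of_nat_in] by (simp add: NO_def oideal_def omodule_add_group)
  define F where "F = (\<lambda>u. \<Sum>b\<in>B. of_int (u b) * b) ` (B \<rightarrow>\<^sub>E {0..<int N})"
  have "finite F" unfolding F_def using B(1) by (intro finite_imageI finite_PiE) auto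
  moreover have "cosets NO \<O> \<subseteq> (\<lambda>x. (\<lambda>h. h + x) ` NO) ` F"
  proof
    fix C assume "C \<in> cosets NO \<O>"
    then obtain x where x: "x \<in> \<O>" "C = (\<lambda>h. h + x) ` NO" by (auto simp: cosets_def)
    obtain u where u: "x = (\<Sum>b\<in>B. of_int (u b) * b)"
      using x(1) unfolding B(2)[symmetric] zmod.span_finite[OF B(1)] by blast
    define y where "y = (\<Sum>b\<in>B. of_int (u b mod int N) * b)"
    define w where "w = (\<Sum>b\<in>B. of_int (u b div int N) * b)"
    have "of_int (u b) * b - of_int (u b mod int N) * b = of_nat N * (of_int (u b div int N) * b)" for b
    proof -
      have "(of_int (u b) :: 'a) = of_int (int N * (u b div int N) + u b mod int N)" by simp
      also have "\<dots> = of_nat N * of_int (u b div int N) + of_int (u b mod int N)"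
        by (simp only: of_int_add of_int_mult of_int_of_nat_eq)
      finally show ?thesis by (simp add: algebra_simps)
    qed
    then have "x - y = of_nat N * w"
      unfolding u y_def w_def by (simp add: sum_subtractf[symmetric] sum_distrib_left)
    moreover have "w \<in> \<O>" unfolding B(2)[symmetric] zmod.span_finite[OF B(1)] w_def by (rule range_eqI) simp
    ultimately have "x - y \<in> NO" unfolding NO_def by (metis imageI)
    then have "C = (\<lambda>h. h + y) ` NO" unfolding x(2) coset_eq_iff[OF grp] .
    moreover have "y \<in> F"
    proof -
      have "y = (\<Sum>b\<in>B. of_int (restrict (\<lambda>b. u b mod int N) B b) * b)"
        unfolding y_def by (rule sum.cong) auto
      moreover have "restrict (\<lambda>b. u b mod int N) B \<in> B \<rightarrow>\<^sub>E {0..<int N}" using assms by auto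
      ultimately show ?thesis unfolding F_def by (rule image_eqI)
    qed
    ultimately show "C \<in> (\<lambda>x. (\<lambda>h. h + x) ` NO) ` F" by blast
  qed
  ultimately show ?thesis unfolding NO_def by (meson finite_imageI finite_subset)
qed

lemma finite_cosets:
  assumes "oideal I" "I \<noteq> {0}" shows "finite (cosets I \<O>)"
proof -
  obtain N where N: "N > 0" "of_nat N \<in> I" using integer_in_ideal[OF assms] .
  have I: "omodule I" "I \<subseteq> \<O>" using assms by (simp_all add: oideal_def)
  have NO: "omodule ((*) (of_nat N) ` \<O>)" using oideal_principal[OF of_nat_in] by (simp add: oideal_def)
  have "(*) (of_nat N) ` \<O> \<subseteq> I"
    using omodule_scale[OF I(1) _ N(2)] by (auto simp: mult.commute)
  from index_tower(3)[OF omodule_add_group[OF NO] omodule_add_group[OF I(1)] omodule_add_group[OF omodule_O]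
      this I(2) finite_cosets_integer[OF N(1)]]
  show ?thesis ..
qed

lemma index_pos: "oideal I \<Longrightarrow> I \<noteq> {0} \<Longrightarrow> index I \<O> > 0"
  using finite_cosets[of I] one by (auto simp: index_def card_gt_0_iff cosets_def)

lemma ideal_index_less:
  assumes "oideal I" "I \<noteq> {0}" "oideal J" "I \<subset> J" shows "index J \<O> < index I \<O>"
  using assms omodule_O finite_cosets[OF assms(1,2)]
  by (intro index_less) (auto simp: oideal_def omodule_add_group)

text \<open>Coprimality to \<open>m\<close> within \<open>\<O>\<close>. For ideals it agrees with coprimality to \<open>m\<close> times the ring of
  integers (\<open>coprime_to_iff\<close>).\<close>

definition coprime_m :: "'a set \<Rightarrow> bool" where
  "coprime_m I \<longleftrightarrow> (\<exists>a\<in>I. \<exists>c\<in>\<O>. 1 = a + of_nat m * c)"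

lemma coprime_m_mono: "coprime_m I \<Longrightarrow> I \<subseteq> J \<Longrightarrow> coprime_m J"
  unfolding coprime_m_def by blast

lemma coprime_m_iprod:
  assumes "oideal I" "oideal J" "coprime_m I" "coprime_m J" shows "coprime_m (I \<star> J)"
proof -
  obtain a c b d where a: "a \<in> I" "c \<in> \<O>" "1 = a + of_nat m * c" and b: "b \<in> J" "d \<in> \<O>" "1 = b + of_nat m * d"
    using assms unfolding coprime_m_def by blast
  have "1 = (a + of_nat m * c) * (b + of_nat m * d)" using a(3) b(3) by simp
  also have "\<dots> = a * b + of_nat m * (c * (b + of_nat m * d) + a * d)" by (simp add: algebra_simps)
  finally have "1 = a * b + of_nat m * (c * (b + of_nat m * d) + a * d)" .
  moreover have "b \<in> \<O>" "a \<in> \<O>" using a b assms by (auto simp: oideal_def)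
  ultimately show ?thesis unfolding coprime_m_def using a b
    by (intro bexI[of _ "a * b"] bexI[of _ "c * (b + of_nat m * d) + a * d"])
      (auto intro: iprod_mult add mult of_nat_in)
qed

text \<open>The ideal \<open>I\<close> is finitely generated as a group, being of finite index over a multiple of \<open>\<O>\<close>, and
  so \<open>x\<close> is integral and \<open>m * x\<close> lies in \<open>\<O>\<close>. Multiplying \<open>1 = a + m * c\<close> by \<open>x\<close> gives the claim.\<close>

lemma multiplier_integral:
  assumes I: "oideal I" "I \<noteq> {0}" "coprime_m I" and stable: "\<And>y. y \<in> I \<Longrightarrow> x * y \<in> I"
  shows "x \<in> \<O>"
proof -
  have Im: "omodule I" using I(1) by (simp add: oideal_def)
  obtain N where N: "N > 0" "of_nat N \<in> I" using integer_in_ideal[OF I(1,2)] .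
  obtain B where B: "finite B" "zspan B = \<O>" using fg by blast
  define NO where "NO = (*) (of_nat N :: 'a) ` \<O>"
  have NOm: "omodule NO" using oideal_principal[OF of_nat_in] by (simp add: NO_def oideal_def)
  have NOI: "NO \<subseteq> I" using omodule_scale[OF Im _ N(2)] by (auto simp: NO_def mult.commute)
  have fin: "finite (cosets NO I)"
  proof -
    have "I \<subseteq> \<O>" "finite (cosets NO \<O>)"
      using I(1) finite_cosets_integer[OF N(1)] by (simp_all add: NO_def oideal_def)
    from index_tower(3)[OF omodule_add_group[OF NOm] omodule_add_group[OF Im] omodule_add_group[OF omodule_O] NOI this]
    show ?thesis ..
  qed
  obtain T where T: "transversal NO I T" using transversal_exists[OF omodule_add_group[OF NOm]] .
  then have finT: "finite T" using finite_transversal[OF omodule_add_group[OF NOm] T] fin by simp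
  define G where "G = (*) (of_nat N) ` B \<union> T"
  have TI: "T \<subseteq> I" using T by (simp add: transversal_def)
  have scaled: "of_nat N * w \<in> zspan ((*) (of_nat N) ` B)" if "w \<in> zspan B" for w
    using that
  proof (induction rule: zmod.span_induct_alt)
    case base then show ?case by (simp add: zmod.span_zero)
  next
    case (step c u v)
    have "of_int c * (of_nat N * u) + of_nat N * v \<in> zspan ((*) (of_nat N) ` B)"
      by (rule zmod.span_add[OF zmod.span_scale[OF zmod.span_base]]) (use step in blast)+
    then show ?case by (simp add: algebra_simps)
  qed
  have IG: "I \<subseteq> zspan G"
  proof
    fix y assume "y \<in> I"
    then obtain t where t: "t \<in> T" "y - t \<in> NO" using T by (auto simp: transversal_def)
    then obtain w where "w \<in> zspan B" "y - t = of_nat N * w" by (auto simp: NO_def B(2))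
    then have "y - t \<in> zspan G"
      using scaled[of w] zmod.span_mono[of "(*) (of_nat N) ` B" G] by (auto simp: G_def)
    then have "(y - t) + t \<in> zspan G"
      using t(1) by (intro zmod.span_add) (auto simp: G_def intro: zmod.span_base)
    then show "y \<in> zspan G" by simp
  qed
  have BO: "B \<subseteq> \<O>" using zmod.span_base[of _ B] B(2) by blast
  have GI: "G \<subseteq> I" unfolding G_def using TI NOI BO by (auto simp: NO_def)
  have "\<exists>g\<in>G. g \<noteq> 0"
    using zspan_generator_nonzero[of "of_nat N" G] IG N by auto
  moreover have "x * g \<in> zspan G" if "g \<in> G" for g
    using that GI IG stable by blast
  moreover have "finite G" unfolding G_def using B(1) finT by simp
  ultimately have "algebraic_int x" using algebraic_int_of_stable[of G x] by blast
  then have mx: "of_nat m * x \<in> \<O>" by (rule int_m)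
  obtain a c where a: "a \<in> I" "c \<in> \<O>" "1 = a + of_nat m * c" using I(3) unfolding coprime_m_def by blast
  have "x = x * (a + of_nat m * c)" using a(3) by simp
  also have "\<dots> = x * a + c * (of_nat m * x)" by (simp add: algebra_simps)
  finally have "x = x * a + c * (of_nat m * x)" .
  moreover have "x * a \<in> \<O>" using stable[OF a(1)] I(1) by (auto simp: oideal_def)
  ultimately show ?thesis using add[OF _ mult[OF a(2) mx]] by metis
qed

end

section \<open>Prime factorization and norms\<close>

context near_maximal_order
begin

definition oprime :: "'a set \<Rightarrow> bool" where
  "oprime P \<longleftrightarrow> oideal P \<and> P \<noteq> {0} \<and> 1 \<notin> P \<and> (\<forall>x\<in>\<O>. \<forall>y\<in>\<O>. x * y \<in> P \<longrightarrow> x \<in> P \<or> y \<in> P)"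

lemma oprime_oideal: "oprime P \<Longrightarrow> oideal P"
  and oprime_nonzero: "oprime P \<Longrightarrow> P \<noteq> {0}"
  and oprime_proper: "oprime P \<Longrightarrow> 1 \<notin> P"
  and oprime_cases: "oprime P \<Longrightarrow> x \<in> \<O> \<Longrightarrow> y \<in> \<O> \<Longrightarrow> x * y \<in> P \<Longrightarrow> x \<in> P \<or> y \<in> P"
  by (simp_all add: oprime_def)

lemma oprime_power:
  assumes "oprime P" "x \<in> \<O>" "x ^ n \<in> P" shows "x \<in> P"
  using assms(3)
proof (induction n)
  case 0 then show ?case using oprime_proper[OF assms(1)] by simp
next
  case (Suc n)
  then show ?case using oprime_cases[OF assms(1,2) power_in[OF assms(2)], of n] by auto
qed

text \<open>As the residue ring is finite, two powers of \<open>x\<close> agree modulo \<open>P\<close>. The lower one is not in \<open>P\<close> and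
  can be cancelled.\<close>

lemma oprime_inverse_mod:
  assumes P: "oprime P" and x: "x \<in> \<O>" "x \<notin> P"
  obtains y where "y \<in> \<O>" "1 - x * y \<in> P"
proof -
  have Pi: "oideal P" "P \<noteq> {0}" "omodule P" using P by (auto simp: oprime_def oideal_def)
  have "\<not> inj_on (\<lambda>n. (\<lambda>h. h + x ^ n) ` P) UNIV"
  proof
    assume inj: "inj_on (\<lambda>n. (\<lambda>h. h + x ^ n) ` P) UNIV"
    have "range (\<lambda>n. (\<lambda>h. h + x ^ n) ` P) \<subseteq> cosets P \<O>" using power_in[OF x(1)] by (auto simp: cosets_def)
    then have "finite (range (\<lambda>n. (\<lambda>h. h + x ^ n) ` P))"
      using finite_cosets[OF Pi(1,2)] finite_subset by blast
    then show False using finite_imageD[OF _ inj] by simp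
  qed
  then obtain a b where ab: "a \<noteq> b" "(\<lambda>h. h + x ^ a) ` P = (\<lambda>h. h + x ^ b) ` P"
    unfolding inj_on_def by blast
  have "\<exists>i j. i < j \<and> x ^ i - x ^ j \<in> P"
  proof (cases "a < b")
    case True
    then show ?thesis using ab(2) coset_eq_iff[OF omodule_add_group[OF Pi(3)]] by blast
  next
    case False
    then have "b < a" using ab(1) by simp
    then show ?thesis using ab(2)[symmetric] coset_eq_iff[OF omodule_add_group[OF Pi(3)]] by blast
  qed
  then obtain i j where ij: "i < j" "x ^ i - x ^ j \<in> P" by blast
  obtain k where k: "j = i + Suc k" using ij(1) less_imp_Suc_add by auto
  have "x ^ i * (1 - x * x ^ k) \<in> P" using ij(2) unfolding k by (simp add: algebra_simps power_add)
  moreover have "x ^ i \<notin> P" using oprime_power[OF P x(1)] x(2) by blast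
  ultimately have "1 - x * x ^ k \<in> P"
    using oprime_cases[OF P power_in[OF x(1)] diff[OF one mult[OF x(1) power_in[OF x(1)]]]] by blast
  then show thesis using that power_in[OF x(1)] by blast
qed

lemma oprime_maximal:
  assumes P: "oprime P" and J: "oideal J" "P \<subseteq> J" "\<not> J \<subseteq> P" shows "J = \<O>"
proof -
  obtain x where x: "x \<in> J" "x \<notin> P" using J(3) by blast
  have Jm: "omodule J" "J \<subseteq> \<O>" using J(1) by (auto simp: oideal_def)
  obtain y where y: "y \<in> \<O>" "1 - x * y \<in> P" using oprime_inverse_mod[OF P _ x(2)] x(1) Jm(2) by blast
  have "x * y \<in> J" using omodule_scale[OF Jm(1) y(1) x(1)] by (simp add: mult.commute)
  then have "(1 - x * y) + x * y \<in> J" using omodule_add[OF Jm(1)] y(2) J(2) by blast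
  then show ?thesis using oideal_one[OF J(1)] by simp
qed

lemma oprime_eq: "oprime P \<Longrightarrow> oprime Q \<Longrightarrow> Q \<subseteq> P \<Longrightarrow> Q = P"
  using oprime_maximal[of Q P] oprime_oideal oprime_proper one by blast

lemma not_oprime:
  assumes I: "oideal I" "I \<noteq> {0}" "1 \<notin> I" "\<not> oprime I"
  obtains x y where "x \<in> \<O>" "y \<in> \<O>" "I \<subset> adjoin I x" "I \<subset> adjoin I y" "adjoin I x \<star> adjoin I y \<subseteq> I"
proof -
  have Im: "omodule I" "I \<subseteq> \<O>" using I(1) by (auto simp: oideal_def)
  obtain x y where xy: "x \<in> \<O>" "y \<in> \<O>" "x * y \<in> I" "x \<notin> I" "y \<notin> I" using I unfolding oprime_def by blast
  have "I \<subset> adjoin I x" "I \<subset> adjoin I y"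
    using adjoin_le adjoin_mem[OF Im(1)] xy(4,5) by blast+
  moreover have "adjoin I x \<star> adjoin I y \<subseteq> I"
  proof (rule iprod_subset)
    fix u v assume "u \<in> adjoin I x" "v \<in> adjoin I y"
    then obtain r a s b where u: "u = r * x + a" "r \<in> \<O>" "a \<in> I" and v: "v = s * y + b" "s \<in> \<O>" "b \<in> I"
      by (auto simp: adjoin_def)
    have "u * v = (r * s) * (x * y) + (r * x) * b + (s * y + b) * a" unfolding u v by (simp add: algebra_simps)
    moreover have "(r * s) * (x * y) \<in> I" "(r * x) * b \<in> I" "(s * y + b) * a \<in> I"
      using u v xy Im(2) by (auto intro!: omodule_scale[OF Im(1)] mult add)
    ultimately show "u * v \<in> I" using omodule_add[OF Im(1)] by simp
  qed (rule omodule_add[OF Im(1)])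
  ultimately show thesis using that xy(1,2) by blast
qed

abbreviation lprod :: "'a set list \<Rightarrow> 'a set" where "lprod Ps \<equiv> foldr (\<star>) Ps \<O>"

lemma lprod_oideal: "(\<And>P. P \<in> set Ps \<Longrightarrow> oideal P) \<Longrightarrow> oideal (lprod Ps)"
  by (induction Ps) (auto intro: oideal_iprod oideal_O)

lemma lprod_append:
  "(\<And>P. P \<in> set Ps \<Longrightarrow> oideal P) \<Longrightarrow> (\<And>P. P \<in> set Qs \<Longrightarrow> oideal P) \<Longrightarrow> lprod (Ps @ Qs) = lprod Ps \<star> lprod Qs"
proof (induction Ps)
  case Nil
  then show ?case using O_iprod(1)[of "lprod Qs"] lprod_oideal[of Qs] by (simp add: oideal_def)
next
  case (Cons P Ps)
  then show ?case by (simp add: iprod_assoc)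
qed

lemma lprod_move: "lprod (xs @ P # ys) = P \<star> lprod (xs @ ys)"
  by (induction xs) (auto simp: iprod_left_commute)

text \<open>A proper ideal that is not prime contains the product of two strictly larger ideals, of smaller
  index.\<close>

lemma contains_prime_product:
  assumes "oideal I" "I \<noteq> {0}" shows "\<exists>Ps. (\<forall>P\<in>set Ps. oprime P) \<and> lprod Ps \<subseteq> I"
  using assms
proof (induction "index I \<O>" arbitrary: I rule: less_induct)
  case less
  show ?case
  proof (cases "1 \<in> I \<or> oprime I")
    case True
    then show ?thesis
    proof
      assume "1 \<in> I"
      then show ?thesis using oideal_one[OF less.prems(1)] by (intro exI[of _ "[]"]) simp
    next
      assume "oprime I"
      then show ?thesis using O_iprod(2)[of I] less.prems(1) by (intro exI[of _ "[I]"]) (simp add: oideal_def)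
    qed
  next
    case False
    then have nf: "1 \<notin> I" "\<not> oprime I" by auto
    obtain x y where xy: "x \<in> \<O>" "y \<in> \<O>" "I \<subset> adjoin I x" "I \<subset> adjoin I y"
        "adjoin I x \<star> adjoin I y \<subseteq> I" by (rule not_oprime[OF less.prems nf])
    have z: "0 \<in> I" using less.prems(1) omodule_zero by (auto simp: oideal_def)
    have "\<exists>Ps. (\<forall>P\<in>set Ps. oprime P) \<and> lprod Ps \<subseteq> adjoin I w" if w: "w \<in> \<O>" "I \<subset> adjoin I w" for w
    proof (rule less.hyps)
      show o: "oideal (adjoin I w)" by (rule oideal_adjoin[OF less.prems(1) w(1)])
      show "index (adjoin I w) \<O> < index I \<O>" by (rule ideal_index_less[OF less.prems o w(2)])
      show "adjoin I w \<noteq> {0}"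
    proof
      assume "adjoin I w = {0}"
      then have "I = {}" using psubset_imp_subset[OF w(2)] w(2) by (metis subset_singletonD less_irrefl)
      then show False using z by simp
    qed
    qed
    from this[OF xy(1,3)] this[OF xy(2,4)] obtain Ps Qs
      where PQ: "\<forall>P\<in>set Ps. oprime P" "lprod Ps \<subseteq> adjoin I x"
        "\<forall>P\<in>set Qs. oprime P" "lprod Qs \<subseteq> adjoin I y" by blast
    have "lprod (Ps @ Qs) = lprod Ps \<star> lprod Qs"
      using PQ oprime_oideal by (intro lprod_append) auto
    also have "\<dots> \<subseteq> I" using iprod_mono[OF PQ(2,4)] xy(5) by (rule subset_trans)
    finally show ?thesis using PQ by (intro exI[of _ "Ps @ Qs"]) auto
  qed
qed

lemma prime_above:
  assumes "oideal I" "I \<noteq> {0}" "1 \<notin> I" shows "\<exists>P. oprime P \<and> I \<subseteq> P"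
  using assms
proof (induction "index I \<O>" arbitrary: I rule: less_induct)
  case less
  show ?case
  proof (cases "oprime I")
    case False
    obtain x y where xy: "x \<in> \<O>" "y \<in> \<O>" "I \<subset> adjoin I x" "I \<subset> adjoin I y"
        "adjoin I x \<star> adjoin I y \<subseteq> I" by (rule not_oprime[OF less.prems False])
    have z: "0 \<in> I" using less.prems(1) omodule_zero by (auto simp: oideal_def)
    have "1 \<notin> adjoin I x \<or> 1 \<notin> adjoin I y"
      using iprod_mult[of 1 "adjoin I x" 1 "adjoin I y"] xy(5) less.prems(3) by auto
    then obtain w where w: "w \<in> \<O>" "I \<subset> adjoin I w" "1 \<notin> adjoin I w" using xy by blast
    have o: "oideal (adjoin I w)" by (rule oideal_adjoin[OF less.prems(1) w(1)])
    have "adjoin I w \<noteq> {0}"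
    proof
      assume "adjoin I w = {0}"
      then have "I = {}" using psubset_imp_subset[OF w(2)] w(2) by (metis subset_singletonD less_irrefl)
      then show False using z by simp
    qed
    from less.hyps[OF ideal_index_less[OF less.prems(1,2) o w(2)] o this w(3)]
    obtain P where "oprime P" "adjoin I w \<subseteq> P" by blast
    then show ?thesis using w(2) by blast
  qed blast
qed

lemma oprime_lprod:
  assumes P: "oprime P" and "\<forall>Q\<in>set Ps. oideal Q" "lprod Ps \<subseteq> P" shows "\<exists>Q\<in>set Ps. Q \<subseteq> P"
  using assms(2,3)
proof (induction Ps)
  case Nil then show ?case using oprime_proper[OF P] one by auto
next
  case (Cons Q Ps)
  show ?case
  proof (cases "Q \<subseteq> P")
    case False
    then obtain q where q: "q \<in> Q" "q \<notin> P" by blast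
    have "lprod Ps \<subseteq> P"
    proof
      fix x assume x: "x \<in> lprod Ps"
      have "q * x \<in> P" using iprod_mult[OF q(1) x] Cons.prems(2) by auto
      moreover have "q \<in> \<O>" "x \<in> \<O>" using q x Cons.prems(1) lprod_oideal[of Ps] by (auto simp: oideal_def)
      ultimately show "x \<in> P" using oprime_cases[OF P] q(2) by blast
    qed
    then show ?thesis using Cons by auto
  qed auto
qed

text \<open>The ideal quotient \<open>\<O> : I\<close>, the only candidate for an inverse of \<open>I\<close>.\<close>

definition colon :: "'a set \<Rightarrow> 'a set" where "colon I = {x. \<forall>y\<in>I. x * y \<in> \<O>}"

lemma omodule_colon: "omodule (colon I)"
  unfolding omodule_def colon_def by (auto simp: distrib_right mult.assoc intro: zero add mult)

lemma one_colon: "oideal I \<Longrightarrow> 1 \<in> colon I"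
  by (auto simp: colon_def oideal_def)

lemma iprod_colon_le: "I \<star> colon I \<subseteq> \<O>"
  by (rule iprod_subset) (auto simp: colon_def mult.commute intro: add)

text \<open>Take an integer \<open>a\<close> in \<open>P\<close> and a shortest product of prime ideals contained in \<open>a\<close> times \<open>\<O>\<close>. One
  of its factors is \<open>P\<close>; omitting this factor leaves an element \<open>b\<close> outside \<open>a\<close> times \<open>\<O>\<close>, and
  \<open>b / a\<close> maps \<open>P\<close> to \<open>\<O>\<close>.\<close>

lemma colon_prime_larger:
  assumes P: "oprime P" shows "\<exists>z\<in>colon P. z \<notin> \<O>"
proof -
  have Pi: "oideal P" "P \<noteq> {0}" "omodule P" "P \<subseteq> \<O>" using P by (auto simp: oprime_def oideal_def)
  obtain N where N: "N > 0" "of_nat N \<in> P" using integer_in_ideal[OF Pi(1,2)] .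
  define a where "a = (of_nat N :: 'a)"
  have a: "a \<noteq> 0" "a \<in> P" "a \<in> \<O>" using N Pi(4) by (auto simp: a_def)
  define A where "A = (*) a ` \<O>"
  have A1: "oideal A" unfolding A_def by (rule oideal_principal[OF a(3)])
  have "a * 1 \<in> A" unfolding A_def using one by (rule imageI)
  then have A2: "A \<noteq> {0}" using a(1) by auto
  have A3: "A \<subseteq> P" using omodule_scale[OF Pi(3) _ a(2)] by (auto simp: A_def mult.commute)
  note A = A1 A2 A3
  \<comment> \<open>The number of factors has to be minimal: a product with one factor less is then not
    contained in \<open>A\<close>.\<close>
  define good where "good n \<longleftrightarrow> (\<exists>Ps. length Ps = n \<and> (\<forall>Q\<in>set Ps. oprime Q) \<and> lprod Ps \<subseteq> A)" for n
  have "\<exists>n. good n" using contains_prime_product[OF A(1,2)] unfolding good_def by blast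
  then obtain n where n: "good n" "\<And>k. k < n \<Longrightarrow> \<not> good k" using exists_least_iff[of good] by blast
  obtain Ps where Ps: "length Ps = n" "\<forall>Q\<in>set Ps. oprime Q" "lprod Ps \<subseteq> A" using n(1) unfolding good_def by blast
  obtain Q where Q: "Q \<in> set Ps" "Q \<subseteq> P" using oprime_lprod[OF P, of Ps] Ps oprime_oideal A(3) by blast
  have "P \<in> set Ps" using oprime_eq[OF P _ Q(2)] Q(1) Ps(2) by blast
  then obtain xs ys where split: "Ps = xs @ P # ys" by (meson split_list)
  have "\<not> good (length (xs @ ys))" using n(2) Ps(1) split by simp
  moreover have "\<forall>Q\<in>set (xs @ ys). oprime Q" using Ps(2) unfolding split by simp
  ultimately have "\<not> lprod (xs @ ys) \<subseteq> A" unfolding good_def by blast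
  then obtain b where b: "b \<in> lprod (xs @ ys)" "b \<notin> A" by blast
  have "b / a \<in> colon P" unfolding colon_def
  proof (clarify)
    fix y assume "y \<in> P"
    then have "y * b \<in> P \<star> lprod (xs @ ys)" using b(1) by (rule iprod_mult)
    then have "y * b \<in> A" using Ps(3) unfolding split lprod_move by blast
    then show "b / a * y \<in> \<O>" using a(1) by (auto simp: A_def field_simps)
  qed
  moreover have "b / a \<notin> \<O>"
  proof
    assume "b / a \<in> \<O>"
    then have "a * (b / a) \<in> A" unfolding A_def by (rule imageI)
    then show False using b(2) a(1) by simp
  qed
  ultimately show ?thesis by blast
qed

text \<open>The product lies between the maximal ideal \<open>P\<close> and \<open>\<O>\<close>. If it were \<open>P\<close>, the elements of the ideal
  quotient would stabilize \<open>P\<close> and hence belong to \<open>\<O>\<close>.\<close>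

lemma prime_invertible:
  assumes P: "oprime P" "coprime_m P" shows "P \<star> colon P = \<O>"
proof -
  have Pi: "oideal P" "P \<noteq> {0}" "omodule P" "P \<subseteq> \<O>" using P by (auto simp: oprime_def oideal_def)
  have J: "oideal (P \<star> colon P)" using omodule_iprod[OF Pi(3) omodule_colon] iprod_colon_le by (simp add: oideal_def)
  have sub: "P \<subseteq> P \<star> colon P" using iprod_mult[of _ P 1 "colon P"] one_colon[OF Pi(1)] by auto
  have "\<not> P \<star> colon P \<subseteq> P"
  proof
    assume le: "P \<star> colon P \<subseteq> P"
    obtain z where z: "z \<in> colon P" "z \<notin> \<O>" using colon_prime_larger[OF P(1)] by blast
    have "z * y \<in> P" if "y \<in> P" for y
      using iprod_mult[OF that z(1)] le by (auto simp: mult.commute)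
    then show False using multiplier_integral[OF Pi(1,2) P(2), of z] z(2) by blast
  qed
  then show ?thesis by (rule oprime_maximal[OF P(1) J sub])
qed

text \<open>Multiplying \<open>I\<close> by the inverse of a prime ideal \<open>P\<close> above \<open>I\<close> gives an ideal that is strictly larger,
  since otherwise the inverse of \<open>P\<close> would stabilize \<open>I\<close> and lie in \<open>\<O>\<close>. So the index decreases.\<close>

lemma prime_factorization:
  assumes "oideal I" "I \<noteq> {0}" "coprime_m I"
  shows "\<exists>Ps. (\<forall>P\<in>set Ps. oprime P \<and> coprime_m P) \<and> I = lprod Ps"
  using assms
proof (induction "index I \<O>" arbitrary: I rule: less_induct)
  case less
  have Im: "omodule I" "I \<subseteq> \<O>" using less.prems(1) by (auto simp: oideal_def)
  show ?case
  proof (cases "1 \<in> I")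
    case True
    then show ?thesis using oideal_one[OF less.prems(1)] by (intro exI[of _ "[]"]) simp
  next
    case False
    then obtain P where P: "oprime P" "I \<subseteq> P" using prime_above[OF less.prems(1,2)] by blast
    have cP: "coprime_m P" by (rule coprime_m_mono[OF less.prems(3) P(2)])
    have Pm: "omodule P" using oprime_oideal[OF P(1)] by (simp add: oideal_def)
    define J where "J = colon P \<star> I"
    have "J \<subseteq> colon P \<star> P" unfolding J_def using P(2) by (intro iprod_mono) auto
    then have J: "oideal J" unfolding J_def oideal_def
      using omodule_iprod[OF omodule_colon Im(1)] iprod_colon_le[of P] by (auto simp: iprod_commute)
    have IJ: "I \<subseteq> J" using iprod_mult[of 1 "colon P" _ I] one_colon[OF oprime_oideal[OF P(1)]] unfolding J_def by auto
    have "I \<noteq> J"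
    proof
      assume eq: "I = J"
      obtain z where z: "z \<in> colon P" "z \<notin> \<O>" using colon_prime_larger[OF P(1)] by blast
      have "z * y \<in> I" if "y \<in> I" for y
        using iprod_mult[OF z(1) that] unfolding J_def[symmetric] eq[symmetric] .
      then show False using multiplier_integral[OF less.prems, of z] z(2) by blast
    qed
    then have less': "index J \<O> < index I \<O>" by (intro ideal_index_less[OF less.prems(1,2) J] psubsetI IJ)
    have "J \<noteq> {0}"
    proof
      assume "J = {0}"
      then have "I = {0}" using IJ omodule_zero[OF Im(1)] by (simp add: subset_singleton_iff) auto
      then show False using less.prems(2) by simp
    qed
    from less.hyps[OF less' J this coprime_m_mono[OF less.prems(3) IJ]]
    obtain Ps where Ps: "\<forall>P\<in>set Ps. oprime P \<and> coprime_m P" "J = lprod Ps" by blast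
    have "P \<star> J = (P \<star> colon P) \<star> I" unfolding J_def by (simp add: iprod_assoc)
    then have "I = P \<star> J" using prime_invertible[OF P(1) cP] O_iprod(1)[OF Im(1)] by simp
    then show ?thesis using Ps P(1) cP by (intro exI[of _ "P # Ps"]) auto
  qed
qed

text \<open>Multiplication by an element \<open>x\<close> of \<open>J\<close> outside \<open>P \<star> J\<close> induces an isomorphism of the residue ring
  of \<open>P\<close> with the quotient of \<open>J\<close> by \<open>P \<star> J\<close>. It is onto because \<open>P\<close> is maximal and \<open>J\<close> is invertible,
  so that no module lies strictly between \<open>P \<star> J\<close> and \<open>J\<close>.\<close>

lemma index_prime_mult:
  assumes P: "oprime P" and J: "oideal J" and J': "J \<star> J' = \<O>" "omodule J'"
  shows "index (P \<star> J) \<O> = index P \<O> * index J \<O>"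
proof -
  have Pm: "omodule P" "P \<subseteq> \<O>" "oideal P" and Jm: "omodule J" "J \<subseteq> \<O>"
    using oprime_oideal[OF P] J by (auto simp: oideal_def)
  have PJm: "omodule (P \<star> J)" by (rule omodule_iprod[OF Pm(1) Jm(1)])
  have PJ: "P \<star> J \<subseteq> J" by (rule oideal_iprod_le[OF Pm(3) J])
  have cancel: "(P \<star> J) \<star> J' = P" using J'(1) O_iprod(2)[OF Pm(1)] by (simp add: iprod_assoc)
  have "J \<noteq> P \<star> J"
  proof
    assume "J = P \<star> J"
    then have "\<O> = P" using J'(1) cancel by simp
    then show False using one oprime_proper[OF P] by simp
  qed
  then obtain x where x: "x \<in> J" "x \<notin> P \<star> J" using PJ by blast
  obtain T where T: "transversal P \<O> T" using transversal_exists[OF omodule_add_group[OF Pm(1)]] .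
  have TO: "T \<subseteq> \<O>" using T by (simp add: transversal_def)
  have xP: "x * p \<in> P \<star> J" if "p \<in> P" for p
    using iprod_mult[OF that x(1)] by (simp add: mult.commute)
  have onto: "\<exists>r\<in>\<O>. y - x * r \<in> P \<star> J" if y: "y \<in> J" for y
  proof -
    define S where "S = adjoin (P \<star> J) x"
    have Sm: "omodule S" unfolding S_def by (rule omodule_adjoin[OF PJm])
    have SJ: "S \<subseteq> J"
      using x(1) PJ omodule_scale[OF Jm(1)] omodule_add[OF Jm(1)] unfolding S_def adjoin_def by blast
    have SJ': "oideal (S \<star> J')"
      using iprod_mono[OF SJ, of J' J'] J' omodule_iprod[OF Sm] by (simp add: oideal_def)
    have sub: "P \<subseteq> S \<star> J'"
    proof -
      have "(P \<star> J) \<star> J' \<subseteq> S \<star> J'" unfolding S_def by (intro iprod_mono adjoin_le) auto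
      then show ?thesis unfolding cancel .
    qed
    have SJJ: "(S \<star> J') \<star> J = S"
      using J'(1) O_iprod(2)[OF Sm] by (simp add: iprod_assoc iprod_commute[of J'])
    have "\<not> S \<star> J' \<subseteq> P"
    proof
      assume "S \<star> J' \<subseteq> P"
      then have "(S \<star> J') \<star> J \<subseteq> P \<star> J" by (intro iprod_mono) auto
      then have "S \<subseteq> P \<star> J" unfolding SJJ .
      then show False using x(2) adjoin_mem[OF PJm] unfolding S_def by blast
    qed
    then have "S \<star> J' = \<O>" by (rule oprime_maximal[OF P SJ' sub])
    then have "S = J" using SJJ O_iprod(1)[OF Jm(1)] by simp
    then obtain r z where "y = r * x + z" "r \<in> \<O>" "z \<in> P \<star> J" using y unfolding S_def adjoin_def by blast
    then show ?thesis by (intro bexI[of _ r]) (auto simp: mult.commute)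
  qed
  have xT: "transversal (P \<star> J) J ((*) x ` T)"
    unfolding transversal_def
  proof (intro conjI ballI impI)
    show "(*) x ` T \<subseteq> J" using TO omodule_scale[OF Jm(1) _ x(1)] by (auto simp: mult.commute)
    fix y assume "y \<in> J"
    then obtain r where r: "r \<in> \<O>" "y - x * r \<in> P \<star> J" using onto by blast
    then obtain t where t: "t \<in> T" "r - t \<in> P" using T by (auto simp: transversal_def)
    have "y - x * t = (y - x * r) + x * (r - t)" by (simp add: algebra_simps)
    then have "y - x * t \<in> P \<star> J" using iprod_add[OF r(2) xP[OF t(2)]] by (simp only:)
    then show "\<exists>s\<in>(*) x ` T. y - s \<in> P \<star> J" using t(1) by blast
  next
    fix s s' assume s: "s \<in> (*) x ` T" and s': "s' \<in> (*) x ` T" and d: "s - s' \<in> P \<star> J"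
    obtain t where t1: "t \<in> T" "s = x * t" using s by (rule imageE)
    obtain t' where t2: "t' \<in> T" "s' = x * t'" using s' by (rule imageE)
    note t = t1(1) t2(1) t1(2) t2(2)
    have dO: "t - t' \<in> \<O>" using t TO diff by blast
    have "t - t' \<in> P"
    proof (rule ccontr)
      assume "t - t' \<notin> P"
      then obtain w where w: "w \<in> \<O>" "1 - (t - t') * w \<in> P" using oprime_inverse_mod[OF P dO] by blast
      have "x * (1 - (t - t') * w) + w * (s - s') = x" unfolding t by (simp add: algebra_simps)
      then have "x \<in> P \<star> J" using iprod_add[OF xP[OF w(2)] omodule_scale[OF PJm w(1) d]] by metis
      then show False using x(2) by blast
    qed
    then have "t = t'" using T t(1,2) unfolding transversal_def by blast
    then show "s = s'" using t by simp
  qed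
  have "x \<noteq> 0" using x(2) omodule_zero[OF PJm] by blast
  then have "inj_on ((*) x) T" by (simp add: inj_on_def)
  then have "index (P \<star> J) J = index P \<O>"
    using index_transversal[OF omodule_add_group[OF PJm] xT] index_transversal[OF omodule_add_group[OF Pm(1)] T]
    by (simp add: card_image)
  then show ?thesis
    using index_tower(1)[OF omodule_add_group[OF PJm] omodule_add_group[OF Jm(1)] omodule_add_group[OF omodule_O] PJ Jm(2)]
    by simp
qed

lemma lprod_invertible:
  "(\<And>P. P \<in> set Ps \<Longrightarrow> oprime P \<and> coprime_m P) \<Longrightarrow> \<exists>J. omodule J \<and> lprod Ps \<star> J = \<O>"
proof (induction Ps)
  case Nil
  then show ?case using O_iprod(1)[OF omodule_O] omodule_O by auto
next
  case (Cons P Ps)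
  then obtain J where J: "omodule J" "lprod Ps \<star> J = \<O>" by auto
  have P: "P \<star> colon P = \<O>" using Cons.prems prime_invertible by auto
  have "lprod (P # Ps) \<star> (colon P \<star> J) = (P \<star> colon P) \<star> (lprod Ps \<star> J)"
    by (simp add: iprod_assoc iprod_left_commute)
  then have "lprod (P # Ps) \<star> (colon P \<star> J) = \<O>" using P J(2) O_iprod(1)[OF omodule_O] by simp
  then show ?case using omodule_iprod[OF omodule_colon J(1)] by blast
qed

lemma index_lprod:
  "(\<And>P. P \<in> set Ps \<Longrightarrow> oprime P \<and> coprime_m P) \<Longrightarrow> index (lprod Ps) \<O> = (\<Prod>P\<leftarrow>Ps. index P \<O>)"
proof (induction Ps)
  case Nil
  have "transversal \<O> \<O> {0}" using zero by (auto simp: transversal_def)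
  then show ?case using index_transversal[OF omodule_add_group[OF omodule_O]] by force
next
  case (Cons P Ps)
  obtain J where "lprod Ps \<star> J = \<O>" "omodule J" using lprod_invertible[of Ps] Cons.prems by auto
  then have "index (P \<star> lprod Ps) \<O> = index P \<O> * index (lprod Ps) \<O>"
    using Cons.prems oprime_oideal by (intro index_prime_mult lprod_oideal) auto
  then show ?case using Cons by auto
qed

lemma coprime_m_lprod:
  "(\<And>P. P \<in> set Ps \<Longrightarrow> oprime P \<and> coprime_m P) \<Longrightarrow> coprime_m (lprod Ps)"
proof (induction Ps)
  case Nil
  show ?case unfolding coprime_m_def using one zero by (intro bexI[of _ 1] bexI[of _ 0]) auto
next
  case (Cons P Ps)
  then show ?case using oprime_oideal by (auto intro!: coprime_m_iprod lprod_oideal)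
qed

end

section \<open>The Galois group and the primes above a rational prime\<close>

lemma Gal_iff:
  "\<gamma> \<in> Gal \<longleftrightarrow> bij \<gamma> \<and> \<gamma> 1 = 1 \<and> (\<forall>x y. \<gamma> (x + y) = \<gamma> x + \<gamma> y) \<and> (\<forall>x y. \<gamma> (x * y) = \<gamma> x * \<gamma> y)"
  by (auto simp: Gal_def ring_iso_def Ring.ring_hom_def ring_of_type_algebra_def)

context
  fixes \<gamma> :: "'a::field_char_0 \<Rightarrow> 'a" assumes \<gamma>: "\<gamma> \<in> Gal"
begin

lemma Gal_bij: "bij \<gamma>" and Gal_1: "\<gamma> 1 = 1"
  and Gal_add: "\<gamma> (x + y) = \<gamma> x + \<gamma> y" and Gal_mult: "\<gamma> (x * y) = \<gamma> x * \<gamma> y"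
  using \<gamma> by (auto simp: Gal_iff)

lemma Gal_0: "\<gamma> 0 = 0" using Gal_add[of 0 0] by simp
lemma Gal_uminus: "\<gamma> (- x) = - \<gamma> x" using Gal_add[of x "- x"] Gal_0 by (simp add: eq_neg_iff_add_eq_0 add.commute)
lemma Gal_diff: "\<gamma> (x - y) = \<gamma> x - \<gamma> y" using Gal_add[of x "- y"] Gal_uminus by simp
lemma Gal_inj: "\<gamma> x = \<gamma> y \<longleftrightarrow> x = y" using Gal_bij by (simp add: bij_def inj_eq)
lemma Gal_eq_0: "\<gamma> x = 0 \<longleftrightarrow> x = 0" using Gal_inj[of x 0] Gal_0 by simp
lemma Gal_of_nat: "\<gamma> (of_nat n) = of_nat n" by (induction n) (auto simp: Gal_0 Gal_1 Gal_add)
lemma Gal_of_int: "\<gamma> (of_int k) = of_int k" by (cases k) (auto simp: Gal_of_nat Gal_uminus simp del: of_nat_Suc)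
lemma Gal_sum: "\<gamma> (sum f A) = (\<Sum>i\<in>A. \<gamma> (f i))"
  by (induction A rule: infinite_finite_induct) (auto simp: Gal_0 Gal_add)
lemma Gal_prod: "\<gamma> (prod f A) = (\<Prod>i\<in>A. \<gamma> (f i))"
  by (induction A rule: infinite_finite_induct) (auto simp: Gal_1 Gal_mult)
lemma Gal_poly: "\<gamma> (poly (map_poly of_int q) x) = poly (map_poly of_int q) (\<gamma> x)"
  by (induction q) (auto simp: of_int_hom.map_poly_pCons_hom Gal_0 Gal_add Gal_mult Gal_of_int)

lemma Gal_inv: "inv_into UNIV \<gamma> \<in> Gal"
proof -
  have r: "\<gamma> (inv_into UNIV \<gamma> x) = x" for x using Gal_bij by (simp add: bij_def surj_f_inv_f)
  have "bij (inv_into UNIV \<gamma>)" by (rule bij_imp_bij_inv[OF Gal_bij])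
  moreover have "inv_into UNIV \<gamma> 1 = 1" using Gal_inj[of "inv_into UNIV \<gamma> 1" 1] by (simp add: r Gal_1)
  moreover have "inv_into UNIV \<gamma> (x + y) = inv_into UNIV \<gamma> x + inv_into UNIV \<gamma> y" for x y
    using Gal_inj[of "inv_into UNIV \<gamma> (x + y)" "inv_into UNIV \<gamma> x + inv_into UNIV \<gamma> y"] by (simp add: r Gal_add)
  moreover have "inv_into UNIV \<gamma> (x * y) = inv_into UNIV \<gamma> x * inv_into UNIV \<gamma> y" for x y
    using Gal_inj[of "inv_into UNIV \<gamma> (x * y)" "inv_into UNIV \<gamma> x * inv_into UNIV \<gamma> y"] by (simp add: r Gal_mult)
  ultimately show ?thesis unfolding Gal_iff by blast
qed

lemma Gal_inv_left: "inv_into UNIV \<gamma> (\<gamma> x) = x" and Gal_inv_right: "\<gamma> (inv_into UNIV \<gamma> x) = x"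
  using Gal_bij by (simp_all add: bij_def surj_f_inv_f)

lemma Gal_iprod: "\<gamma> ` (I \<star> J) = (\<gamma> ` I) \<star> (\<gamma> ` J)"
proof
  show "\<gamma> ` (I \<star> J) \<subseteq> (\<gamma> ` I) \<star> (\<gamma> ` J)"
  proof clarify
    fix x assume "x \<in> I \<star> J"
    then show "\<gamma> x \<in> (\<gamma> ` I) \<star> (\<gamma> ` J)"
      by (induction rule: iprod_induct) (auto simp: Gal_mult Gal_add intro: iprod_mult iprod_add)
  qed
  show "(\<gamma> ` I) \<star> (\<gamma> ` J) \<subseteq> \<gamma> ` (I \<star> J)"
  proof (rule iprod_subset)
    fix u v assume "u \<in> \<gamma> ` I" "v \<in> \<gamma> ` J"
    then obtain i j where "i \<in> I" "j \<in> J" "u = \<gamma> i" "v = \<gamma> j" by blast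
    then show "u * v \<in> \<gamma> ` (I \<star> J)" using iprod_mult[of i I j J] by (auto simp: Gal_mult[symmetric])
  next
    fix u v assume "u \<in> \<gamma> ` (I \<star> J)" "v \<in> \<gamma> ` (I \<star> J)"
    then obtain i j where "i \<in> I \<star> J" "j \<in> I \<star> J" "u = \<gamma> i" "v = \<gamma> j" by blast
    then show "u + v \<in> \<gamma> ` (I \<star> J)" using iprod_add[of i I J j] by (auto simp: Gal_add[symmetric])
  qed
qed

end

lemma Gal_id: "(\<lambda>x. x) \<in> Gal" by (simp add: Gal_iff bij_def)

lemma Gal_comp: "\<gamma> \<in> Gal \<Longrightarrow> \<delta> \<in> Gal \<Longrightarrow> \<gamma> \<circ> \<delta> \<in> Gal"
  by (simp add: Gal_iff bij_comp)

lemma bezout_prime: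
  assumes "Factorial_Ring.prime p" "\<not> int p dvd k" obtains u v where "u * int p + v * k = 1"
proof -
  have "gcd (int p) k = 1" using assms prime_imp_coprime[of "int p" k] by simp
  then show thesis using that bezout_int[of "int p" k] by auto
qed

locale galois_order = near_maximal_order +
  assumes Gal_O: "\<gamma> \<in> Gal \<Longrightarrow> \<gamma> ` \<O> = \<O>"
    and galois: "galois_over_rat TYPE('a)"
begin

lemma Gal_in: "\<gamma> \<in> Gal \<Longrightarrow> x \<in> \<O> \<Longrightarrow> \<gamma> x \<in> \<O>" using Gal_O by blast

text \<open>Every element of the field is a quotient of elements of \<open>\<O>\<close>, so that an automorphism is determined
  by its values on finitely many generators of \<open>\<O>\<close>; and each value is a root of the equation of the
  generator.\<close>

lemma finite_Gal: "finite (Gal :: ('a \<Rightarrow> 'a) set)"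
proof -
  obtain B where B: "finite B" "zspan B = \<O>" using fg by blast
  have BO: "B \<subseteq> \<O>" using zmod.span_base[of _ B] B(2) by blast
  define R where "R b = {y. \<exists>\<gamma>\<in>Gal. y = \<gamma> b}" for b :: 'a
  have finR: "finite (R b)" if "b \<in> B" for b
  proof -
    have "algebraic_int b" using algebraic BO that by blast
    then obtain p :: "int poly" where p: "poly (map_poly of_int p) b = 0" "lead_coeff p = 1"
      unfolding algebraic_int_altdef_ipoly by blast
    have "map_poly of_int p \<noteq> (0 :: 'a poly)" using p(2) by auto
    moreover have "R b \<subseteq> {y. poly (map_poly of_int p) y = 0}"
    proof
      fix y assume "y \<in> R b"
      then obtain \<gamma> where g: "\<gamma> \<in> Gal" "y = \<gamma> b" by (auto simp: R_def)
      have "poly (map_poly of_int p) y = \<gamma> (poly (map_poly of_int p) b)"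
        unfolding g(2) by (rule Gal_poly[OF g(1), symmetric])
      then show "y \<in> {y. poly (map_poly of_int p) y = 0}" using p(1) Gal_0[OF g(1)] by simp
    qed
    ultimately show ?thesis using poly_roots_finite finite_subset by blast
  qed
  have inj: "inj_on (\<lambda>\<gamma>. restrict \<gamma> B) (Gal :: ('a \<Rightarrow> 'a) set)"
  proof (rule inj_onI)
    fix \<gamma> \<delta> :: "'a \<Rightarrow> 'a" assume g: "\<gamma> \<in> Gal" "\<delta> \<in> Gal" and eq: "restrict \<gamma> B = restrict \<delta> B"
    have onO: "\<gamma> x = \<delta> x" if x: "x \<in> \<O>" for x
    proof -
      obtain u where u: "x = (\<Sum>b\<in>B. of_int (u b) * b)"
        using x unfolding B(2)[symmetric] zmod.span_finite[OF B(1)] by blast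
      have "\<gamma> b = \<delta> b" if "b \<in> B" for b using fun_cong[OF eq, of b] that by simp
      then show ?thesis unfolding u by (simp add: Gal_sum Gal_mult Gal_of_int g)
    qed
    show "\<gamma> = \<delta>"
    proof
      fix x
      obtain d where d: "d \<in> \<O>" "d \<noteq> 0" "d * x \<in> \<O>" using frac by blast
      have "\<gamma> d * \<gamma> x = \<gamma> d * \<delta> x"
        using onO[OF d(1)] onO[OF d(3)] by (simp add: Gal_mult g)
      then show "\<gamma> x = \<delta> x" using d(2) Gal_eq_0[OF g(1)] by simp
    qed
  qed
  have "(\<lambda>\<gamma>. restrict \<gamma> B) ` Gal \<subseteq> PiE B R" by (auto simp: R_def)
  from finite_subset[OF this finite_PiE[OF B(1) finR]] show ?thesis by (rule finite_imageD[OF _ inj])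
qed

text \<open>The product is invariant under the Galois group, hence rational, and it is integral.\<close>

lemma norm_integer:
  assumes x: "x \<in> \<O>" shows "(\<Prod>\<gamma>\<in>Gal. \<gamma> x) \<in> \<int>"
proof (rule rational_algebraic_int_is_int)
  show "algebraic_int (\<Prod>\<gamma>\<in>Gal. \<gamma> x)" by (rule algebraic, rule prod_in) (rule Gal_in[OF _ x])
  have "\<delta> (\<Prod>\<gamma>\<in>Gal. \<gamma> x) = (\<Prod>\<gamma>\<in>Gal. \<gamma> x)" if d: "\<delta> \<in> Gal" for \<delta>
  proof -
    have "\<delta> (\<Prod>\<gamma>\<in>Gal. \<gamma> x) = (\<Prod>\<gamma>\<in>Gal. (\<delta> \<circ> \<gamma>) x)" by (simp add: Gal_prod[OF d])
    also have "\<dots> = (\<Prod>\<gamma>\<in>Gal. \<gamma> x)"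
    proof (rule prod.reindex_bij_betw[of "\<lambda>\<gamma>. \<delta> \<circ> \<gamma>" Gal Gal "\<lambda>\<gamma>. \<gamma> x"])
      show "bij_betw (\<lambda>\<gamma>. \<delta> \<circ> \<gamma>) Gal Gal"
        by (rule bij_betwI[where g = "\<lambda>\<gamma>. inv_into UNIV \<delta> \<circ> \<gamma>"])
          (auto intro: Gal_comp d Gal_inv simp: fun_eq_iff Gal_inv_left[OF d] Gal_inv_right[OF d])
    qed
    finally show ?thesis .
  qed
  then show "(\<Prod>\<gamma>\<in>Gal. \<gamma> x) \<in> \<rat>" using galois unfolding galois_over_rat_def by blast
qed

lemma omodule_image: assumes g: "\<gamma> \<in> Gal" and I: "omodule I" shows "omodule (\<gamma> ` I)"
  unfolding omodule_def
proof (intro conjI ballI)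
  show "0 \<in> \<gamma> ` I" using Gal_0[OF g] omodule_zero[OF I] by (metis imageI)
next
  fix u v assume "u \<in> \<gamma> ` I" "v \<in> \<gamma> ` I"
  then show "u + v \<in> \<gamma> ` I" using omodule_add[OF I] by (auto simp: Gal_add[OF g, symmetric])
next
  fix r u assume r: "r \<in> \<O>" and "u \<in> \<gamma> ` I"
  then obtain x where x: "x \<in> I" "u = \<gamma> x" by blast
  obtain s where "s \<in> \<O>" "r = \<gamma> s" using r Gal_O[OF g] by blast
  then show "r * u \<in> \<gamma> ` I" using omodule_scale[OF I _ x(1), of s] x(2) by (auto simp: Gal_mult[OF g, symmetric])
qed

lemma oideal_image: "\<gamma> \<in> Gal \<Longrightarrow> oideal I \<Longrightarrow> oideal (\<gamma> ` I)"
  using omodule_image[of \<gamma> I] Gal_in[of \<gamma>] by (auto simp: oideal_def)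

lemma coprime_m_image: assumes g: "\<gamma> \<in> Gal" and I: "coprime_m I" shows "coprime_m (\<gamma> ` I)"
proof -
  obtain a c where a: "a \<in> I" "c \<in> \<O>" "1 = a + of_nat m * c" using I unfolding coprime_m_def by blast
  have "\<gamma> 1 = \<gamma> (a + of_nat m * c)" using a(3) by simp
  then have "1 = \<gamma> a + of_nat m * \<gamma> c" by (simp add: Gal_1[OF g] Gal_add[OF g] Gal_mult[OF g] Gal_of_nat[OF g])
  then show ?thesis unfolding coprime_m_def using a Gal_in[OF g a(2)] by blast
qed

lemma oprime_image: assumes g: "\<gamma> \<in> Gal" and P: "oprime P" shows "oprime (\<gamma> ` P)"
  unfolding oprime_def
proof (intro conjI ballI impI)
  show "oideal (\<gamma> ` P)" by (rule oideal_image[OF g oprime_oideal[OF P]])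
  show "\<gamma> ` P \<noteq> {0}"
  proof
    assume "\<gamma> ` P = {0}"
    then have "\<gamma> x = 0" if "x \<in> P" for x using that by blast
    then have "P \<subseteq> {0}" using Gal_eq_0[OF g] by blast
    then show False using oprime_nonzero[OF P] oprime_oideal[OF P] omodule_zero by (auto simp: oideal_def)
  qed
  show "1 \<notin> \<gamma> ` P"
  proof
    assume "1 \<in> \<gamma> ` P"
    then obtain x where "x \<in> P" "\<gamma> x = \<gamma> 1" using Gal_1[OF g] by auto
    then show False using Gal_inj[OF g] oprime_proper[OF P] by metis
  qed
  fix x y assume "x \<in> \<O>" "y \<in> \<O>" and xy: "x * y \<in> \<gamma> ` P"
  then have "x \<in> \<gamma> ` \<O>" "y \<in> \<gamma> ` \<O>" by (simp_all add: Gal_O[OF g])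
  then obtain u v where u: "u \<in> \<O>" "x = \<gamma> u" and v: "v \<in> \<O>" "y = \<gamma> v" by (elim imageE)
  obtain w where w: "w \<in> P" "x * y = \<gamma> w" using xy by (rule imageE)
  have "u * v = w" using w(2) unfolding u(2) v(2) Gal_mult[OF g, symmetric] Gal_inj[OF g] .
  then have "u \<in> P \<or> v \<in> P" using oprime_cases[OF P u(1) v(1)] w(1) by simp
  then show "x \<in> \<gamma> ` P \<or> y \<in> \<gamma> ` P" unfolding u(2) v(2) by blast
qed

lemma index_image: assumes g: "\<gamma> \<in> Gal" and I: "omodule I" shows "index (\<gamma> ` I) \<O> = index I \<O>"
proof -
  obtain T where T: "transversal I \<O> T" using transversal_exists[OF omodule_add_group[OF I]] .
  have "transversal (\<gamma> ` I) (\<gamma> ` \<O>) (\<gamma> ` T)"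
    using T unfolding transversal_def
    by (auto simp: Gal_diff[OF g, symmetric] Gal_inj[OF g] image_iff)
  moreover have "card (\<gamma> ` T) = card T"
    using Gal_inj[OF g] by (intro card_image) (auto simp: inj_on_def)
  ultimately show ?thesis
    using index_transversal[OF omodule_add_group[OF I] T] index_transversal[OF omodule_add_group[OF omodule_image[OF g I]]]
    unfolding Gal_O[OF g] by simp
qed

lemma integer_in_oprime:
  assumes P: "oprime P" and p: "Factorial_Ring.prime p" "of_nat p \<in> P" and k: "of_int k \<in> P"
  shows "int p dvd k"
proof (rule ccontr)
  assume "\<not> int p dvd k"
  then obtain u v where uv: "u * int p + v * k = 1" by (rule bezout_prime[OF p(1)])
  have "(of_int (u * int p + v * k) :: 'a) = of_int u * of_nat p + of_int v * of_int k" by simp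
  also have "\<dots> \<in> P" using oprime_oideal[OF P] p k of_int_in unfolding oideal_def
    by (intro omodule_add omodule_scale) auto
  finally show False using oprime_proper[OF P] unfolding uv by simp
qed

lemma oprime_prime_number:
  assumes P: "oprime P" shows "\<exists>p. Factorial_Ring.prime p \<and> of_nat p \<in> P"
proof -
  obtain N where N: "N > 0" "of_nat N \<in> P" using integer_in_ideal[OF oprime_oideal[OF P] oprime_nonzero[OF P]] .
  then show ?thesis
  proof (induction N rule: less_induct)
    case (less N)
    have "N \<noteq> 1" using less.prems(2) oprime_proper[OF P] by auto
    then obtain p where p: "Factorial_Ring.prime p" "p dvd N" using prime_factor_nat by blast
    then obtain k where k: "N = p * k" by blast
    have "of_nat p * of_nat k \<in> P" using less.prems(2) unfolding k by simp
    then have "of_nat p \<in> P \<or> of_nat k \<in> P" using oprime_cases[OF P of_nat_in of_nat_in] by blast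
    moreover have "k < N" "k > 0" using k less.prems(1) prime_gt_1_nat[OF p(1)] by auto
    ultimately show ?case using less.IH p(1) by blast
  qed
qed

lemma coprime_m_iff_not_dvd:
  assumes P: "oprime P" and p: "Factorial_Ring.prime p" "of_nat p \<in> P"
  shows "coprime_m P \<longleftrightarrow> \<not> p dvd m"
proof
  assume c: "coprime_m P"
  show "\<not> p dvd m"
  proof
    assume "p dvd m"
    then obtain k where k: "m = p * k" by blast
    obtain a c where a: "a \<in> P" "c \<in> \<O>" "1 = a + of_nat m * c" using c unfolding coprime_m_def by blast
    have "a + (of_nat k * c) * of_nat p \<in> P"
      using oprime_oideal[OF P] a p(2) unfolding oideal_def
      by (intro omodule_add omodule_scale mult of_nat_in) auto
    also have "a + (of_nat k * c) * of_nat p = 1" unfolding a(3) k by (simp add: algebra_simps)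
    finally show False using oprime_proper[OF P] by simp
  qed
next
  assume "\<not> p dvd m"
  then have "\<not> int p dvd int m" by simp
  then obtain u v where uv: "u * int p + v * int m = 1" by (rule bezout_prime[OF p(1)])
  have "(1 :: 'a) = of_int (u * int p + v * int m)" unfolding uv by simp
  also have "\<dots> = of_int u * of_nat p + of_nat m * of_int v" by simp
  finally have "1 = of_int u * of_nat p + of_nat m * (of_int v :: 'a)" .
  moreover have "of_int u * of_nat p \<in> P" using oprime_oideal[OF P] p(2) of_int_in
    unfolding oideal_def by (intro omodule_scale) auto
  ultimately show "coprime_m P" unfolding coprime_m_def using of_int_in by blast
qed

text \<open>If \<open>Q\<close> differs from all conjugates of \<open>P\<close>, there is an \<open>x\<close> in \<open>Q\<close> that lies in no conjugate of \<open>P\<close>.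
  The norm of \<open>x\<close> is an integer in \<open>Q\<close>, hence a multiple of \<open>p\<close> and an element of \<open>P\<close>. So one of the
  conjugates of \<open>x\<close> lies in \<open>P\<close>, that is, \<open>x\<close> lies in a conjugate of \<open>P\<close> after all.\<close>

lemma Gal_transitive:
  assumes P: "oprime P" and Q: "oprime Q" and p: "Factorial_Ring.prime p" "of_nat p \<in> P" "of_nat p \<in> Q"
  shows "\<exists>\<gamma>\<in>Gal. Q = \<gamma> ` P"
proof (rule ccontr)
  assume no: "\<not> ?thesis"
  have Qm: "omodule Q" "Q \<subseteq> \<O>" using oprime_oideal[OF Q] by (auto simp: oideal_def)
  have Pm: "omodule P" "P \<subseteq> \<O>" using oprime_oideal[OF P] by (auto simp: oideal_def)
  have "\<exists>b. b \<in> \<gamma> ` P \<and> 1 - b \<in> Q" if g: "\<gamma> \<in> Gal" for \<gamma>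
  proof -
    have gP: "oprime (\<gamma> ` P)" by (rule oprime_image[OF g P])
    have "\<not> Q \<subseteq> \<gamma> ` P" using oprime_eq[OF gP Q] no g by blast
    then obtain a where a: "a \<in> Q" "a \<notin> \<gamma> ` P" by blast
    then obtain y where y: "y \<in> \<O>" "1 - a * y \<in> \<gamma> ` P" using oprime_inverse_mod[OF gP] Qm(2) by blast
    have "1 - (1 - a * y) \<in> Q" using omodule_scale[OF Qm(1) y(1) a(1)] by (simp add: mult.commute)
    then show ?thesis using y(2) by blast
  qed
  then have "\<forall>\<gamma>\<in>Gal. \<exists>b. b \<in> \<gamma> ` P \<and> 1 - b \<in> Q" by blast
  from bchoice[OF this] obtain b where b: "\<And>\<gamma>. \<gamma> \<in> Gal \<Longrightarrow> b \<gamma> \<in> \<gamma> ` P" "\<And>\<gamma>. \<gamma> \<in> Gal \<Longrightarrow> 1 - b \<gamma> \<in> Q"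
    by blast
  have bO: "b \<gamma> \<in> \<O>" if "\<gamma> \<in> Gal" for \<gamma>
    using b(1)[OF that] image_mono[OF Pm(2), of \<gamma>] unfolding Gal_O[OF that] by (rule rev_subsetD)
  \<comment> \<open>The factor \<open>b \<gamma>\<close> is \<open>0\<close> modulo \<open>\<gamma> ` P\<close>, and all factors are \<open>1\<close> modulo \<open>Q\<close>. Hence
    \<open>x\<close> is \<open>0\<close> modulo \<open>Q\<close> and \<open>1\<close> modulo every conjugate of \<open>P\<close>.\<close>
  define x where "x = 1 - (\<Prod>\<gamma>\<in>Gal. b \<gamma>)"
  have "1 - (\<Prod>\<gamma>\<in>A. b \<gamma>) \<in> Q" if "A \<subseteq> Gal" for A
    using that
  proof (induction A rule: infinite_finite_induct)
    case (insert \<gamma> A)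
    have "1 - (\<Prod>\<gamma>\<in>insert \<gamma> A. b \<gamma>) = (1 - b \<gamma>) + b \<gamma> * (1 - (\<Prod>\<gamma>\<in>A. b \<gamma>))"
      using insert by (simp add: algebra_simps)
    moreover have "b \<gamma> * (1 - (\<Prod>\<gamma>\<in>A. b \<gamma>)) \<in> Q"
      using insert bO by (intro omodule_scale[OF Qm(1)]) auto
    moreover have "1 - b \<gamma> \<in> Q" using b(2) insert.prems by blast
    ultimately show ?case using omodule_add[OF Qm(1)] by (simp only:)
  qed (auto simp: omodule_zero[OF Qm(1)])
  then have xQ: "x \<in> Q" unfolding x_def by blast
  have xP: "x \<notin> \<gamma> ` P" if g: "\<gamma> \<in> Gal" for \<gamma>
  proof
    assume x: "x \<in> \<gamma> ` P"
    have gPm: "omodule (\<gamma> ` P)" by (rule omodule_image[OF g Pm(1)])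
    have "(\<Prod>\<delta>\<in>Gal. b \<delta>) = (\<Prod>\<delta>\<in>Gal - {\<gamma>}. b \<delta>) * b \<gamma>"
      using prod.remove[OF finite_Gal g, of b] by (simp add: mult.commute)
    also have "\<dots> \<in> \<gamma> ` P" using bO b(1)[OF g] by (intro omodule_scale[OF gPm] prod_in) auto
    finally have "x + (\<Prod>\<delta>\<in>Gal. b \<delta>) \<in> \<gamma> ` P" by (rule omodule_add[OF gPm x])
    then show False using oprime_proper[OF oprime_image[OF g P]] by (simp add: x_def)
  qed
  have xO: "x \<in> \<O>" using xQ Qm(2) by blast
  obtain k where k: "(\<Prod>\<gamma>\<in>Gal. \<gamma> x) = of_int k" using norm_integer[OF xO] by (auto elim: Ints_cases)
  have "(\<Prod>\<gamma>\<in>Gal. \<gamma> x) = (\<Prod>\<gamma>\<in>Gal - {\<lambda>x. x}. \<gamma> x) * x"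
    using prod.remove[OF finite_Gal Gal_id, of "\<lambda>\<gamma>. \<gamma> x"] by (simp add: mult.commute)
  also have "\<dots> \<in> Q" using xQ Gal_in[OF _ xO] by (intro omodule_scale[OF Qm(1)] prod_in) auto
  finally have "int p dvd k" unfolding k by (rule integer_in_oprime[OF Q p(1,3)])
  then obtain l where l: "k = int p * l" by blast
  have "of_int l * of_nat p \<in> P" by (rule omodule_scale[OF Pm(1) of_int_in p(2)])
  then have "(\<Prod>\<gamma>\<in>Gal. \<gamma> x) \<in> P" unfolding k l by (simp add: mult.commute)
  moreover have "\<exists>\<gamma>\<in>A. \<gamma> x \<in> P" if "A \<subseteq> Gal" "(\<Prod>\<gamma>\<in>A. \<gamma> x) \<in> P" for A
    using that
  proof (induction A rule: infinite_finite_induct)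
    case (insert \<gamma> A)
    have "\<gamma> x * (\<Prod>\<gamma>\<in>A. \<gamma> x) \<in> P" using insert by simp
    moreover have "\<gamma> x \<in> \<O>" "(\<Prod>\<gamma>\<in>A. \<gamma> x) \<in> \<O>" using insert.prems(1) Gal_in[OF _ xO] by (auto intro!: prod_in)
    ultimately have "\<gamma> x \<in> P \<or> (\<Prod>\<gamma>\<in>A. \<gamma> x) \<in> P" using oprime_cases[OF P] by blast
    then show ?case using insert by auto
  qed (use oprime_proper[OF P] in auto)
  ultimately obtain \<gamma> where g: "\<gamma> \<in> Gal" "\<gamma> x \<in> P" by blast
  then have "inv_into UNIV \<gamma> (\<gamma> x) \<in> inv_into UNIV \<gamma> ` P" by blast
  then show False using xP[OF Gal_inv[OF g(1)]] by (simp add: Gal_inv_left[OF g(1)])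
qed

end

section \<open>Residue fields and inertia degrees\<close>

text \<open>Adding a basis vector multiplies the cardinality by that of the scalars, because the
  representation of an element of the larger space is unique.\<close>

lemma (in ring) card_dimension:
  assumes K: "subfield K R" "finite K" and dim: "dimension n K E"
  shows "card E = card K ^ n"
proof -
  obtain Us where Us: "set Us \<subseteq> carrier R" "independent K Us" "length Us = n" "Span K Us = E"
    using exists_base[OF K(1) dim] by blast
  have "finite (Span K Us) \<and> card (Span K Us) = card K ^ length Us" using Us(1,2)
  proof (induction Us)
    case Nil then show ?case by simp
  next
    case (Cons u Us)
    have u: "u \<notin> Span K Us" "independent K Us" "u \<in> carrier R" "set Us \<subseteq> carrier R"
      using independent_backwards[OF Cons.prems(2)] Cons.prems(1) by auto
    have Kc: "K \<subseteq> carrier R" by (rule subfieldE(3)[OF K(1)])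
    have Sc: "Span K Us \<subseteq> carrier R" by (rule Span_subgroup_props(1)[OF K(1) u(4)])
    define f where "f = (\<lambda>(k, v). k \<otimes> u \<oplus> v)"
    have im: "Span K (u # Us) = f ` (K \<times> Span K Us)"
    proof (rule Set.set_eqI)
      fix x
      have "x \<in> Span K (u # Us) \<longleftrightarrow> (\<exists>k\<in>K. \<exists>v\<in>Span K Us. x = k \<otimes> u \<oplus> v)"
        by (simp add: line_extension_mem_iff)
      then show "x \<in> Span K (u # Us) \<longleftrightarrow> x \<in> f ` (K \<times> Span K Us)"
        unfolding f_def image_iff by (simp add: Bex_def)
    qed
    have "inj_on f (K \<times> Span K Us)"
    proof (rule inj_onI)
      fix a b assume "a \<in> K \<times> Span K Us" "b \<in> K \<times> Span K Us" and f: "f a = f b"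
      then obtain k v l w where a: "a = (k, v)" "k \<in> K" "v \<in> Span K Us" and b: "b = (l, w)" "l \<in> K" "w \<in> Span K Us"
        by blast
      have c: "k \<in> carrier R" "v \<in> carrier R" "l \<in> carrier R" "w \<in> carrier R" using a b Kc Sc by auto
      have eq: "k \<otimes> u \<oplus> v = l \<otimes> u \<oplus> w" using f unfolding a b f_def by simp
      have "(k \<ominus> l) \<otimes> u = (k \<otimes> u \<oplus> v) \<ominus> (l \<otimes> u) \<ominus> v" using c u(3) by algebra
      also have "\<dots> = w \<ominus> v" unfolding eq using c u(3) by algebra
      also have "w \<ominus> v \<in> Span K Us"
        using Span_subgroup_props(3,4)[OF K(1) u(4)] a(3) b(3) by (simp add: a_minus_def)
      finally have "(k \<ominus> l) \<otimes> u \<in> Span K Us" .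
      moreover have "k \<ominus> l \<in> K"
        using subringE(5,7)[OF subfieldE(1)[OF K(1)]] a(2) b(2) by (simp add: a_minus_def)
      ultimately have "k \<ominus> l = \<zero>"
        using Span_m_inv_simprule[OF K(1) u(4) _ u(3), of "k \<ominus> l"] u(1) by blast
      then have kl: "k = l" using c by (simp add: r_right_minus_eq)
      then show "a = b" using eq c u(3) unfolding a b by simp
    qed
    then have "card (Span K (u # Us)) = card K * card (Span K Us)"
      unfolding im by (simp add: card_image card_cartesian_product)
    then show ?case using Cons.IH u K(2) unfolding im by simp
  qed
  then show ?thesis using Us by simp
qed

lemma type_ring_field: "Ring.field (ring_of_type_algebra :: 'a::field_char_0 ring)"
  by (rule field_from_type_algebra)

lemma type_ring_simps:
  "carrier (ring_of_type_algebra :: 'a::field_char_0 ring) = UNIV"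
  "monoid.mult (ring_of_type_algebra :: 'a ring) = (*)" "add (ring_of_type_algebra :: 'a ring) = (+)"
  "monoid.one (ring_of_type_algebra :: 'a ring) = 1" "ring.zero (ring_of_type_algebra :: 'a ring) = 0"
  by (simp_all add: ring_of_type_algebra_def)

lemma type_ring_uminus: "\<ominus>\<^bsub>ring_of_type_algebra\<^esub> x = - (x :: 'a::field_char_0)"
proof -
  interpret K: Ring.field "ring_of_type_algebra :: 'a ring" by (rule type_ring_field)
  show ?thesis using K.minus_equality[of "- x" x] by (simp add: type_ring_simps)
qed

locale unital_subring =
  fixes A :: "'a::field_char_0 set"
  assumes one_A: "1 \<in> A" and add_A: "x \<in> A \<Longrightarrow> y \<in> A \<Longrightarrow> x + y \<in> A"
    and uminus_A: "x \<in> A \<Longrightarrow> - x \<in> A" and mult_A: "x \<in> A \<Longrightarrow> y \<in> A \<Longrightarrow> x * y \<in> A"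
begin

lemma zero_A: "0 \<in> A" using add_A[OF one_A uminus_A[OF one_A]] by simp
lemma of_nat_A: "of_nat n \<in> A" by (induction n) (auto intro: zero_A one_A add_A)
lemma of_int_A: "of_int k \<in> A" by (cases k) (auto intro: of_nat_A uminus_A simp del: of_nat_Suc)

lemma cring_A: "cring (sub_ring A)"
proof -
  interpret K: Ring.field "ring_of_type_algebra :: 'a ring" by (rule type_ring_field)
  have "subring A ring_of_type_algebra"
    by (rule K.subringI) (auto simp: type_ring_simps type_ring_uminus one_A add_A uminus_A mult_A)
  then have "subcring A ring_of_type_algebra" by (rule K.subcringI')
  then show ?thesis using K.subcring_iff[of A] by (simp add: type_ring_simps)
qed

lemma sub_uminus: assumes "x \<in> A" shows "\<ominus>\<^bsub>sub_ring A\<^esub> x = - x"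
proof -
  interpret C: cring "sub_ring A" by (rule cring_A)
  show ?thesis using C.minus_equality[of "- x" x] assms uminus_A[OF assms] by (simp add: type_ring_simps)
qed

lemma primeideal_iff:
  "primeideal P (sub_ring A) \<longleftrightarrow> P \<subseteq> A \<and> 0 \<in> P \<and> (\<forall>x\<in>P. \<forall>y\<in>P. x + y \<in> P) \<and>
     (\<forall>r\<in>A. \<forall>x\<in>P. r * x \<in> P) \<and> 1 \<notin> P \<and> (\<forall>x\<in>A. \<forall>y\<in>A. x * y \<in> P \<longrightarrow> x \<in> P \<or> y \<in> P)"
  (is "_ \<longleftrightarrow> ?R")
proof
  assume "primeideal P (sub_ring A)"
  then interpret P: primeideal P "sub_ring A" .
  have "1 \<notin> P"
    using P.one_imp_carrier P.I_notcarr by (auto simp: type_ring_simps)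
  then show ?R
    using P.a_subset additive_subgroup.zero_closed[OF P.is_additive_subgroup]
      additive_subgroup.a_closed[OF P.is_additive_subgroup] P.I_l_closed P.I_prime by (simp add: type_ring_simps)
next
  assume R: ?R
  have u: "- x \<in> P" if "x \<in> P" for x
  proof -
    have "(- 1) * x \<in> P" using R that uminus_A[OF one_A] by blast
    then show ?thesis by simp
  qed
  interpret C: cring "sub_ring A" by (rule cring_A)
  show "primeideal P (sub_ring A)"
  proof (rule primeidealI2)
    show "additive_subgroup P (sub_ring A)"
    proof (rule additive_subgroup.intro, rule subgroup.intro)
      fix a assume a: "a \<in> P"
      then have "m_inv (add_monoid (sub_ring A)) a = - a"
        using sub_uminus[of a] R unfolding a_inv_def by blast
      then show "m_inv (add_monoid (sub_ring A)) a \<in> P" using u[OF a] by simp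
    qed (use R in \<open>auto simp: type_ring_simps\<close>)
    show "cring (sub_ring A)" by (rule cring_A)
    show "carrier (sub_ring A) \<noteq> P" using R one_A by (auto simp: type_ring_simps)
  next
    fix a x assume "a \<in> P" "x \<in> carrier (sub_ring A)"
    then have "x * a \<in> P" using R by (simp add: type_ring_simps)
    then show "x \<otimes>\<^bsub>sub_ring A\<^esub> a \<in> P" "a \<otimes>\<^bsub>sub_ring A\<^esub> x \<in> P"
      by (simp_all add: type_ring_simps mult.commute)
  next
    fix a b assume "a \<in> carrier (sub_ring A)" "b \<in> carrier (sub_ring A)" "a \<otimes>\<^bsub>sub_ring A\<^esub> b \<in> P"
    then show "a \<in> P \<or> b \<in> P" using R by (simp add: type_ring_simps)
  qed
qed

lemma coset_A: "P +>\<^bsub>sub_ring A\<^esub> x = (\<lambda>h. h + x) ` P"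
  by (auto simp: a_r_coset_def r_coset_def type_ring_simps)

lemma carrier_quotient: "carrier (sub_ring A Quot P) = cosets P A"
proof -
  have "carrier (sub_ring A Quot P) = (\<Union>x\<in>A. {P +>\<^bsub>sub_ring A\<^esub> x})"
    by (simp add: FactRing_def A_RCOSETS_def RCOSETS_def a_r_coset_def type_ring_simps)
  then show ?thesis unfolding coset_A cosets_def by blast
qed

text \<open>The image of the integers in the residue ring is a field with \<open>p\<close> elements, and the residue ring
  is a vector space over it.\<close>

lemma card_residue_field:
  assumes Q: "primeideal Q (sub_ring A)" and p: "Factorial_Ring.prime p" "of_nat p \<in> Q"
    and fin: "finite (cosets Q A)"
  defines "F \<equiv> sub_ring A Quot Q"
  shows "index Q A = p ^ ring.dim F (range (\<lambda>k::int. Q +>\<^bsub>sub_ring A\<^esub> of_int k)) (carrier F)"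
proof -
  interpret Q: primeideal Q "sub_ring A" by (rule Q)
  interpret F: domain F unfolding F_def by (rule Q.quotient_is_domain)
  have Qp: "Q \<subseteq> A" "0 \<in> Q" "\<And>x y. x \<in> Q \<Longrightarrow> y \<in> Q \<Longrightarrow> x + y \<in> Q" "\<And>r x. r \<in> A \<Longrightarrow> x \<in> Q \<Longrightarrow> r * x \<in> Q" "1 \<notin> Q"
    using Q unfolding primeideal_iff by blast+
  have Qu: "- x \<in> Q" if "x \<in> Q" for x
    using Qp(4)[OF uminus_A[OF one_A] that] by simp
  have "x - y \<in> Q" if "x \<in> Q" "y \<in> Q" for x y using Qp(3)[OF that(1) Qu[OF that(2)]] by simp
  then have Qgrp: "add_group Q" using Qp(2) by (simp add: add_group_def)
  define q where "q k = Q +>\<^bsub>sub_ring A\<^esub> of_int k" for k :: int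
  have hom: "(+>\<^bsub>sub_ring A\<^esub>) Q \<in> Ring.ring_hom (sub_ring A) F" unfolding F_def by (rule Q.rcos_ring_hom)
  have q_in: "q k \<in> carrier F" for k
    using ring_hom_closed[OF hom, of "of_int k"] of_int_A by (simp add: q_def type_ring_simps)
  have q_mult: "q a \<otimes>\<^bsub>F\<^esub> q b = q (a * b)" for a b
    using ring_hom_mult[OF hom, of "of_int a" "of_int b"] of_int_A by (simp add: q_def type_ring_simps)
  have q_add: "q a \<oplus>\<^bsub>F\<^esub> q b = q (a + b)" for a b
    using ring_hom_add[OF hom, of "of_int a" "of_int b"] of_int_A by (simp add: q_def type_ring_simps)
  have q_one: "q 1 = \<one>\<^bsub>F\<^esub>"
    using ring_hom_one[OF hom] by (simp add: q_def type_ring_simps)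
  have q_zero: "q 0 = \<zero>\<^bsub>F\<^esub>"
    by (simp add: q_def F_def FactRing_def coset_A)
  have q_uminus: "\<ominus>\<^bsub>F\<^esub> q a = q (- a)" for a
    using F.minus_equality[of "q (- a)" "q a"] q_in by (simp add: q_add q_zero)
  have q_eq: "q a = q b \<longleftrightarrow> of_int (a - b) \<in> Q" for a b
    unfolding q_def coset_A coset_eq_iff[OF Qgrp] by simp
  have bezout: "\<exists>v. of_int (v * k - 1) \<in> Q" if nd: "\<not> int p dvd k" for k
  proof -
    obtain u v where uv: "u * int p + v * k = 1" by (rule bezout_prime[OF p(1) nd])
    have "of_int (- u) * of_nat p \<in> Q" by (rule Qp(4)[OF of_int_A p(2)])
    also have "of_int (- u) * of_nat p = (of_int (- u * int p) :: 'a)" by simp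
    also have "- u * int p = v * k - 1" using uv by simp
    finally show ?thesis by blast
  qed
  have in_Q: "of_int k \<in> Q \<longleftrightarrow> int p dvd k" for k
  proof
    assume k: "of_int k \<in> Q"
    show "int p dvd k"
    proof (rule ccontr)
      assume nd: "\<not> int p dvd k"
      obtain v where v: "of_int (v * k - 1) \<in> Q" using bezout[OF nd] by blast
      have "of_int v * of_int k + - of_int (v * k - 1) \<in> Q" 
        by (rule Qp(3)[OF Qp(4)[OF of_int_A k] Qu[OF v]])
      then show False using Qp(5) by simp
    qed
  next
    assume "int p dvd k"
    then obtain l where "k = int p * l" by blast
    then show "of_int k \<in> Q" using Qp(4)[OF of_int_A p(2), of l] by (simp add: mult.commute)
  qed
  define k where "k = range q"
  have k_sub: "k \<subseteq> carrier F" using q_in by (auto simp: k_def)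
  have sring: "subring k F"
    by (rule F.subringI) (use k_sub in \<open>auto simp: k_def q_uminus q_mult q_add q_one[symmetric]\<close>)
  have sfield: "subfield k F"
  proof (rule F.subfieldI)
    show "subcring k F" by (rule F.subcringI'[OF sring])
    show "Units (F\<lparr>carrier := k\<rparr>) = k - {\<zero>\<^bsub>F\<^esub>}"
    proof
      show "Units (F\<lparr>carrier := k\<rparr>) \<subseteq> k - {\<zero>\<^bsub>F\<^esub>}"
      proof
        fix x assume "x \<in> Units (F\<lparr>carrier := k\<rparr>)"
        then obtain y where x: "x \<in> k" "y \<in> k" "y \<otimes>\<^bsub>F\<^esub> x = \<one>\<^bsub>F\<^esub>" by (auto simp: Units_def)
        have "x \<noteq> \<zero>\<^bsub>F\<^esub>"
        proof
          assume "x = \<zero>\<^bsub>F\<^esub>"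
          then have "\<zero>\<^bsub>F\<^esub> = \<one>\<^bsub>F\<^esub>" using x k_sub by auto
          then show False using F.one_not_zero by simp
        qed
        then show "x \<in> k - {\<zero>\<^bsub>F\<^esub>}" using x(1) by simp
      qed
      show "k - {\<zero>\<^bsub>F\<^esub>} \<subseteq> Units (F\<lparr>carrier := k\<rparr>)"
      proof
        fix x assume x: "x \<in> k - {\<zero>\<^bsub>F\<^esub>}"
        then obtain a where a: "x = q a" by (auto simp: k_def)
        have "q a \<noteq> q 0" using x unfolding a q_zero by simp
        then have nd: "\<not> int p dvd a" using q_eq[of a 0] in_Q[of a] by simp
        obtain v where "of_int (v * a - 1) \<in> Q" using bezout[OF nd] by blast
        then have "q (v * a) = q 1" unfolding q_eq .
        then have "q v \<otimes>\<^bsub>F\<^esub> q a = \<one>\<^bsub>F\<^esub>" "q a \<otimes>\<^bsub>F\<^esub> q v = \<one>\<^bsub>F\<^esub>" by (simp_all add: q_mult q_one mult.commute)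
        then show "x \<in> Units (F\<lparr>carrier := k\<rparr>)" unfolding Units_def a by (auto simp: k_def)
      qed
    qed
  qed
  have card_k: "card k = p"
  proof -
    have "k = q ` {0..<int p}"
    proof
      show "k \<subseteq> q ` {0..<int p}"
      proof
        fix x assume "x \<in> k"
        then obtain a where a: "x = q a" by (auto simp: k_def)
        have "q a = q (a mod int p)" unfolding q_eq in_Q by (simp add: minus_mod_eq_mult_div)
        moreover have "a mod int p \<in> {0..<int p}" using prime_gt_0_nat[OF p(1)] by simp
        ultimately show "x \<in> q ` {0..<int p}" unfolding a by blast
      qed
    qed (auto simp: k_def)
    moreover have "inj_on q {0..<int p}"
    proof (rule inj_onI)
      fix a b assume ab: "a \<in> {0..<int p}" "b \<in> {0..<int p}" "q a = q b"
      then have "int p dvd a - b" unfolding q_eq in_Q by simp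
      then show "a = b" using ab(1,2) by (simp add: mod_eq_dvd_iff[symmetric])
    qed
    ultimately show ?thesis by (simp add: card_image)
  qed
  have fin_k: "finite k" using card_k prime_gt_0_nat[OF p(1)] card_gt_0_iff by metis
  have fin_F: "finite (carrier F)" unfolding F_def carrier_quotient by (rule fin)
  then obtain Us where Us: "set Us = carrier F" using finite_list by blast
  have "F.Span k Us = carrier F"
    using F.Span_base_incl[OF sfield, of Us] F.Span_subgroup_props(1)[OF sfield, of Us] Us by blast
  then have "F.finite_dimension k (carrier F)" using F.Span_finite_dimension[OF sfield, of Us] Us by simp
  then have "F.dimension (F.dim k (carrier F)) k (carrier F)"
    unfolding F.dim_def by (rule theI'[OF F.unique_dimension[OF sfield]])
  then have "card (carrier F) = p ^ F.dim k (carrier F)"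
    using F.card_dimension[OF sfield fin_k] card_k by simp
  moreover have "k = range (\<lambda>k::int. Q +>\<^bsub>sub_ring A\<^esub> of_int k)" by (simp add: k_def q_def)
  ultimately show ?thesis unfolding index_def by (simp add: F_def carrier_quotient)
qed

end

lemma ring_of_integers_subring: "unital_subring (ring_of_integers :: 'a::field_char_0 set)"
proof
  show "1 \<in> (ring_of_integers :: 'a set)" by (auto simp: ring_of_integers_def intro: int_imp_algebraic_int)
qed (auto simp: ring_of_integers_def algebraic_int_add_mult)

context near_maximal_order
begin

sublocale unital_subring \<O> by unfold_locales (rule one add uminus mult; assumption?)+

lemma oprime_iff: "oprime P \<longleftrightarrow> primeideal P (sub_ring \<O>) \<and> P \<noteq> {0}"
  unfolding oprime_def primeideal_iff oideal_def omodule_def by blast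

lemma ideal_norm_index: "ideal_norm \<O> I = index I \<O>"
  by (simp add: ideal_norm_def index_def carrier_quotient)

lemma O_integral: "\<O> \<subseteq> ring_of_integers"
  using algebraic by (auto simp: ring_of_integers_def)

text \<open>If \<open>1 = a + m * b\<close> with \<open>b\<close> integral, then squaring \<open>m * b = 1 - a\<close> turns the coefficient of \<open>m\<close> into
  \<open>m * b * b\<close>, which lies in \<open>\<O>\<close>.\<close>

lemma coprime_to_iff:
  assumes I: "oideal I" shows "coprime_to m \<O> I \<longleftrightarrow> coprime_m I"
proof -
  interpret R: unital_subring "ring_of_integers :: 'a set" by (rule ring_of_integers_subring)
  have Im: "omodule I" "I \<subseteq> \<O>" using I by (auto simp: oideal_def)
  have sum: "I <+>\<^bsub>ring_of_type_algebra\<^esub> ((*) (of_nat m) ` ring_of_integers) =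
      {a + of_nat m * b |a b. a \<in> I \<and> b \<in> ring_of_integers}"
    by (auto simp: set_add_def set_mult_def type_ring_simps)
  show ?thesis
  proof
    assume "coprime_to m \<O> I"
    then have "1 \<in> {a + of_nat m * b |a b. a \<in> I \<and> b \<in> ring_of_integers}"
      using one unfolding coprime_to_def sum by simp
    then obtain a b where ab: "1 = a + of_nat m * b" "a \<in> I" "b \<in> ring_of_integers" by blast
    have "of_nat m * (b * b) \<in> \<O>"
      using int_m R.mult_A[OF ab(3,3)] by (simp add: ring_of_integers_def)
    moreover have "(2 - a) * a \<in> I"
      using Im ab(2) by (intro omodule_scale diff) (use of_nat_in[of 2] in auto)
    moreover have "1 = (2 - a) * a + of_nat m * (of_nat m * (b * b))"
    proof -
      have mb: "of_nat m * b = 1 - a" using ab(1) by (simp add: eq_diff_eq add.commute)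
      have "of_nat m * (of_nat m * (b * b)) = (of_nat m * b) * (of_nat m * b)" by (simp add: ac_simps)
      then have "of_nat m * (of_nat m * (b * b)) = (1 - a) * (1 - a)" unfolding mb .
      then show ?thesis by (simp add: algebra_simps)
    qed
    ultimately show "coprime_m I" unfolding coprime_m_def by blast
  next
    assume "coprime_m I"
    then obtain a c where a: "a \<in> I" "c \<in> \<O>" "1 = a + of_nat m * c" unfolding coprime_m_def by blast
    show "coprime_to m \<O> I" unfolding coprime_to_def sum
    proof
      show "{a + of_nat m * b |a b. a \<in> I \<and> b \<in> ring_of_integers} \<subseteq> \<O>"
      proof clarify
        fix a b assume "a \<in> I" "b \<in> (ring_of_integers :: 'a set)"
        then show "a + of_nat m * b \<in> \<O>" using Im(2) int_m by (intro add) (auto simp: ring_of_integers_def)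
      qed
      show "\<O> \<subseteq> {a + of_nat m * b |a b. a \<in> I \<and> b \<in> ring_of_integers}"
      proof
        fix y assume y: "y \<in> \<O>"
        have "y = y * (a + of_nat m * c)" using a(3) by simp
        also have "\<dots> = y * a + of_nat m * (y * c)" by (simp add: algebra_simps)
        finally have "y = y * a + of_nat m * (y * c)" .
        moreover have "y * a \<in> I" by (rule omodule_scale[OF Im(1) y a(1)])
        moreover have "y * c \<in> ring_of_integers" using mult[OF y a(2)] O_integral by blast
        ultimately show "y \<in> {a + of_nat m * b |a b. a \<in> I \<and> b \<in> ring_of_integers}" by blast
      qed
    qed
  qed
qed

lemma coprime_prime_ideals_iff: "P \<in> coprime_prime_ideals m \<O> \<longleftrightarrow> oprime P \<and> coprime_m P"
  using coprime_to_iff[of P] oprime_oideal[of P] unfolding coprime_prime_ideals_def oprime_iff[symmetric] by (auto simp: oprime_iff)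

text \<open>Since \<open>1\<close> is a combination of \<open>p\<close> and \<open>m\<close>, every algebraic integer is congruent modulo \<open>Q\<close> to a
  multiple of \<open>m\<close> and hence to an element of \<open>\<O>\<close>. So a transversal of the contracted ideal in \<open>\<O>\<close> is
  also a transversal of \<open>Q\<close>.\<close>

lemma contraction_of_prime:
  assumes Q: "primeideal Q (sub_ring ring_of_integers)" and p: "Factorial_Ring.prime p" "of_nat p \<in> Q"
    and pm: "\<not> p dvd m"
  shows "oprime (Q \<inter> \<O>)" "of_nat p \<in> Q \<inter> \<O>" "index Q ring_of_integers = index (Q \<inter> \<O>) \<O>"
    "finite (cosets Q ring_of_integers)"
proof -
  interpret R: unital_subring "ring_of_integers :: 'a set" by (rule ring_of_integers_subring)
  have Qp: "Q \<subseteq> ring_of_integers" "0 \<in> Q" "\<And>x y. x \<in> Q \<Longrightarrow> y \<in> Q \<Longrightarrow> x + y \<in> Q"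
    "\<And>r x. r \<in> ring_of_integers \<Longrightarrow> x \<in> Q \<Longrightarrow> r * x \<in> Q" "1 \<notin> Q"
    "\<And>x y. x \<in> ring_of_integers \<Longrightarrow> y \<in> ring_of_integers \<Longrightarrow> x * y \<in> Q \<Longrightarrow> x \<in> Q \<or> y \<in> Q"
    using Q unfolding R.primeideal_iff by blast+
  show pQ: "of_nat p \<in> Q \<inter> \<O>" using p(2) of_nat_in by blast
  have "(of_nat p :: 'a) \<noteq> 0" using prime_gt_0_nat[OF p(1)] by simp
  then have nz: "Q \<inter> \<O> \<noteq> {0}" using pQ by blast
  show P: "oprime (Q \<inter> \<O>)" unfolding oprime_def oideal_def omodule_def
  proof (intro conjI ballI impI nz)
    show "0 \<in> Q \<inter> \<O>" using Qp(2) zero by blast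
    show "1 \<notin> Q \<inter> \<O>" using Qp(5) by blast
  next
    fix x y assume "x \<in> Q \<inter> \<O>" "y \<in> Q \<inter> \<O>"
    then show "x + y \<in> Q \<inter> \<O>" using Qp(3) add by blast
  next
    fix r x assume "r \<in> \<O>" "x \<in> Q \<inter> \<O>"
    then show "r * x \<in> Q \<inter> \<O>" using Qp(4) O_integral mult by blast
  next
    fix x y assume "x \<in> \<O>" "y \<in> \<O>" "x * y \<in> Q \<inter> \<O>"
    then show "x \<in> Q \<inter> \<O> \<or> y \<in> Q \<inter> \<O>" using Qp(6)[of x y] O_integral by blast
  qed simp
  have Pgrp: "add_group (Q \<inter> \<O>)" using oprime_oideal[OF P] omodule_add_group by (simp add: oideal_def)
  have Qu: "- x \<in> Q" if "x \<in> Q" for x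
    using Qp(4)[OF R.uminus_A[OF R.one_A] that] by simp
  have "x - y \<in> Q" if "x \<in> Q" "y \<in> Q" for x y using Qp(3)[OF that(1) Qu[OF that(2)]] by simp
  then have Qgrp: "add_group Q" using Qp(2) by (simp add: add_group_def)
  have "\<not> int p dvd int m" using pm by simp
  then obtain u v where uv: "u * int p + v * int m = 1" by (rule bezout_prime[OF p(1)])
  have uv': "(1 :: 'a) = of_int u * of_nat p + of_int v * of_nat m"
    using arg_cong[OF uv, of "of_int :: int \<Rightarrow> 'a"] by simp
  obtain T where T: "transversal (Q \<inter> \<O>) \<O> T" using transversal_exists[OF Pgrp] .
  have T': "transversal Q ring_of_integers T"
    unfolding transversal_def
  proof (intro conjI ballI impI)
    show "T \<subseteq> ring_of_integers" using T O_integral by (auto simp: transversal_def)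
    fix y :: 'a assume y: "y \<in> ring_of_integers"
    have "of_int v * (of_nat m * y) \<in> \<O>"
      using y by (intro mult[OF of_int_in] int_m) (simp add: ring_of_integers_def)
    then obtain t where t: "t \<in> T" "of_int v * (of_nat m * y) - t \<in> Q"
      using T by (auto simp: transversal_def)
    have "(of_int u * y) * of_nat p \<in> Q" by (rule Qp(4)[OF R.mult_A[OF R.of_int_A y] p(2)])
    from Qp(3)[OF this t(2)]
    have "(of_int u * y) * of_nat p + (of_int v * (of_nat m * y) - t) \<in> Q" .
    also have "(of_int u * y) * of_nat p + (of_int v * (of_nat m * y) - t) =
        y * (of_int u * of_nat p + of_int v * of_nat m) - t" by (simp add: algebra_simps)
    finally have "y - t \<in> Q" unfolding uv'[symmetric] by simp
    then show "\<exists>t\<in>T. y - t \<in> Q" using t(1) by blast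
  next
    fix t t' assume t: "t \<in> T" "t' \<in> T" "t - t' \<in> Q"
    have "t - t' \<in> \<O>" using t(1,2) T by (intro diff) (auto simp: transversal_def)
    then show "t = t'" using t T unfolding transversal_def by blast
  qed
  show "index Q ring_of_integers = index (Q \<inter> \<O>) \<O>"
    using index_transversal[OF Pgrp T] index_transversal[OF Qgrp T'] by simp
  show "finite (cosets Q ring_of_integers)"
    using finite_cosets[OF oprime_oideal[OF P] nz]
    unfolding finite_transversal[OF Pgrp T] finite_transversal[OF Qgrp T'] .
qed

text \<open>As \<open>m\<close> is invertible modulo \<open>P\<close>, the condition on \<open>m * y\<close> describes a prime ideal of the ring of
  integers above \<open>P\<close>. Its existence is what makes the number characterized by \<open>inertia_degree\<close> unique.\<close>

lemma extension_of_prime: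
  assumes P: "oprime P" "coprime_m P"
  defines "Q \<equiv> {y \<in> ring_of_integers. of_nat m * y \<in> P}"
  shows "primeideal Q (sub_ring ring_of_integers)" "P \<subseteq> Q"
proof -
  interpret R: unital_subring "ring_of_integers :: 'a set" by (rule ring_of_integers_subring)
  have Pm: "omodule P" "P \<subseteq> \<O>" using oprime_oideal[OF P(1)] by (auto simp: oideal_def)
  have mP: "of_nat m \<notin> P"
  proof
    assume mP: "of_nat m \<in> P"
    obtain a c where a: "a \<in> P" "c \<in> \<O>" "1 = a + of_nat m * c" using P(2) unfolding coprime_m_def by blast
    have "a + c * of_nat m \<in> P" by (rule omodule_add[OF Pm(1) a(1) omodule_scale[OF Pm(1) a(2) mP]])
    then show False using a(3) oprime_proper[OF P(1)] by (simp add: mult.commute)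
  qed
  have mR: "of_nat m * y \<in> \<O>" if "y \<in> ring_of_integers" for y
    using that int_m by (simp add: ring_of_integers_def)
  have cancel: "x \<in> P" if "x \<in> \<O>" "of_nat m * x \<in> P" for x
    using oprime_cases[OF P(1) of_nat_in that(1) that(2)] mP by blast
  show "P \<subseteq> Q" using O_integral Pm omodule_scale[OF Pm(1) of_nat_in] by (auto simp: Q_def)
  show "primeideal Q (sub_ring ring_of_integers)" unfolding R.primeideal_iff
  proof (intro conjI ballI impI)
    show "Q \<subseteq> ring_of_integers" by (auto simp: Q_def)
    show "0 \<in> Q" using R.zero_A omodule_zero[OF Pm(1)] by (simp add: Q_def)
    show "1 \<notin> Q" using mP by (simp add: Q_def)
  next
    fix x y assume "x \<in> Q" "y \<in> Q"
    then show "x + y \<in> Q" using R.add_A omodule_add[OF Pm(1)] by (simp add: Q_def distrib_left)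
  next
    fix r x :: 'a assume r: "r \<in> ring_of_integers" and x: "x \<in> Q"
    have xr: "x \<in> ring_of_integers" "of_nat m * x \<in> P" using x by (auto simp: Q_def)
    have "(of_nat m * r) * (of_nat m * x) \<in> P" by (rule omodule_scale[OF Pm(1) mR[OF r] xr(2)])
    then have "of_nat m * (of_nat m * (r * x)) \<in> P" by (simp add: ac_simps)
    then have "of_nat m * (r * x) \<in> P" by (rule cancel[OF mR[OF R.mult_A[OF r xr(1)]]])
    then show "r * x \<in> Q" using R.mult_A[OF r xr(1)] by (simp add: Q_def)
  next
    fix x y :: 'a assume x: "x \<in> ring_of_integers" and y: "y \<in> ring_of_integers" and "x * y \<in> Q"
    then have "of_nat m * (of_nat m * (x * y)) \<in> P"
      using omodule_scale[OF Pm(1) of_nat_in] by (simp add: Q_def)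
    then have "(of_nat m * x) * (of_nat m * y) \<in> P" by (simp add: ac_simps)
    then show "x \<in> Q \<or> y \<in> Q" using oprime_cases[OF P(1) mR[OF x] mR[OF y]] x y by (auto simp: Q_def)
  qed
qed

end

context galois_order
begin

text \<open>Every prime ideal of the ring of integers above \<open>p\<close> contracts to a conjugate of \<open>P\<close> and has the same
  residue field as its contraction. All residue degrees are therefore determined by the index of
  \<open>P\<close>, so that they agree with the inertia degree.\<close>

theorem index_prime_eq_power:
  assumes P: "oprime P" "of_nat p \<in> P" and p: "Factorial_Ring.prime p" "\<not> p dvd m"
  shows "index P \<O> = p ^ inertia_degree TYPE('a) p"
proof -
  interpret R: unital_subring "ring_of_integers :: 'a set" by (rule ring_of_integers_subring)
  have res: "index P \<O> = p ^ residue_degree Q"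
    if Q: "primeideal Q (sub_ring ring_of_integers)" "of_nat p \<in> Q" for Q :: "'a set"
  proof -
    note c = contraction_of_prime[OF Q(1) p(1) Q(2) p(2)]
    obtain \<gamma> where g: "\<gamma> \<in> Gal" "Q \<inter> \<O> = \<gamma> ` P"
      using Gal_transitive[OF P(1) c(1) p(1) P(2) c(2)] by blast
    have "index P \<O> = index (Q \<inter> \<O>) \<O>"
      unfolding g(2) using index_image[OF g(1)] oprime_oideal[OF P(1)] by (simp add: oideal_def)
    also have "\<dots> = index Q ring_of_integers" using c(3) by simp
    also have "\<dots> = p ^ residue_degree Q"
      unfolding residue_degree_def Let_def by (rule R.card_residue_field[OF Q(1) p(1) Q(2) c(4)])
    finally show ?thesis .
  qed
  define Q0 where "Q0 = {y \<in> ring_of_integers. of_nat m * y \<in> P}"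
  have cP: "coprime_m P" using coprime_m_iff_not_dvd[OF P(1) p(1) P(2)] p(2) by simp
  have Q0: "primeideal Q0 (sub_ring ring_of_integers)" "of_nat p \<in> Q0"
    using extension_of_prime[OF P(1) cP] P(2) unfolding Q0_def by auto
  have p1: "p > 1" by (rule prime_gt_1_nat[OF p(1)])
  have "inertia_degree TYPE('a) p = residue_degree Q0"
    unfolding inertia_degree_def
  proof (rule the_equality)
    show "\<forall>Q::'a set. primeideal Q (sub_ring ring_of_integers) \<and> of_nat p \<in> Q \<longrightarrow> residue_degree Q = residue_degree Q0"
    proof (intro allI impI)
      fix Q :: "'a set" assume "primeideal Q (sub_ring ring_of_integers) \<and> of_nat p \<in> Q"
      then have "p ^ residue_degree Q = p ^ residue_degree Q0" using res[of Q] res[OF Q0] by simp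
      then show "residue_degree Q = residue_degree Q0" using p1 by simp
    qed
  qed (use Q0 in blast)
  then show ?thesis using res[OF Q0] by simp
qed

lemma inertia_degree_pos:
  assumes P: "oprime P" "of_nat p \<in> P" and p: "Factorial_Ring.prime p" "\<not> p dvd m"
  shows "inertia_degree TYPE('a) p > 0"
proof (rule ccontr)
  assume "\<not> ?thesis"
  then have "index P \<O> = 1" using index_prime_eq_power[OF assms] by simp
  moreover have "oideal P" "P \<subset> \<O>" using oprime_oideal[OF P(1)] oprime_proper[OF P(1)] one by (auto simp: oideal_def)
  moreover have "index \<O> \<O> < index P \<O>"
    by (rule ideal_index_less[OF oprime_oideal[OF P(1)] oprime_nonzero[OF P(1)] oideal_O \<open>P \<subset> \<O>\<close>])
  moreover have "index \<O> \<O> > 0" using one by (intro index_pos[OF oideal_O]) auto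
  ultimately show False by simp
qed

end

section \<open>The class group and the action of the Galois group\<close>

context near_maximal_order
begin

lemma fractional_ideal_iff:
  "fractional_ideal \<O> I \<longleftrightarrow> omodule I \<and> I \<noteq> {0} \<and> (\<exists>d\<in>\<O>. d \<noteq> 0 \<and> (*) d ` I \<subseteq> \<O>)"
proof -
  interpret K: Ring.field "ring_of_type_algebra :: 'a ring" by (rule type_ring_field)
  have "subgroup I (add_monoid ring_of_type_algebra) \<and> (\<forall>r\<in>\<O>. \<forall>x\<in>I. r * x \<in> I) \<longleftrightarrow> omodule I"
  proof
    assume a: "subgroup I (add_monoid ring_of_type_algebra) \<and> (\<forall>r\<in>\<O>. \<forall>x\<in>I. r * x \<in> I)"
    then interpret S: subgroup I "add_monoid ring_of_type_algebra" by blast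
    show "omodule I" unfolding omodule_def using a S.m_closed S.one_closed by (simp add: type_ring_simps)
  next
    assume I: "omodule I"
    have "subgroup I (add_monoid ring_of_type_algebra)"
    proof (rule subgroup.intro)
      fix x assume "x \<in> I"
      then show "m_inv (add_monoid ring_of_type_algebra) x \<in> I"
        using omodule_uminus[OF I] type_ring_uminus[of x] by (simp add: a_inv_def)
    qed (use I in \<open>auto simp: type_ring_simps omodule_zero omodule_add\<close>)
    then show "subgroup I (add_monoid ring_of_type_algebra) \<and> (\<forall>r\<in>\<O>. \<forall>x\<in>I. r * x \<in> I)"
      using omodule_scale[OF I] by blast
  qed
  then show ?thesis unfolding fractional_ideal_def by blast
qed

abbreviation IG :: "'a set monoid" where "IG \<equiv> invertible_ideal_group \<O>"

lemma IG_simps: "monoid.mult IG = (\<star>)" "monoid.one IG = \<O>"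
  by (simp_all add: invertible_ideal_group_def iprod_def fun_eq_iff)

lemma IG_carrier: "I \<in> carrier IG \<longleftrightarrow> fractional_ideal \<O> I \<and> (\<exists>J. fractional_ideal \<O> J \<and> I \<star> J = \<O>)"
  by (simp add: invertible_ideal_group_def iprod_def)

lemma IG_omodule: "I \<in> carrier IG \<Longrightarrow> omodule I" by (simp add: IG_carrier fractional_ideal_iff)

lemma fractional_iprod:
  assumes I: "fractional_ideal \<O> I" and J: "fractional_ideal \<O> J" shows "fractional_ideal \<O> (I \<star> J)"
proof -
  have m: "omodule I" "omodule J" "I \<noteq> {0}" "J \<noteq> {0}" using I J by (auto simp: fractional_ideal_iff)
  obtain d e where d: "d \<in> \<O>" "d \<noteq> 0" "(*) d ` I \<subseteq> \<O>" and e: "e \<in> \<O>" "e \<noteq> 0" "(*) e ` J \<subseteq> \<O>"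
    using I J by (auto simp: fractional_ideal_iff)
  obtain i where i: "i \<in> I" "i \<noteq> 0" using m(3) omodule_zero[OF m(1)] by blast
  obtain j where j: "j \<in> J" "j \<noteq> 0" using m(4) omodule_zero[OF m(2)] by blast
  have "i * j \<in> I \<star> J" "i * j \<noteq> 0" using iprod_mult i j by auto
  then have ne: "I \<star> J \<noteq> {0}" by blast
  have "I \<star> J \<subseteq> {x. d * e * x \<in> \<O>}"
  proof (rule iprod_subset)
    fix i j assume "i \<in> I" "j \<in> J"
    then have "d * i \<in> \<O>" "e * j \<in> \<O>" using d e by blast+
    then have "(d * i) * (e * j) \<in> \<O>" by (rule mult)
    then show "i * j \<in> {x. d * e * x \<in> \<O>}" by (simp add: ac_simps)
  next
    fix x y assume "x \<in> {x. d * e * x \<in> \<O>}" "y \<in> {x. d * e * x \<in> \<O>}"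
    then show "x + y \<in> {x. d * e * x \<in> \<O>}" using add by (simp add: distrib_left)
  qed
  then have "(*) (d * e) ` (I \<star> J) \<subseteq> \<O>" by blast
  moreover have "d * e \<in> \<O>" "d * e \<noteq> 0" using mult d e by auto
  ultimately show ?thesis unfolding fractional_ideal_iff using omodule_iprod[OF m(1,2)] ne by blast
qed

lemma fractional_O: "fractional_ideal \<O> \<O>"
  unfolding fractional_ideal_iff using omodule_O one mult by (auto intro!: bexI[of _ 1])

lemma IG_comm_group: "comm_group IG"
proof (rule comm_groupI)
  fix I J assume I: "I \<in> carrier IG" and J: "J \<in> carrier IG"
  then obtain I' J' where IJ: "fractional_ideal \<O> I" "fractional_ideal \<O> J" "fractional_ideal \<O> I'"
    "fractional_ideal \<O> J'" "I \<star> I' = \<O>" "J \<star> J' = \<O>" by (auto simp: IG_carrier)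
  have "(I \<star> J) \<star> (I' \<star> J') = (I \<star> I') \<star> (J \<star> J')" by (simp add: iprod_assoc iprod_left_commute)
  also have "\<dots> = \<O>" using IJ O_iprod(1)[OF omodule_O] by simp
  finally show "I \<otimes>\<^bsub>IG\<^esub> J \<in> carrier IG"
    unfolding IG_carrier IG_simps using fractional_iprod[OF IJ(1,2)] fractional_iprod[OF IJ(3,4)] by blast
next
  show "\<one>\<^bsub>IG\<^esub> \<in> carrier IG" using fractional_O O_iprod(1)[OF omodule_O] by (auto simp: IG_carrier IG_simps)
next
  fix I assume "I \<in> carrier IG"
  then obtain I' where I: "fractional_ideal \<O> I" "fractional_ideal \<O> I'" "I \<star> I' = \<O>" by (auto simp: IG_carrier)
  then have "I' \<in> carrier IG" by (auto simp: IG_carrier iprod_commute[of I'])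
  then show "\<exists>y\<in>carrier IG. y \<otimes>\<^bsub>IG\<^esub> I = \<one>\<^bsub>IG\<^esub>" using I(3) by (auto simp: IG_simps iprod_commute[of _ I])
next
  fix I assume "I \<in> carrier IG"
  then show "\<one>\<^bsub>IG\<^esub> \<otimes>\<^bsub>IG\<^esub> I = I" by (simp add: IG_simps O_iprod IG_omodule)
next
  fix I J :: "'a set" show "I \<otimes>\<^bsub>IG\<^esub> J = J \<otimes>\<^bsub>IG\<^esub> I" unfolding IG_simps by (rule iprod_commute)
qed (simp add: IG_simps iprod_assoc)

lemma prime_in_IG:
  assumes "oprime P" "coprime_m P" shows "P \<in> carrier IG"
proof -
  have Pm: "omodule P" "P \<subseteq> \<O>" "P \<noteq> {0}" using assms oprime_oideal oprime_nonzero by (auto simp: oideal_def)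
  have fP: "fractional_ideal \<O> P" unfolding fractional_ideal_iff
    using Pm one by (auto intro!: bexI[of _ 1])
  obtain d where d: "d \<in> P" "d \<noteq> 0" using Pm(3) omodule_zero[OF Pm(1)] by blast
  have "(*) d ` colon P \<subseteq> \<O>" using d(1) by (auto simp: colon_def mult.commute)
  moreover have "colon P \<noteq> {0}" using one_colon[OF oprime_oideal[OF assms(1)]] by auto
  ultimately have "fractional_ideal \<O> (colon P)" unfolding fractional_ideal_iff
    using omodule_colon d Pm(2) by blast
  then show ?thesis using fP prime_invertible[OF assms] by (auto simp: IG_carrier)
qed

text \<open>Lists suit induction on factorizations; products over an index set occur in the definition of
  weighted zero-sum sequences.\<close>

lemma lprod_finprod:
  assumes "set Ps \<subseteq> carrier IG" shows "lprod Ps = finprod IG (\<lambda>i. Ps ! i) {..<length Ps}" and "lprod Ps \<in> carrier IG"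
proof -
  interpret G: comm_group IG by (rule IG_comm_group)
  have "lprod Ps = finprod IG (\<lambda>i. Ps ! i) {..<length Ps}" using assms
  proof (induction Ps rule: rev_induct)
    case Nil then show ?case by (simp add: IG_simps)
  next
    case (snoc P Ps)
    have Pc: "P \<in> carrier IG" "\<And>i. i < length Ps \<Longrightarrow> Ps ! i \<in> carrier IG"
      using snoc.prems by auto
    have "lprod (Ps @ [P]) = P \<star> lprod Ps" using lprod_move[of Ps P "[]"] by simp
    also have "\<dots> = P \<otimes>\<^bsub>IG\<^esub> finprod IG (\<lambda>i. Ps ! i) {..<length Ps}" using snoc by (simp add: IG_simps)
    also have "finprod IG (\<lambda>i. Ps ! i) {..<length Ps} = finprod IG (\<lambda>i. (Ps @ [P]) ! i) {..<length Ps}"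
      by (rule G.finprod_cong') (use Pc(2) in \<open>auto simp: nth_append\<close>)
    also have "P \<otimes>\<^bsub>IG\<^esub> \<dots> = finprod IG (\<lambda>i. (Ps @ [P]) ! i) (insert (length Ps) {..<length Ps})"
      using Pc by (subst G.finprod_insert) (auto simp: nth_append)
    finally show ?case by (simp add: lessThan_Suc)
  qed
  moreover have "finprod IG (\<lambda>i. Ps ! i) {..<length Ps} \<in> carrier IG"
    by (rule G.finprod_closed) (use assms nth_mem in auto)
  ultimately show "lprod Ps = finprod IG (\<lambda>i. Ps ! i) {..<length Ps}" "lprod Ps \<in> carrier IG" by simp_all
qed

lemma real_embedding_simps:
  assumes "\<sigma> \<in> real_embeddings"
  shows "\<sigma> (x * y) = \<sigma> x * \<sigma> (y :: 'a)" "\<sigma> (x + y) = \<sigma> x + \<sigma> y" "\<sigma> 1 = 1"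
  using assms by (auto simp: real_embeddings_def Ring.ring_hom_def ring_of_type_algebra_def)

lemma K_elems_one: "(1 :: 'a) \<in> K_elems s"
  by (cases s) (auto simp: real_embedding_simps)

lemma K_elems_mult: "a \<in> K_elems s \<Longrightarrow> b \<in> K_elems s \<Longrightarrow> a * b \<in> K_elems s" for a b :: 'a
  by (cases s) (auto simp: real_embedding_simps)

lemma K_elems_nonzero: "a \<in> K_elems s \<Longrightarrow> a \<noteq> 0" for a :: 'a
  by (cases s) auto

lemma K_elems_inverse: "a \<in> K_elems s \<Longrightarrow> inverse a \<in> K_elems s" for a :: 'a
proof (cases s)
  case Totally_Positive
  assume a: "a \<in> K_elems s"
  have "\<sigma> (inverse a) > 0" if s: "\<sigma> \<in> real_embeddings" for \<sigma>
  proof -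
    have "\<sigma> a * \<sigma> (inverse a) = \<sigma> (a * inverse a)" by (simp add: real_embedding_simps(1)[OF s])
    also have "\<dots> = 1" using K_elems_nonzero[OF a] by (simp add: real_embedding_simps(3)[OF s])
    finally have "0 < \<sigma> a * \<sigma> (inverse a)" by simp
    moreover have "\<sigma> a > 0" using a s Totally_Positive by simp
    ultimately show ?thesis by (rule zero_less_mult_pos)
  qed
  then show ?thesis using a Totally_Positive by simp
qed auto

lemma principal_iprod: "((*) a ` \<O>) \<star> ((*) b ` \<O>) = (*) (a * b) ` \<O>"
proof
  show "((*) a ` \<O>) \<star> ((*) b ` \<O>) \<subseteq> (*) (a * b) ` \<O>"
  proof (rule iprod_subset)
    fix u v assume "u \<in> (*) a ` \<O>" "v \<in> (*) b ` \<O>"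
    then obtain x y where "x \<in> \<O>" "y \<in> \<O>" "u = a * x" "v = b * y" by blast
    then have "u * v = a * b * (x * y)" "x * y \<in> \<O>" using mult by (auto simp: ac_simps)
    then show "u * v \<in> (*) (a * b) ` \<O>" by blast
  next
    fix u v assume "u \<in> (*) (a * b) ` \<O>" "v \<in> (*) (a * b) ` \<O>"
    then obtain x y where "x \<in> \<O>" "y \<in> \<O>" "u = a * b * x" "v = a * b * y" by blast
    then have "u + v = a * b * (x + y)" "x + y \<in> \<O>" using add by (auto simp: distrib_left)
    then show "u + v \<in> (*) (a * b) ` \<O>" by blast
  qed
  show "(*) (a * b) ` \<O> \<subseteq> ((*) a ` \<O>) \<star> ((*) b ` \<O>)"
  proof clarify
    fix x assume "x \<in> \<O>"
    then have "(a * x) * (b * 1) \<in> ((*) a ` \<O>) \<star> ((*) b ` \<O>)" by (intro iprod_mult imageI one)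
    then show "a * b * x \<in> ((*) a ` \<O>) \<star> ((*) b ` \<O>)" by (simp add: ac_simps)
  qed
qed

lemma principal_in_IG: assumes a: "a \<noteq> 0" shows "(*) a ` \<O> \<in> carrier IG"
proof -
  have frc: "fractional_ideal \<O> ((*) a ` \<O>)" if "a \<noteq> 0" for a
  proof -
    obtain d where d: "d \<in> \<O>" "d \<noteq> 0" "d * a \<in> \<O>" using frac by blast
    note omodule_principal[of a]
    moreover have "(*) a ` \<O> \<noteq> {0}"
    proof -
      have "a * 1 \<in> (*) a ` \<O>" using one by (rule imageI)
      then show ?thesis using that by auto
    qed
    moreover have "(*) d ` (*) a ` \<O> \<subseteq> \<O>"
    proof clarify
      fix x assume "x \<in> \<O>"
      then have "(d * a) * x \<in> \<O>" using mult d(3) by blast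
      then show "d * (a * x) \<in> \<O>" by (simp add: mult.assoc)
    qed
    ultimately show ?thesis unfolding fractional_ideal_iff using d by blast
  qed
  have "((*) a ` \<O>) \<star> ((*) (inverse a) ` \<O>) = \<O>" unfolding principal_iprod using a by simp
  then show ?thesis unfolding IG_carrier using frc[OF a] frc[of "inverse a"] a by auto
qed

lemma principal_subgroup: "subgroup (principal_fractional_ideals s \<O>) IG"
proof -
  interpret G: comm_group IG by (rule IG_comm_group)
  show ?thesis
  proof (rule G.subgroupI)
    show "principal_fractional_ideals s \<O> \<subseteq> carrier IG"
    proof
      fix I assume "I \<in> principal_fractional_ideals s \<O>"
      then obtain a where "a \<in> K_elems s" "I = (*) a ` \<O>" unfolding principal_fractional_ideals_def by blast
      then show "I \<in> carrier IG" using principal_in_IG[OF K_elems_nonzero] by simp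
    qed
    show "principal_fractional_ideals s \<O> \<noteq> {}"
      unfolding principal_fractional_ideals_def using K_elems_one by blast
  next
    fix I assume "I \<in> principal_fractional_ideals s \<O>"
    then obtain a where a: "a \<in> K_elems s" "I = (*) a ` \<O>" unfolding principal_fractional_ideals_def by blast
    note nz = K_elems_nonzero[OF a(1)]
    have "I \<otimes>\<^bsub>IG\<^esub> (*) (inverse a) ` \<O> = \<one>\<^bsub>IG\<^esub>" unfolding a IG_simps principal_iprod using nz by simp
    then have "inv\<^bsub>IG\<^esub> I = (*) (inverse a) ` \<O>"
      using principal_in_IG nz by (intro G.inv_equality) (auto simp: a G.m_comm)
    then show "inv\<^bsub>IG\<^esub> I \<in> principal_fractional_ideals s \<O>"
      unfolding principal_fractional_ideals_def using K_elems_inverse[OF a(1)] by blast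
  next
    fix I J assume "I \<in> principal_fractional_ideals s \<O>" "J \<in> principal_fractional_ideals s \<O>"
    then obtain a b where "a \<in> K_elems s" "I = (*) a ` \<O>" "b \<in> K_elems s" "J = (*) b ` \<O>"
      unfolding principal_fractional_ideals_def by blast
    then show "I \<otimes>\<^bsub>IG\<^esub> J \<in> principal_fractional_ideals s \<O>"
      unfolding principal_fractional_ideals_def IG_simps using principal_iprod K_elems_mult by blast
  qed
qed

lemma class_group_comm: "comm_group (class_group s \<O>)"
  unfolding class_group_def by (rule comm_group.abelian_FactGroup[OF IG_comm_group principal_subgroup])

lemma ideal_class_hom: "ideal_class s \<O> \<in> hom IG (class_group s \<O>)"
proof -
  interpret G: comm_group IG by (rule IG_comm_group)
  have "principal_fractional_ideals s \<O> \<lhd> IG" by (rule G.subgroup_imp_normal[OF principal_subgroup])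
  then show ?thesis
    unfolding class_group_def ideal_class_def[abs_def] by (rule normal.r_coset_hom_Mod)
qed

lemma ideal_class_one_iff:
  assumes "I \<in> carrier IG"
  shows "ideal_class s \<O> I = \<one>\<^bsub>class_group s \<O>\<^esub> \<longleftrightarrow> I \<in> principal_fractional_ideals s \<O>"
proof -
  interpret G: comm_group IG by (rule IG_comm_group)
  show ?thesis unfolding class_group_def ideal_class_def one_FactGroup
    using G.coset_join1[OF _ assms principal_subgroup] G.coset_join2[OF assms principal_subgroup]
      subgroup.subset[OF principal_subgroup] by blast
qed

lemma class_of_finprod:
  fixes l :: nat
  assumes "\<And>i. i < l \<Longrightarrow> f i \<in> carrier IG"
  shows "ideal_class s \<O> (finprod IG f {..<l}) = finprod (class_group s \<O>) (\<lambda>i. ideal_class s \<O> (f i)) {..<l}"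
proof -
  interpret G: comm_group IG by (rule IG_comm_group)
  interpret C: comm_group "class_group s \<O>" by (rule class_group_comm)
  have c: "ideal_class s \<O> I \<in> carrier (class_group s \<O>)" if "I \<in> carrier IG" for I
    using ideal_class_hom[of s] that by (rule hom_in_carrier)
  show ?thesis using assms
  proof (induction l)
    case 0
    show ?case using hom_one[OF ideal_class_hom G.group_axioms C.group_axioms] by simp
  next
    case (Suc l)
    have f: "f \<in> {..<l} \<rightarrow> carrier IG" "f l \<in> carrier IG" using Suc.prems by auto
    have "ideal_class s \<O> (finprod IG f {..<Suc l}) = ideal_class s \<O> (f l \<otimes>\<^bsub>IG\<^esub> finprod IG f {..<l})"
      using f by (simp add: lessThan_Suc G.finprod_insert)
    also have "\<dots> = ideal_class s \<O> (f l) \<otimes>\<^bsub>class_group s \<O>\<^esub> ideal_class s \<O> (finprod IG f {..<l})"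
      by (rule hom_mult[OF ideal_class_hom f(2) G.finprod_closed[OF f(1)]])
    also have "\<dots> = finprod (class_group s \<O>) (\<lambda>i. ideal_class s \<O> (f i)) {..<Suc l}"
      using Suc f c by (simp add: lessThan_Suc C.finprod_insert Pi_def)
    finally show ?case .
  qed
qed

end

context galois_order
begin

lemma K_elems_image: assumes g: "\<gamma> \<in> (Gal :: ('a \<Rightarrow> 'a) set)" and a: "a \<in> K_elems s" shows "\<gamma> a \<in> K_elems s"
proof (cases s)
  case General
  then show ?thesis using a Gal_eq_0[OF g] by simp
next
  case Totally_Positive
  have "\<sigma> \<circ> \<gamma> \<in> real_embeddings" if s: "\<sigma> \<in> real_embeddings" for \<sigma>
    using real_embedding_simps[OF s] Gal_1[OF g] Gal_add[OF g] Gal_mult[OF g]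
    by (auto simp: real_embeddings_def Ring.ring_hom_def ring_of_type_algebra_def)
  moreover have "\<And>\<sigma>. \<sigma> \<in> real_embeddings \<Longrightarrow> \<sigma> a > 0" "a \<noteq> 0" using a Totally_Positive by auto
  ultimately have "(\<sigma> \<circ> \<gamma>) a > 0" if "\<sigma> \<in> real_embeddings" for \<sigma> using that by blast
  then show ?thesis using \<open>a \<noteq> 0\<close> Totally_Positive Gal_eq_0[OF g] by simp
qed

lemma principal_image: "\<gamma> \<in> Gal \<Longrightarrow> \<gamma> ` ((*) a ` \<O>) = (*) (\<gamma> a) ` \<O>"
proof -
  assume g: "\<gamma> \<in> Gal"
  have "\<gamma> ` ((*) a ` \<O>) = (*) (\<gamma> a) ` (\<gamma> ` \<O>)" by (simp add: image_image Gal_mult[OF g])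
  then show ?thesis unfolding Gal_O[OF g] .
qed

text \<open>The automorphism maps a principal ideal with generator \<open>a\<close> to the one with generator \<open>\<gamma> a\<close>, and it
  preserves total positivity because a real embedding composed with \<open>\<gamma>\<close> is a real embedding.\<close>

lemma Gal_ideal_class:
  assumes g: "\<gamma> \<in> Gal" and I: "I \<in> carrier IG"
  shows "((`) ((`) \<gamma>)) (ideal_class s \<O> I) = ideal_class s \<O> (\<gamma> ` I)"
proof -
  have cls: "ideal_class s \<O> J = {((*) a ` \<O>) \<star> J |a. a \<in> K_elems s}" for J
    by (auto simp: ideal_class_def r_coset_def IG_simps principal_fractional_ideals_def)
  show ?thesis
  proof
    show "((`) ((`) \<gamma>)) (ideal_class s \<O> I) \<subseteq> ideal_class s \<O> (\<gamma> ` I)"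
    proof
      fix J assume "J \<in> ((`) ((`) \<gamma>)) (ideal_class s \<O> I)"
      then obtain a where a: "a \<in> K_elems s" "J = \<gamma> ` (((*) a ` \<O>) \<star> I)" unfolding cls by blast
      have "J = ((*) (\<gamma> a) ` \<O>) \<star> (\<gamma> ` I)" unfolding a(2) Gal_iprod[OF g] principal_image[OF g] ..
      then show "J \<in> ideal_class s \<O> (\<gamma> ` I)" unfolding cls using K_elems_image[OF g a(1)] by blast
    qed
    show "ideal_class s \<O> (\<gamma> ` I) \<subseteq> ((`) ((`) \<gamma>)) (ideal_class s \<O> I)"
    proof
      fix J assume "J \<in> ideal_class s \<O> (\<gamma> ` I)"
      then obtain a where a: "a \<in> K_elems s" "J = ((*) a ` \<O>) \<star> (\<gamma> ` I)" unfolding cls by blast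
      define b where "b = inv_into UNIV \<gamma> a"
      have b: "b \<in> K_elems s" "\<gamma> b = a"
        using K_elems_image[OF Gal_inv[OF g] a(1)] Gal_inv_right[OF g] by (simp_all add: b_def)
      have "J = \<gamma> ` (((*) b ` \<O>) \<star> I)" unfolding a(2) Gal_iprod[OF g] principal_image[OF g] b(2) ..
      then show "J \<in> ((`) ((`) \<gamma>)) (ideal_class s \<O> I)" unfolding cls using b(1) by blast
    qed
  qed
qed

end

section \<open>Norms of principal ideals and weighted zero-sum sequences\<close>

lemma (in comm_monoid) finprod_lessThan_add:
  fixes l k :: nat
  assumes "\<And>i. i < l + k \<Longrightarrow> h i \<in> carrier G"
  shows "finprod G h {..<l + k} = finprod G h {..<l} \<otimes> finprod G (\<lambda>i. h (l + i)) {..<k}"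
  using assms
proof (induction k)
  case 0
  then have "finprod G h {..<l} \<in> carrier G" by (intro finprod_closed) auto
  then show ?case by simp
next
  case (Suc k)
  have c: "h \<in> {..<l + k} \<rightarrow> carrier G" "h (l + k) \<in> carrier G" "h \<in> {..<l} \<rightarrow> carrier G"
    "(\<lambda>i. h (l + i)) \<in> {..<k} \<rightarrow> carrier G" using Suc.prems by auto
  have "finprod G h {..<l + Suc k} = h (l + k) \<otimes> finprod G h {..<l + k}"
    using c by (simp add: lessThan_Suc finprod_insert)
  also have "\<dots> = h (l + k) \<otimes> (finprod G h {..<l} \<otimes> finprod G (\<lambda>i. h (l + i)) {..<k})"
    using Suc by simp
  also have "\<dots> = finprod G h {..<l} \<otimes> (h (l + k) \<otimes> finprod G (\<lambda>i. h (l + i)) {..<k})"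
    using c by (intro m_lcomm finprod_closed) auto
  also have "h (l + k) \<otimes> finprod G (\<lambda>i. h (l + i)) {..<k} = finprod G (\<lambda>i. h (l + i)) {..<Suc k}"
    using c by (simp add: lessThan_Suc finprod_insert)
  finally show ?case .
qed

lemma sum_replicate_count:
  assumes "finite S" "set_mset U \<subseteq> S"
  shows "(\<Sum>p\<in>S. replicate_mset (count U p) (\<phi> p)) = image_mset \<phi> U"
  using assms(2)
proof (induction U)
  case empty then show ?case by simp
next
  case (add q U)
  have "(\<Sum>p\<in>S. replicate_mset (count (add_mset q U) p) (\<phi> p)) =
      (\<Sum>p\<in>S. (if p = q then {#\<phi> p#} else {#}) + replicate_mset (count U p) (\<phi> p))"
    by (rule sum.cong) auto
  also have "\<dots> = {#\<phi> q#} + image_mset \<phi> U"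
    using add assms(1) by (simp add: sum.distrib)
  finally show ?case by simp
qed

text \<open>The inertia degrees enter as a parameter \<open>f\<close> with a defining assumption: a definition would need
  an explicit type argument, as its value mentions the field only through its type.\<close>

locale chosen_primes = galois_order +
  fixes s :: positivity and \<pp> :: "nat \<Rightarrow> 'a set" and f :: "nat \<Rightarrow> nat"
  assumes choice: "prime_ideal_choice s m \<O> \<pp>"
    and f_def: "f = inertia_degree TYPE('a)"
begin

abbreviation "Cl \<equiv> class_group s \<O>"
abbreviation "\<phi> p \<equiv> ideal_class s \<O> (\<pp> p)"
abbreviation "Pm \<equiv> primes_not_dividing m"
abbreviation "CB \<equiv> carrier (weighted_zero_sum_monoid Cl Gal_on_classes)"

lemma Pm_prime: "p \<in> Pm \<Longrightarrow> Factorial_Ring.prime p" and Pm_not_dvd: "p \<in> Pm \<Longrightarrow> \<not> p dvd m"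
  by (auto simp: primes_not_dividing_def)

lemma pp:
  assumes "p \<in> Pm" shows "oprime (\<pp> p)" "coprime_m (\<pp> p)" "of_nat p \<in> \<pp> p"
  using choice assms unfolding prime_ideal_choice_def coprime_prime_ideals_iff by blast+

lemma f_pos: "p \<in> Pm \<Longrightarrow> f p > 0"
  unfolding f_def by (rule inertia_degree_pos[OF pp(1,3) Pm_prime Pm_not_dvd])

lemma carrier_Cl: "carrier Cl = {\<phi> p |p. p \<in> Pm \<and> f p = 1}"
  using choice by (simp add: prime_ideal_choice_def f_def)

lemma pp_image:
  assumes "p \<in> Pm" "\<gamma> \<in> Gal"
  shows "oprime (\<gamma> ` \<pp> p)" "coprime_m (\<gamma> ` \<pp> p)" "\<gamma> ` \<pp> p \<in> carrier IG"
    "index (\<gamma> ` \<pp> p) \<O> = p ^ f p" "((`) ((`) \<gamma>)) (\<phi> p) = ideal_class s \<O> (\<gamma> ` \<pp> p)"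
proof -
  show 1: "oprime (\<gamma> ` \<pp> p)" "coprime_m (\<gamma> ` \<pp> p)"
    using oprime_image[OF assms(2) pp(1)] coprime_m_image[OF assms(2) pp(2)] assms(1) by auto
  then show "\<gamma> ` \<pp> p \<in> carrier IG" by (rule prime_in_IG)
  have "index (\<gamma> ` \<pp> p) \<O> = index (\<pp> p) \<O>"
    using oprime_oideal[OF pp(1)[OF assms(1)]] by (intro index_image[OF assms(2)]) (simp add: oideal_def)
  then show "index (\<gamma> ` \<pp> p) \<O> = p ^ f p"
    using index_prime_eq_power[OF pp(1,3) Pm_prime Pm_not_dvd] assms(1) by (simp add: f_def)
  show "((`) ((`) \<gamma>)) (\<phi> p) = ideal_class s \<O> (\<gamma> ` \<pp> p)"
    by (rule Gal_ideal_class[OF assms(2) prime_in_IG[OF pp(1,2)]]) (rule assms(1))+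
qed

lemma class_in_Cl: "I \<in> carrier IG \<Longrightarrow> ideal_class s \<O> I \<in> carrier Cl"
  using ideal_class_hom[of s] by (rule hom_in_carrier)

lemma weights_closed:
  assumes "\<gamma> \<in> Gal_on_classes" "C \<in> carrier Cl" shows "\<gamma> C \<in> carrier Cl"
proof -
  obtain p where p: "p \<in> Pm" "C = \<phi> p" using assms(2) by (auto simp: carrier_Cl)
  obtain \<delta> where d: "\<delta> \<in> Gal" "\<gamma> = (`) ((`) \<delta>)" using assms(1) by (auto simp: Gal_on_classes_def)
  show ?thesis unfolding p d pp_image(5)[OF p(1) d(1)] by (rule class_in_Cl[OF pp_image(3)[OF p(1) d(1)]])
qed

text \<open>The norm of a product of prime ideals coprime to \<open>m\<close> that lie above the primes in \<open>U\<close>.\<close>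

definition \<nu> :: "nat multiset \<Rightarrow> nat" where "\<nu> U = (\<Prod>p\<in>#U. p ^ f p)"

lemma nu_pos: "set_mset U \<subseteq> Pm \<Longrightarrow> \<nu> U > 0"
proof (induction U)
  case (add p U)
  then show ?case using prime_gt_0_nat[OF Pm_prime, of p] by (simp add: \<nu>_def)
qed (simp add: \<nu>_def)

lemma multiplicity_nu:
  assumes "set_mset U \<subseteq> Pm" "Factorial_Ring.prime p" shows "multiplicity p (\<nu> U) = f p * count U p"
  using assms(1)
proof (induction U)
  case empty then show ?case by (simp add: \<nu>_def)
next
  case (add q U)
  have q: "Factorial_Ring.prime q" using add.prems Pm_prime by simp
  have "multiplicity p (\<nu> (add_mset q U)) = multiplicity p (q ^ f q * \<nu> U)" by (simp add: \<nu>_def)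
  also have "\<dots> = multiplicity p (q ^ f q) + multiplicity p (\<nu> U)"
    using assms(2) nu_pos[of U] add.prems prime_gt_0_nat[OF q]
    by (intro prime_elem_multiplicity_mult_distrib) auto
  also have "multiplicity p (q ^ f q) = (if p = q then f q else 0)"
    using assms(2) q by (simp add: multiplicity_distinct_prime_power)
  finally show ?case using add by simp
qed

lemma nu_inj: "inj_on \<nu> {U. set_mset U \<subseteq> Pm}"
proof (rule inj_onI)
  fix U V assume U: "U \<in> {U. set_mset U \<subseteq> Pm}" and V: "V \<in> {U. set_mset U \<subseteq> Pm}" and eq: "\<nu> U = \<nu> V"
  show "U = V"
  proof (rule multiset_eqI)
    fix p
    show "count U p = count V p"
    proof (cases "p \<in> Pm")
      case True
      have "f p * count U p = multiplicity p (\<nu> U)" using multiplicity_nu[of U p] U Pm_prime[OF True] by simp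
      also have "\<dots> = f p * count V p" unfolding eq using multiplicity_nu[of V p] V Pm_prime[OF True] by simp
      finally have "f p * count U p = f p * count V p" .
      then show ?thesis using f_pos[OF True] by simp
    next
      case False
      then have "p \<notin># U" "p \<notin># V" using U V by auto
      then show ?thesis by (simp add: not_in_iff)
    qed
  qed
qed

lemma Theta_nu: assumes U: "set_mset U \<subseteq> Pm" shows "Theta s m \<O> \<pp> (\<nu> U) = image_mset \<phi> U"
proof -
  have "{p \<in> Pm. p dvd \<nu> U} = set_mset U"
  proof (rule Set.set_eqI)
    fix p
    show "p \<in> {p \<in> Pm. p dvd \<nu> U} \<longleftrightarrow> p \<in># U"
    proof (cases "p \<in> Pm")
      case True
      have "p dvd \<nu> U \<longleftrightarrow> multiplicity p (\<nu> U) > 0"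
        using nu_pos[OF U] prime_multiplicity_gt_zero_iff[of p "\<nu> U"] Pm_prime[OF True] by simp
      also have "\<dots> \<longleftrightarrow> count U p > 0" using multiplicity_nu[OF U Pm_prime[OF True]] f_pos[OF True] by simp
      finally show ?thesis using True by simp
    next
      case False then show ?thesis using U by auto
    qed
  qed
  then have "Theta s m \<O> \<pp> (\<nu> U) = (\<Sum>p\<in>set_mset U. replicate_mset (multiplicity p (\<nu> U) div f p) (\<phi> p))"
    by (simp add: Theta_def f_def)
  also have "\<dots> = (\<Sum>p\<in>set_mset U. replicate_mset (count U p) (\<phi> p))"
  proof (rule sum.cong[OF refl])
    fix p assume "p \<in># U"
    then have p: "p \<in> Pm" using U by blast
    then have "multiplicity p (\<nu> U) div f p = count U p"
      using multiplicity_nu[OF U Pm_prime[OF p]] f_pos[OF p] by simp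
    then show "replicate_mset (multiplicity p (\<nu> U) div f p) (\<phi> p) = replicate_mset (count U p) (\<phi> p)" by simp
  qed
  also have "\<dots> = image_mset \<phi> U" by (rule sum_replicate_count) auto
  finally show ?thesis .
qed

text \<open>The exponent of each prime \<open>p\<close> in \<open>n\<close> is a multiple of \<open>f p\<close>, and the quotient is the multiplicity
  of \<open>p\<close> in \<open>U\<close>.\<close>

lemma field_norms_nu: assumes n: "n \<in> field_norms TYPE('a) m" obtains U where "set_mset U \<subseteq> Pm" "n = \<nu> U"
proof -
  have n': "n > 0" "coprime n m" "\<And>p. p \<in> Pm \<Longrightarrow> f p dvd multiplicity p n"
    using n by (auto simp: field_norms_def f_def)
  have Pn: "p \<in> Pm" if "p \<in> prime_factors n" for p
  proof -
    have p: "Factorial_Ring.prime p" "p dvd n" using that by (auto simp: in_prime_factors_iff)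
    have "\<not> p dvd m"
    proof
      assume "p dvd m"
      then have "p dvd 1" using coprime_common_divisor[OF n'(2) p(2)] by simp
      then show False using p(1) by (simp add: not_prime_unit)
    qed
    then show ?thesis using p(1) by (simp add: primes_not_dividing_def)
  qed
  define U where "U = (\<Sum>p\<in>prime_factors n. replicate_mset (multiplicity p n div f p) p)"
  have "set_mset U \<subseteq> Pm"
    unfolding U_def using Pn by (auto simp: set_mset_sum split: if_splits)
  moreover have "n = \<nu> U"
  proof -
    have nu_sum: "\<nu> (\<Sum>p\<in>A. replicate_mset (k p) p) = (\<Prod>p\<in>A. (p ^ f p) ^ k p)" if "finite A" for A k
      using that by (induction A rule: finite_induct) (auto simp: \<nu>_def)
    have "\<nu> U = (\<Prod>p\<in>prime_factors n. (p ^ f p) ^ (multiplicity p n div f p))"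
      unfolding U_def by (rule nu_sum) simp
    also have "\<dots> = (\<Prod>p\<in>prime_factors n. p ^ multiplicity p n)"
      using n'(3)[OF Pn] by (intro prod.cong) (auto simp: power_mult[symmetric])
    also have "\<dots> = n" using prime_factorization_nat[OF n'(1)] by simp
    finally show ?thesis ..
  qed
  ultimately show thesis by (rule that)
qed

lemma CB_iff: "S \<in> CB \<longleftrightarrow> (\<exists>(l::nat) g \<gamma>. S = mset (map g [0..<l]) \<and>
         (\<forall>i<l. g i \<in> carrier Cl \<and> \<gamma> i \<in> Gal_on_classes) \<and>
         finprod Cl (\<lambda>i. \<gamma> i (g i)) {..<l} = \<one>\<^bsub>Cl\<^esub>)"
  by (simp add: weighted_zero_sum_monoid_def)

lemma CB_empty: "{#} \<in> CB"
proof -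
  interpret C: comm_group Cl by (rule class_group_comm)
  show ?thesis unfolding CB_iff by (rule exI[of _ 0]) simp
qed

text \<open>Two weighted sums are concatenated, the second one being shifted by the length of the first.\<close>

lemma CB_add: assumes S: "S \<in> CB" and T: "T \<in> CB" shows "S + T \<in> CB"
proof -
  interpret C: comm_group Cl by (rule class_group_comm)
  obtain l g \<gamma> where S: "S = mset (map g [0..<l])" "\<forall>i<l. g i \<in> carrier Cl \<and> \<gamma> i \<in> Gal_on_classes"
    "finprod Cl (\<lambda>i. \<gamma> i (g i)) {..<l} = \<one>\<^bsub>Cl\<^esub>" using S unfolding CB_iff by blast
  obtain k h \<delta> where T: "T = mset (map h [0..<k])" "\<forall>i<k. h i \<in> carrier Cl \<and> \<delta> i \<in> Gal_on_classes"
    "finprod Cl (\<lambda>i. \<delta> i (h i)) {..<k} = \<one>\<^bsub>Cl\<^esub>" using T unfolding CB_iff by blast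
  define g' where "g' i = (if i < l then g i else h (i - l))" for i
  define \<gamma>' where "\<gamma>' i = (if i < l then \<gamma> i else \<delta> (i - l))" for i
  have c: "g' i \<in> carrier Cl \<and> \<gamma>' i \<in> Gal_on_classes" if "i < l + k" for i
    using S(2) T(2) that by (cases "i < l") (auto simp: g'_def \<gamma>'_def)
  have cw: "\<gamma>' i (g' i) \<in> carrier Cl" if "i < l + k" for i using c[OF that] weights_closed by blast
  have "map g' [0..<l + k] = map g [0..<l] @ map h [0..<k]"
    by (rule nth_equalityI) (auto simp: g'_def nth_append)
  then have "S + T = mset (map g' [0..<l + k])" unfolding S(1) T(1) by (metis mset_append)
  moreover have "finprod Cl (\<lambda>i. \<gamma>' i (g' i)) {..<l + k} = \<one>\<^bsub>Cl\<^esub>"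
  proof -
    have "finprod Cl (\<lambda>i. \<gamma>' i (g' i)) {..<l + k} = finprod Cl (\<lambda>i. \<gamma>' i (g' i)) {..<l} \<otimes>\<^bsub>Cl\<^esub>
        finprod Cl (\<lambda>i. \<gamma>' (l + i) (g' (l + i))) {..<k}"
      by (rule C.finprod_lessThan_add[OF cw])
    also have "finprod Cl (\<lambda>i. \<gamma>' i (g' i)) {..<l} = finprod Cl (\<lambda>i. \<gamma> i (g i)) {..<l}"
      using S(2) weights_closed by (intro C.finprod_cong') (auto simp: g'_def \<gamma>'_def)
    also have "finprod Cl (\<lambda>i. \<gamma>' (l + i) (g' (l + i))) {..<k} = finprod Cl (\<lambda>i. \<delta> i (h i)) {..<k}"
      using T(2) weights_closed by (intro C.finprod_cong') (auto simp: g'_def \<gamma>'_def)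
    finally show ?thesis using S(3) T(3) by simp
  qed
  ultimately show ?thesis unfolding CB_iff using c by blast
qed

lemma CB_lifts: assumes "S \<in> CB" shows "set_mset S \<subseteq> \<phi> ` Pm"
proof -
  have "set_mset S \<subseteq> carrier Cl" using assms unfolding CB_iff by force
  then show ?thesis unfolding carrier_Cl by blast
qed

text \<open>Factor the principal ideal and write each prime factor as the image of a chosen prime ideal under
  an automorphism. These automorphisms are weights with which the classes of the chosen prime ideals
  sum to the trivial class of the ideal.\<close>

lemma principal_norm_imp_zero_sum:
  assumes n: "n \<in> ideal_norm \<O> ` coprime_principal_ideals s m \<O>"
  obtains U where "set_mset U \<subseteq> Pm" "n = \<nu> U" "image_mset \<phi> U \<in> CB"
proof -
  obtain a where a: "a \<in> \<O>" "a \<in> K_elems s" "coprime_to m \<O> ((*) a ` \<O>)" "n = index ((*) a ` \<O>) \<O>"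
    using n unfolding coprime_principal_ideals_def ideal_norm_index by blast
  define I where "I = (*) a ` \<O>"
  have I: "oideal I" "coprime_m I" using oideal_principal[OF a(1)] coprime_to_iff a(3) by (auto simp: I_def)
  have "a * 1 \<in> I" unfolding I_def using one by (rule imageI)
  then have "I \<noteq> {0}" using K_elems_nonzero[OF a(2)] by auto
  then obtain Ps where Ps: "\<And>P. P \<in> set Ps \<Longrightarrow> oprime P \<and> coprime_m P" "I = lprod Ps"
    using prime_factorization[OF I(1) _ I(2)] by blast
  have "\<forall>P\<in>set Ps. \<exists>q. fst q \<in> Pm \<and> snd q \<in> Gal \<and> P = snd q ` \<pp> (fst q)"
  proof
    fix P assume "P \<in> set Ps"
    then have P: "oprime P" "coprime_m P" using Ps(1) by auto
    obtain p where p: "Factorial_Ring.prime p" "of_nat p \<in> P" using oprime_prime_number[OF P(1)] by blast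
    have pm: "p \<in> Pm" using coprime_m_iff_not_dvd[OF P(1) p] P(2) p(1) by (simp add: primes_not_dividing_def)
    obtain \<gamma> where "\<gamma> \<in> Gal" "P = \<gamma> ` \<pp> p" using Gal_transitive[OF pp(1)[OF pm] P(1) p(1) pp(3)[OF pm] p(2)] by blast
    then have "fst (p, \<gamma>) \<in> Pm \<and> snd (p, \<gamma>) \<in> Gal \<and> P = snd (p, \<gamma>) ` \<pp> (fst (p, \<gamma>))"
      unfolding fst_conv snd_conv using pm by blast
    then show "\<exists>q. fst q \<in> Pm \<and> snd q \<in> Gal \<and> P = snd q ` \<pp> (fst q)" by (rule exI)
  qed
  from bchoice[OF this] obtain q where
    qq: "\<forall>P\<in>set Ps. fst (q P) \<in> Pm \<and> snd (q P) \<in> Gal \<and> P = snd (q P) ` \<pp> (fst (q P))" by (rule exE)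
  have q: "fst (q P) \<in> Pm" "snd (q P) \<in> Gal" "P = snd (q P) ` \<pp> (fst (q P))" if "P \<in> set Ps" for P
    using bspec[OF qq that] by - (elim conjE, assumption)+
  define U where "U = mset (map (\<lambda>P. fst (q P)) Ps)"
  have U: "set_mset U \<subseteq> Pm" unfolding U_def using q(1) by auto
  have "n = (\<Prod>P\<leftarrow>Ps. index P \<O>)" unfolding a(4) using index_lprod[OF Ps(1)] Ps(2) by (simp add: I_def)
  also have "\<dots> = (\<Prod>P\<leftarrow>Ps. fst (q P) ^ f (fst (q P)))"
  proof (rule arg_cong[of _ _ prod_list], rule map_cong[OF refl])
    fix P assume P: "P \<in> set Ps"
    show "index P \<O> = fst (q P) ^ f (fst (q P))"
      using pp_image(4)[OF q(1,2)[OF P]] q(3)[OF P] by simp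
  qed
  also have "\<dots> = \<nu> U" by (simp add: \<nu>_def U_def prod_mset_prod_list[symmetric] image_mset.compositionality comp_def)
  finally have n_nu: "n = \<nu> U" .
  \<comment> \<open>The weight of the \<open>i\<close>-th class moves the chosen prime ideal to the \<open>i\<close>-th factor.\<close>
  define g where "g i = \<phi> (fst (q (Ps ! i)))" for i
  define \<gamma> where "\<gamma> i = ((`) ((`) (snd (q (Ps ! i)))) :: 'a set set \<Rightarrow> 'a set set)" for i
  have "image_mset \<phi> U = mset (map g [0..<length Ps])"
  proof -
    have "map (\<lambda>P. \<phi> (fst (q P))) Ps = map g [0..<length Ps]"
      by (rule nth_equalityI) (auto simp: g_def)
    then have "mset (map (\<lambda>P. \<phi> (fst (q P))) Ps) = mset (map g [0..<length Ps])" by (rule arg_cong)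
    then show ?thesis by (simp add: U_def image_mset.compositionality comp_def)
  qed
  moreover have "g i \<in> carrier Cl \<and> \<gamma> i \<in> Gal_on_classes" if i: "i < length Ps" for i
  proof -
    have Pi: "Ps ! i \<in> set Ps" using i by simp
    have "\<phi> (fst (q (Ps ! i))) \<in> carrier Cl"
      by (rule class_in_Cl[OF prime_in_IG]) (use pp(1,2) q(1)[OF Pi] in auto)
    then show ?thesis using q(2)[OF Pi] by (auto simp: g_def \<gamma>_def Gal_on_classes_def)
  qed
  moreover have "finprod Cl (\<lambda>i. \<gamma> i (g i)) {..<length Ps} = \<one>\<^bsub>Cl\<^esub>"
  proof -
    interpret C: comm_group Cl by (rule class_group_comm)
    have PsIG: "set Ps \<subseteq> carrier IG" using Ps(1) prime_in_IG by blast
    have cls: "\<gamma> i (g i) = ideal_class s \<O> (Ps ! i)" if i: "i < length Ps" for i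
    proof -
      have Pi: "Ps ! i \<in> set Ps" using i by simp
      have "\<gamma> i (g i) = ideal_class s \<O> (snd (q (Ps ! i)) ` \<pp> (fst (q (Ps ! i))))"
        unfolding g_def \<gamma>_def by (rule pp_image(5)[OF q(1,2)[OF Pi]])
      then show ?thesis unfolding q(3)[OF Pi, symmetric] .
    qed
    have "finprod Cl (\<lambda>i. \<gamma> i (g i)) {..<length Ps} = finprod Cl (\<lambda>i. ideal_class s \<O> (Ps ! i)) {..<length Ps}"
      using cls class_in_Cl PsIG by (intro C.finprod_cong') (auto simp: subset_iff)
    also have "\<dots> = ideal_class s \<O> (finprod IG (\<lambda>i. Ps ! i) {..<length Ps})"
      using PsIG by (intro class_of_finprod[symmetric]) (auto simp: subset_iff)
    also have "\<dots> = ideal_class s \<O> I" unfolding lprod_finprod(1)[OF PsIG, symmetric] Ps(2) ..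
    also have "\<dots> = \<one>\<^bsub>Cl\<^esub>"
    proof -
      have "I \<in> principal_fractional_ideals s \<O>" unfolding I_def principal_fractional_ideals_def using a(2) by blast
      moreover have "I \<in> carrier IG" unfolding I_def by (rule principal_in_IG[OF K_elems_nonzero[OF a(2)]])
      ultimately show ?thesis using ideal_class_one_iff by blast
    qed
    finally show ?thesis .
  qed
  ultimately have "image_mset \<phi> U \<in> CB" unfolding CB_iff by blast
  then show thesis by (rule that[OF U n_nu])
qed

text \<open>The weights of a vanishing weighted sum are automorphisms. Moving the chosen prime ideals by them
  and multiplying gives an ideal in the trivial class, with the prescribed norm. Its generator is an
  element of \<open>\<O>\<close> because the ideal contains it.\<close>

lemma zero_sum_imp_principal_norm:
  assumes U: "set_mset U \<subseteq> Pm" and zs: "image_mset \<phi> U \<in> CB"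
  shows "\<nu> U \<in> ideal_norm \<O> ` coprime_principal_ideals s m \<O>"
proof -
  interpret C: comm_group Cl by (rule class_group_comm)
  obtain l g \<gamma> where g: "image_mset \<phi> U = mset (map g [0..<l])"
    "\<And>i. i < l \<Longrightarrow> g i \<in> carrier Cl" "\<And>i. i < l \<Longrightarrow> \<gamma> i \<in> Gal_on_classes"
    "finprod Cl (\<lambda>i. \<gamma> i (g i)) {..<l} = \<one>\<^bsub>Cl\<^esub>" using zs unfolding CB_iff by blast
  obtain ps where ps: "mset ps = U" "map \<phi> ps = map g [0..<l]" by (rule lift_list[OF g(1)])
  have len: "length ps = l" using arg_cong[OF ps(2), of length] by simp
  have psm: "ps ! i \<in> Pm" if "i < l" for i using U that unfolding ps(1)[symmetric] len[symmetric] by auto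
  have gi: "g i = \<phi> (ps ! i)" if "i < l" for i
    using arg_cong[OF ps(2), of "\<lambda>xs. xs ! i"] that len by simp
  have "\<forall>i\<in>{..<l}. \<exists>d. d \<in> Gal \<and> \<gamma> i = (`) ((`) d)" using g(3) by (auto simp: Gal_on_classes_def)
  from bchoice[OF this] obtain d where d: "\<And>i. i < l \<Longrightarrow> d i \<in> Gal" "\<And>i. i < l \<Longrightarrow> \<gamma> i = (`) ((`) (d i))" by blast
  define Ps where "Ps = map (\<lambda>i. d i ` \<pp> (ps ! i)) [0..<l]"
  have lenP: "length Ps = l" and nthP: "\<And>i. i < l \<Longrightarrow> Ps ! i = d i ` \<pp> (ps ! i)" by (auto simp: Ps_def)
  have Ps: "oprime P \<and> coprime_m P" if "P \<in> set Ps" for P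
    using that pp_image(1,2)[OF psm d(1)] by (auto simp: Ps_def)
  have PsIG: "set Ps \<subseteq> carrier IG" using Ps prime_in_IG by blast
  define I where "I = lprod Ps"
  have I: "oideal I" "coprime_m I" "I \<in> carrier IG"
    unfolding I_def using lprod_oideal[of Ps] Ps oprime_oideal coprime_m_lprod[of Ps] lprod_finprod(2)[OF PsIG] by auto
  have "ideal_class s \<O> I = finprod Cl (\<lambda>i. ideal_class s \<O> (Ps ! i)) {..<l}"
    unfolding I_def lprod_finprod(1)[OF PsIG] lenP
    using PsIG lenP by (intro class_of_finprod) (auto simp: subset_iff)
  also have "\<dots> = finprod Cl (\<lambda>i. \<gamma> i (g i)) {..<l}"
  proof (rule C.finprod_cong'[OF refl])
    show "(\<lambda>i. \<gamma> i (g i)) \<in> {..<l} \<rightarrow> carrier Cl" using weights_closed g(2,3) by auto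
    fix i assume "i \<in> {..<l}"
    then have i: "i < l" by simp
    show "ideal_class s \<O> (Ps ! i) = \<gamma> i (g i)"
      unfolding nthP[OF i] gi[OF i] d(2)[OF i] by (rule pp_image(5)[OF psm[OF i] d(1)[OF i], symmetric])
  qed
  finally have "I \<in> principal_fractional_ideals s \<O>" using g(4) ideal_class_one_iff[OF I(3)] by simp
  then obtain a where a: "a \<in> K_elems s" "I = (*) a ` \<O>" unfolding principal_fractional_ideals_def by blast
  have "a * 1 \<in> I" unfolding a(2) using one by (rule imageI)
  then have aO: "a \<in> \<O>" using I(1) by (auto simp: oideal_def)
  have "I \<in> coprime_principal_ideals s m \<O>"
    unfolding coprime_principal_ideals_def using a aO coprime_to_iff[OF I(1)] I(2) by blast
  moreover have "ideal_norm \<O> I = \<nu> U"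
  proof -
    have "ideal_norm \<O> I = (\<Prod>P\<leftarrow>Ps. index P \<O>)" unfolding ideal_norm_index I_def by (rule index_lprod[OF Ps])
    also have "map (\<lambda>P. index P \<O>) Ps = map (\<lambda>p. p ^ f p) ps"
      by (rule nth_equalityI) (auto simp: lenP len nthP pp_image(4)[OF psm d(1)])
    also have "prod_list \<dots> = \<nu> U" unfolding \<nu>_def ps(1)[symmetric] by (metis mset_map prod_mset_prod_list)
    finally show ?thesis .
  qed
  ultimately show ?thesis by (metis imageI)
qed

sublocale lift: block_lift Pm \<nu> \<phi> CB "Theta s m \<O> \<pp>"
proof
  show "inj_on \<nu> {U. set_mset U \<subseteq> Pm}" by (rule nu_inj)
qed (simp_all add: \<nu>_def[of "{#}"] \<nu>_def[of "_ + _"] Theta_nu CB_empty CB_add CB_lifts \<nu>_def[symmetric])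

lemma principal_norm_monoid_lift: "principal_norm_monoid s m \<O> = lift.H"
proof -
  have "ideal_norm \<O> ` coprime_principal_ideals s m \<O> = \<nu> ` lift.D"
  proof
    show "ideal_norm \<O> ` coprime_principal_ideals s m \<O> \<subseteq> \<nu> ` lift.D"
    proof
      fix n assume "n \<in> ideal_norm \<O> ` coprime_principal_ideals s m \<O>"
      then obtain U where "set_mset U \<subseteq> Pm" "n = \<nu> U" "image_mset \<phi> U \<in> CB" by (rule principal_norm_imp_zero_sum)
      then show "n \<in> \<nu> ` lift.D" by (auto simp: lift.D_def)
    qed
    show "\<nu> ` lift.D \<subseteq> ideal_norm \<O> ` coprime_principal_ideals s m \<O>"
      using zero_sum_imp_principal_norm by (auto simp: lift.D_def)
  qed
  then show ?thesis by (simp add: principal_norm_monoid_def lift.H_def)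
qed

lemma weighted_zero_sum_monoid_lift: "weighted_zero_sum_monoid Cl Gal_on_classes = lift.B"
  by (simp add: lift.B_def) (simp add: weighted_zero_sum_monoid_def)

lemma norm_iff_zero_sum:
  assumes "n \<in> field_norms TYPE('a) m"
  shows "n \<in> carrier (principal_norm_monoid s m \<O>) \<longleftrightarrow> Theta s m \<O> \<pp> n \<in> CB"
proof -
  obtain U where U: "set_mset U \<subseteq> Pm" "n = \<nu> U" using field_norms_nu[OF assms] .
  have "n \<in> carrier (principal_norm_monoid s m \<O>) \<longleftrightarrow> U \<in> lift.D"
    unfolding principal_norm_monoid_lift lift.carrier_H U(2)
    using U(1) inj_onD[OF nu_inj, of U] lift.D_sub by auto
  also have "\<dots> \<longleftrightarrow> Theta s m \<O> \<pp> n \<in> CB" using U Theta_nu[OF U(1)] by (simp add: lift.D_def)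
  finally show ?thesis .
qed

end


interpretation qmod: Modules.module "\<lambda>(q::rat) (x::'a::field_char_0). of_rat q * x"
  by unfold_locales (auto simp: algebra_simps of_rat_add of_rat_mult)

theorem theorem3p2:
  fixes \<O> :: "'a::field_char_0 set" and m :: nat
    and s :: positivity and \<pp> :: "nat \<Rightarrow> 'a set"
  assumes "number_field TYPE('a)"
    and "galois_over_rat TYPE('a)"
    and "order_of_field \<O>"
    and "\<forall>\<gamma>\<in>Gal. \<gamma> ` \<O> = \<O>"
    and "m > 0" and "of_nat m \<in> conductor \<O>"
    and "prime_ideal_choice s m \<O> \<pp>"
  shows "(\<forall>n\<in>field_norms TYPE('a) m.
            n \<in> carrier (principal_norm_monoid s m \<O>) \<longleftrightarrow>
            Theta s m \<O> \<pp> n \<in>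
              carrier (weighted_zero_sum_monoid (class_group s \<O>) Gal_on_classes)) \<and>
         transfer_hom (principal_norm_monoid s m \<O>)
           (weighted_zero_sum_monoid (class_group s \<O>) Gal_on_classes) (Theta s m \<O> \<pp>) \<and>
         fibre_catenary_degree (principal_norm_monoid s m \<O>)
           (weighted_zero_sum_monoid (class_group s \<O>) Gal_on_classes) (Theta s m \<O> \<pp>) \<le> 2"
proof -
  interpret K: Ring.field "ring_of_type_algebra :: 'a ring" by (rule type_ring_field)
  have sub: "subring \<O> ring_of_type_algebra" using assms(3) by (simp add: order_of_field_def)
  have ring: "1 \<in> \<O>" "\<And>x y. x \<in> \<O> \<Longrightarrow> y \<in> \<O> \<Longrightarrow> x + y \<in> \<O>" "\<And>x. x \<in> \<O> \<Longrightarrow> - x \<in> \<O>"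
      "\<And>x y. x \<in> \<O> \<Longrightarrow> y \<in> \<O> \<Longrightarrow> x * y \<in> \<O>" "0 \<in> \<O>"
    using subringE(3)[OF sub] subringE(7)[OF sub] subringE(5)[OF sub] subringE(6)[OF sub] subringE(2)[OF sub]
    by (simp_all add: type_ring_simps type_ring_uminus)
  have ints: "of_int k \<in> \<O>" for k
  proof -
    have "of_nat n \<in> \<O>" for n by (induction n) (auto intro: ring)
    then show ?thesis by (cases k) (auto intro: ring simp del: of_nat_Suc)
  qed
  \<comment> \<open>The rational span of \<open>\<O>\<close> is the whole field, and denominators can be cleared.\<close>
  have frac: "\<exists>d\<in>\<O>. d \<noteq> 0 \<and> d * x \<in> \<O>" for x
  proof -
    have "x \<in> qmod.span \<O>" using assms(3) by (simp add: order_of_field_def)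
    then have "\<exists>d::int. d \<noteq> 0 \<and> of_int d * x \<in> \<O>"
    proof (induction rule: qmod.span_induct_alt)
      case base
      show ?case using ring(5) by (intro exI[of _ 1]) simp
    next
      case (step c x y)
      then obtain d :: int where d: "d \<noteq> 0" "of_int d * y \<in> \<O>" by blast
      obtain a b where q: "quotient_of c = (a, b)" by fastforce
      have ab: "c = of_int a / of_int b" "b > 0" using quotient_of_div[OF q] quotient_of_denom_pos[OF q] by auto
      have cb: "of_int b * of_rat c = (of_int a :: 'a)" 
        unfolding ab(1) of_rat_divide of_rat_of_int_eq using ab(2) by simp
      have "of_int (b * d) * (of_rat c * x + y) = (of_int b * of_rat c) * of_int d * x + of_int b * (of_int d * y)"
        by (simp only: of_int_mult distrib_left ac_simps)
      then have "of_int (b * d) * (of_rat c * x + y) = of_int (a * d) * x + of_int b * (of_int d * y)"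
        unfolding cb by simp
      moreover have "of_int (a * d) * x + of_int b * (of_int d * y) \<in> \<O>" 
        by (rule ring(2)[OF ring(4)[OF ints step(1)] ring(4)[OF ints d(2)]])
      ultimately have "of_int (b * d) * (of_rat c * x + y) \<in> \<O>" by (simp only:)
      then show ?case using ab(2) d(1) by (intro exI[of _ "b * d"]) simp
    qed
    then obtain d :: int where "d \<noteq> 0" "of_int d * x \<in> \<O>" by blast
    then show ?thesis by (intro bexI[of _ "of_int d"] conjI ints) simp_all
  qed
  interpret chosen_primes \<O> m s \<pp> "inertia_degree TYPE('a)"
  proof
    show "\<exists>B. finite B \<and> zspan B = \<O>" using assms(3) by (simp add: order_of_field_def zspan_def)
    show "of_nat m * x \<in> \<O>" if "algebraic_int x" for x
      using assms(6) that by (auto simp: conductor_def ring_of_integers_def)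
  qed (use ring frac assms in simp_all)
  show ?thesis
    using norm_iff_zero_sum lift.transfer_hom_theta lift.fibre_catenary_degree_le_2
    unfolding principal_norm_monoid_lift[symmetric] weighted_zero_sum_monoid_lift[symmetric] by simp
qed

end
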